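(* Let $d,N\ge 1$ be integers, $A=(a_1,\dots,a_N)\in(\mathbb{R}^d)^N$, $P,Q\in(\mathbb{R}^d)^N$, $0<t_0<t_1$, and let $\beta:(0,+\infty)\to(0,+\infty)$ be smooth. Let $f_\varepsilon$, $f$ and $\overline{\nabla} f$ be as in the context. For $\varepsilon>0$ and $\mathcal{X}=(X_t)_{t\in[t_0,t_1]}\in C^0([t_0,t_1];(\mathbb{R}^d)^N)$ set $$L_\varepsilon(\mathcal{X})=\int_{t_0}^{t_1}\left|\dot X_t-\frac{X_t-\nabla f_\varepsilon(t,X_t)}{2t}\right|^2\beta(t)\,dt$$ if $\mathcal{X}\in H^1([t_0,t_1];(\mathbb{R}^d)^N)$, $X_{t_0}\in\{P^\sigma:\sigma\in\mathfrak{S}_N\}$ and $X_{t_1}\in\{Q^\sigma:\sigma\in\mathfrak{S}_N\}$, and $L_\varepsilon(\mathcal{X})=+\infty$ otherwise. Likewise set $$L(\mathcal{X})=\int_{t_0}^{t_1}\left|\dot X_t-\frac{X_t-\overline{\nabla} f(X_t)}{2t}\right|^2\beta(t)\,dt$$ if $\mathcal{X}\in H^1([t_0,t_1];(\mathbb{R}^d)^N)$, $X_{t_0}\in\{P^\sigma:\sigma\in\mathfrak{S}_N\}$ and $X_{t_1}\in\{Q^\sigma:\sigma\in\mathfrak{S}_N\}$, and $L(\mathcal{X})=+\infty$ otherwise. Then, as $\varepsilon\to0$, the family $(L_\varepsilon)_{\varepsilon>0}$ $\Gamma$-converges to $L$ for the topology of uniform convergence of $C^0([t_0,t_1];(\m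athbb{R}^d)^N)$.
   Context: $\mathfrak{S}_N$ is the group of permutations of $\{1,\dots,N\}$. For $X=(x_1,\dots,x_N)\in(\mathbb{R}^d)^N$ and $\sigma\in\mathfrak{S}_N$, $X^\sigma:=(x_{\sigma(1)},\dots,x_{\sigma(N)})$. The dot $\cdot$ and $|\cdot|$ denote the Euclidean inner product and norm on $(\mathbb{R}^d)^N$. For $\varepsilon>0$, $t>0$, $X\in(\mathbb{R}^d)^N$: $$f_\varepsilon(t,X):=\varepsilon t\log\left[\frac1{N!}\sum_{\sigma\in\mathfrak{S}_N}\exp\left(\frac{X\cdot A^\sigma}{\varepsilon t}\right)\right],\qquad f(X):=\max_{\sigma\in\mathfrak{S}_N}X\cdot A^\sigma.$$ $\nabla f_\varepsilon$ is the gradient with respect to $X$. Extended gradient: for a real-valued convex function $h$ on a Euclidean space, $\overline{\nabla} h(X)$ is the element of minimal Euclidean norm of the subdifferential $\partial h(X)$. $\Gamma$-convergence of $L_\varepsilon$ to $L$ as $\varepsilon\to0$ means: (i) whenever $\mathcal{X}^\varepsilon\to\mathcal{X}$ uniformly, $L(\mathcal{X})\le\liminf_{\varepsilon\to0}L_\varepsilon(\mathcal{X}^\varepsilon)$; (ii) for every $\mathcal{X}$ there is a family $\mathcal{X}^\varepsilon\to\mathcal{X}$ uniformly with $\limsup_{\varepsilon\to0}L_\varepsilon(\mathcal{X}^\varepsilon)\le L(\mathcal{X})$. *)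

theory Defs
  imports "HOL-Analysis.Analysis"
begin

section \<open>Permutations of point configurations\<close>

text \<open>A configuration of N points in d-dimensional space has type \<open>(real ^ 'd) ^ 'n\<close>, with
  \<open>N = CARD('n)\<close> and \<open>d = CARD('d)\<close>; the norm and inner product of this type are
  the Euclidean ones.\<close>

abbreviation perms :: "('n::finite \<Rightarrow> 'n) set" where
  "perms \<equiv> {\<sigma>. \<sigma> permutes (UNIV :: 'n set)}"

definition permute_conf :: "'a ^ 'n \<Rightarrow> ('n \<Rightarrow> 'n) \<Rightarrow> 'a ^ ('n::finite)" where
  "permute_conf X \<sigma> = (\<chi> i. X $ \<sigma> i)"

definition orbit_conf :: "'a ^ ('n::finite) \<Rightarrow> ('a ^ 'n) set" where
  "orbit_conf P = permute_conf P ` perms"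

section \<open>The potentials and their gradients\<close>

definition f_eps :: "(real ^ 'd) ^ ('n::finite) \<Rightarrow> real \<Rightarrow> real \<Rightarrow> (real ^ 'd::finite) ^ 'n \<Rightarrow> real" where
  "f_eps A \<epsilon> t X =
     \<epsilon> * t * ln ((1 / fact CARD('n)) * (\<Sum>\<sigma>\<in>perms. exp ((X \<bullet> permute_conf A \<sigma>) / (\<epsilon> * t))))"

definition f_max :: "(real ^ 'd) ^ ('n::finite) \<Rightarrow> (real ^ 'd::finite) ^ 'n \<Rightarrow> real" where
  "f_max A X = (MAX \<sigma>\<in>perms. X \<bullet> permute_conf A \<sigma>)"

definition gradient :: "('a::real_inner \<Rightarrow> real) \<Rightarrow> 'a \<Rightarrow> 'a" where
  "gradient h X = (THE D. GDERIV h X :> D)"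

definition subdifferential :: "('a::real_inner \<Rightarrow> real) \<Rightarrow> 'a \<Rightarrow> 'a set" where
  "subdifferential h X = {p. \<forall>Y. h Y \<ge> h X + p \<bullet> (Y - X)}"

text \<open>For real-valued convex \<open>h\<close> on a Euclidean space the subdifferential is nonempty, closed and
  convex, so the minimiser exists and is unique.\<close>

definition ext_gradient :: "('a::real_inner \<Rightarrow> real) \<Rightarrow> 'a \<Rightarrow> 'a" where
  "ext_gradient h X = arg_min_on norm (subdifferential h X)"

section \<open>The Sobolev space H1 of curves\<close>

definition square_integrable_on :: "real \<Rightarrow> real \<Rightarrow> (real \<Rightarrow> 'a::euclidean_space) \<Rightarrow> bool" where
  "square_integrable_on a b V \<longleftrightarrow>
     V \<in> borel_measurable (lebesgue_on {a..b}) \<and>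
     integrable (lebesgue_on {a..b}) (\<lambda>t. (norm (V t))\<^sup>2)"

text \<open>Test functions are continuously differentiable with compact support in the open interval.\<close>

definition test_function :: "real \<Rightarrow> real \<Rightarrow> (real \<Rightarrow> real) \<Rightarrow> bool" where
  "test_function a b \<phi> \<longleftrightarrow>
     \<phi> C1_differentiable_on UNIV \<and> closure {t. \<phi> t \<noteq> 0} \<subseteq> {a<..<b}"

definition is_weak_derivative ::
  "real \<Rightarrow> real \<Rightarrow> (real \<Rightarrow> 'a::euclidean_space) \<Rightarrow> (real \<Rightarrow> 'a) \<Rightarrow> bool" where
  "is_weak_derivative a b X V \<longleftrightarrow>
     square_integrable_on a b V \<and>
     (\<forall>\<phi>. test_function a b \<phi> \<longrightarrow>
        (LINT t|lebesgue_on {a..b}. deriv \<phi> t *\<^sub>R X t) =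
        - (LINT t|lebesgue_on {a..b}. \<phi> t *\<^sub>R V t))"

definition H1_on :: "real \<Rightarrow> real \<Rightarrow> (real \<Rightarrow> 'a::euclidean_space) \<Rightarrow> bool" where
  "H1_on a b X \<longleftrightarrow> square_integrable_on a b X \<and> (\<exists>V. is_weak_derivative a b X V)"

text \<open>The weak derivative is unique up to null sets, so the choice of the representative does
  not affect the integrals below.\<close>

definition weak_derivative ::
  "real \<Rightarrow> real \<Rightarrow> (real \<Rightarrow> 'a::euclidean_space) \<Rightarrow> real \<Rightarrow> 'a" where
  "weak_derivative a b X = (SOME V. is_weak_derivative a b X V)"

section \<open>The functionals\<close>

text \<open>The field \<open>G\<close> stands for the (extended) gradient of the potential.\<close>

definition action ::
  "(real \<Rightarrow> real) \<Rightarrow> real \<Rightarrow> real \<Rightarrow> (real ^ 'd) ^ 'n \<Rightarrow> (real ^ 'd) ^ 'n \<Rightarrow>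
   (real \<Rightarrow> (real ^ 'd) ^ 'n \<Rightarrow> (real ^ 'd) ^ 'n) \<Rightarrow>
   (real \<Rightarrow> (real ^ 'd::finite) ^ ('n::finite)) \<Rightarrow> ennreal" where
  "action \<beta> t\<^sub>0 t\<^sub>1 P Q G X =
     (if H1_on t\<^sub>0 t\<^sub>1 X \<and> X t\<^sub>0 \<in> orbit_conf P \<and> X t\<^sub>1 \<in> orbit_conf Q
      then \<integral>\<^sup>+ t. ennreal ((norm (weak_derivative t\<^sub>0 t\<^sub>1 X t
                              - (1 / (2 * t)) *\<^sub>R (X t - G t (X t))))\<^sup>2 * \<beta> t)
           \<partial>lebesgue_on {t\<^sub>0..t\<^sub>1}
      else \<infinity>)"

definition L_eps ::
  "(real ^ 'd) ^ 'n \<Rightarrow> (real \<Rightarrow> real) \<Rightarrow> real \<Rightarrow> real \<Rightarrow> (real ^ 'd) ^ 'n \<Rightarrow> (real ^ 'd) ^ 'n \<Rightarrow>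
   real \<Rightarrow> (real \<Rightarrow> (real ^ 'd::finite) ^ ('n::finite)) \<Rightarrow> ennreal" where
  "L_eps A \<beta> t\<^sub>0 t\<^sub>1 P Q \<epsilon> = action \<beta> t\<^sub>0 t\<^sub>1 P Q (\<lambda>t. gradient (f_eps A \<epsilon> t))"

definition L_lim ::
  "(real ^ 'd) ^ 'n \<Rightarrow> (real \<Rightarrow> real) \<Rightarrow> real \<Rightarrow> real \<Rightarrow> (real ^ 'd) ^ 'n \<Rightarrow> (real ^ 'd) ^ 'n \<Rightarrow>
   (real \<Rightarrow> (real ^ 'd::finite) ^ ('n::finite)) \<Rightarrow> ennreal" where
  "L_lim A \<beta> t\<^sub>0 t\<^sub>1 P Q = action \<beta> t\<^sub>0 t\<^sub>1 P Q (\<lambda>t. ext_gradient (f_max A))"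

section \<open>Gamma-convergence\<close>

text \<open>Elements of the space of continuous curves are represented by functions on the reals that
  are continuous on the interval; their values outside the interval are irrelevant for the
  functionals above.\<close>

definition Gamma_converges_uniformly ::
  "real \<Rightarrow> real \<Rightarrow> (real \<Rightarrow> (real \<Rightarrow> 'a::metric_space) \<Rightarrow> ennreal) \<Rightarrow>
   ((real \<Rightarrow> 'a) \<Rightarrow> ennreal) \<Rightarrow> bool" where
  "Gamma_converges_uniformly a b F\<^sub>\<epsilon> F \<longleftrightarrow>
     (\<forall>\<X> X. (\<forall>\<epsilon>>0. continuous_on {a..b} (\<X> \<epsilon>)) \<and> continuous_on {a..b} X \<and>
             uniform_limit {a..b} \<X> X (at_right 0) \<longrightarrow>
             F X \<le> Liminf (at_right 0) (\<lambda>\<epsilon>. F\<^sub>\<epsilon> \<epsilon> (\<X> \<epsilon>))) \<and>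
     (\<forall>X. continuous_on {a..b} X \<longrightarrow>
        (\<exists>\<X>. (\<forall>\<epsilon>>0. continuous_on {a..b} (\<X> \<epsilon>)) \<and>
             uniform_limit {a..b} \<X> X (at_right 0) \<and>
             Limsup (at_right 0) (\<lambda>\<epsilon>. F\<^sub>\<epsilon> \<epsilon> (\<X> \<epsilon>)) \<le> F X))"

section \<open>Smooth functions on the positive half-line\<close>

definition smooth_on_pos :: "(real \<Rightarrow> real) \<Rightarrow> bool" where
  "smooth_on_pos \<beta> \<longleftrightarrow> (\<forall>k. \<forall>t>0. (deriv ^^ k) \<beta> field_differentiable at t)"

end

theory Submission
  imports Defs
begin

text \<open>
  Write \<open>X\<^sub>t = t Z\<^sub>t\<close>. The approximate potential satisfies \<open>f\<^sub>\<epsilon>(t, X) = t F\<^sub>\<epsilon>(X / t)\<close>, where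
  \<open>F\<^sub>\<epsilon> z = \<epsilon> log (mean of exp (z \<bullet> A\<^sup>\<sigma> / \<epsilon>))\<close> is a soft maximum, and the limit potential \<open>f\<close> is positively
  homogeneous of degree one. In the variable \<open>Z\<close> time therefore disappears from the potentials, and
  both functionals become integrals of
  \<open>\<beta>(t) |t Z' + Z / 2 + G / (2 t)|\<^sup>2\<close>, where \<open>G\<close> is \<open>\<nabla>F\<^sub>\<epsilon>(Z)\<close> or the subgradient of least norm of \<open>f\<close> at \<open>Z\<close>.

  Expanding the square leaves \<open>t\<^sup>2 |Z'|\<^sup>2\<close>, \<open>|G|\<^sup>2 / (4 t\<^sup>2)\<close>, and terms that are harmless: \<open>|Z|\<^sup>2 / 4\<close>; the product
  \<open>Z \<bullet> G\<close>, which is \<open>f(Z)\<close> up to \<open>\<epsilon> log N!\<close>, by homogeneity; and \<open>Z \<bullet> Z'\<close> and \<open>G \<bullet> Z'\<close>, which are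
  derivatives along the curve of \<open>|Z|\<^sup>2 / 2\<close> and of the potential. That last identity holds for every
  measurable choice of subgradients (\<open>convex_chain_rule\<close>), so after an integration by parts against \<open>\<beta>\<close> the
  cross terms depend only on the potential and on the curve, and pass to uniform limits
  (\<open>energy_expand\<close>). Only \<open>|Z'|\<^sup>2\<close> and \<open>|G|\<^sup>2\<close> remain to be controlled.

  Lower bound (\<open>energy_liminf\<close>). Along curves of bounded energy the pairs of velocity and gradient are bounded in
  \<open>L\<^sup>2\<close>, and by Mazur's argument (\<open>mazur_midpoint\<close>) suitable convex combinations of them converge almost
  everywhere. All that has to be remembered is convex: being the velocity of a curve close to \<open>Z\<close>, being
  almost a subgradient of \<open>f\<close> at \<open>Z\<close>, having energy at most \<open>m\<close>. The limit is the velocity of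
  \<open>Z\<close> together with some subgradient of \<open>f\<close> along \<open>Z\<close>, with energy at most \<open>m\<close>. Replacing that subgradient
  by the one of least norm decreases \<open>|G|\<^sup>2\<close> and, by the expansion, changes nothing else.

  Recovery family (\<open>energy_limsup\<close>). Take \<open>Z\<^sup>\<epsilon>\<^sub>t = (id + \<tau> \<nabla>F\<^sub>\<epsilon>)\<^sup>-\<^sup>1 Z\<^sub>t\<close> with
  \<open>\<tau> = \<surd>\<epsilon> (t - t\<^sub>0) (t\<^sub>1 - t)\<close>. The endpoints do not move. The resolvent is nonexpansive, so
  \<open>|(Z\<^sup>\<epsilon>)'| \<le> |Z'| + O(\<surd>\<epsilon>)\<close>. Finally \<open>|\<nabla>F\<^sub>\<epsilon>(Z\<^sup>\<epsilon>)|\<^sup>2 \<le> |p|\<^sup>2 + 2 \<epsilon> log N! / \<tau>\<close> for every subgradient \<open>p\<close> of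
  \<open>f\<close> at \<open>Z\<^sub>t\<close>, in particular for the one of least norm, and \<open>\<epsilon> / \<tau> \<rightarrow> 0\<close> inside the interval.
\<close>

section \<open>Mazur combinations in \<open>L\<^sup>2\<close>\<close>

lemma norm_mid_sq:
  fixes x y :: "'e::real_inner"
  shows "(norm ((1/2) *\<^sub>R (x + y)))\<^sup>2 = (norm x)\<^sup>2 / 2 + (norm y)\<^sup>2 / 2 - (norm (x - y))\<^sup>2 / 4"
  by (simp add: power_mult_distrib power2_norm_eq_inner inner_simps inner_commute field_simps)

lemma norm_mid_sq_le:
  fixes x y :: "'e::real_inner"
  shows "(norm ((1/2) *\<^sub>R (x + y)))\<^sup>2 \<le> (norm x)\<^sup>2 / 2 + (norm y)\<^sup>2 / 2"
  unfolding norm_mid_sq by simp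

lemma norm_sub_sq_le:
  fixes x y :: "'e::real_inner"
  shows "(norm (x - y))\<^sup>2 \<le> 2 * (norm x)\<^sup>2 + 2 * (norm y)\<^sup>2"
proof -
  have "0 \<le> (norm ((1/2) *\<^sub>R (x + y)))\<^sup>2" by simp
  thus ?thesis unfolding norm_mid_sq by linarith
qed

lemma norm_add_sq_le:
  fixes x y :: "'e::real_inner"
  shows "(norm (x + y))\<^sup>2 \<le> 2 * (norm x)\<^sup>2 + 2 * (norm y)\<^sup>2"
  using norm_sub_sq_le[of x "- y"] by simp

lemma (in finite_measure) integrable_of_norm_sq:
  fixes f :: "'a \<Rightarrow> 'e::euclidean_space"
  assumes "f \<in> borel_measurable M" "integrable M (\<lambda>x. (norm (f x))\<^sup>2)"
  shows "integrable M f"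
proof (rule Bochner_Integration.integrable_bound[of M "\<lambda>x. 1 + (norm (f x))\<^sup>2"])
  show "AE x in M. norm (f x) \<le> norm (1 + (norm (f x))\<^sup>2)"
  proof (rule AE_I2)
    fix x
    have "0 \<le> (1 - norm (f x))\<^sup>2" by (rule zero_le_power2)
    hence "norm (f x) \<le> 1 + (norm (f x))\<^sup>2"
      unfolding power2_diff one_power2 mult_1_right using norm_ge_zero[of "f x"] by linarith
    thus "norm (f x) \<le> norm (1 + (norm (f x))\<^sup>2)" by simp
  qed
qed (use assms in auto)

text \<open>Weak compactness in \<open>L\<^sup>2\<close> together with Mazur's lemma, in the form used below: each \<open>H n\<close> collects the
  functions that satisfy some convex constraint with tolerance \<open>1 / n\<close>, and the limit \<open>u\<close> satisfies the
  constraint exactly. Almost minimal elements of the \<open>H n\<close> form a Cauchy sequence: the infima of the squared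
  norms increase to a limit, the midpoint of two almost minimal elements lies in the larger of their two sets,
  so its norm cannot be much smaller, and by the parallelogram law the two are close. This is why closure under
  midpoints is all that is asked of \<open>H\<close>.\<close>

lemma (in finite_measure) mazur_midpoint:
  fixes H :: "nat \<Rightarrow> ('a \<Rightarrow> 'e::euclidean_space) set"
  assumes decr: "\<And>m n. m \<le> n \<Longrightarrow> H n \<subseteq> H m"
    and ne: "\<And>n. H n \<noteq> {}"
    and mid: "\<And>n f g. f \<in> H n \<Longrightarrow> g \<in> H n \<Longrightarrow> (\<lambda>x. (1/2) *\<^sub>R (f x + g x)) \<in> H n"
    and meas: "\<And>f. f \<in> H 0 \<Longrightarrow> f \<in> borel_measurable M"
    and int: "\<And>f. f \<in> H 0 \<Longrightarrow> integrable M (\<lambda>x. (norm (f x))\<^sup>2)"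
    and bd: "\<And>f. f \<in> H 0 \<Longrightarrow> (\<integral>x. (norm (f x))\<^sup>2 \<partial>M) \<le> C"
  obtains f u where "\<And>k. f k \<in> H k" "u \<in> borel_measurable M" "integrable M (\<lambda>x. (norm (u x))\<^sup>2)"
    "AE x in M. (\<lambda>k. f k x) \<longlonglongrightarrow> u x" "(\<lambda>k. \<integral>x. norm (f k x - u x) \<partial>M) \<longlonglongrightarrow> 0"
proof -
  define N where "N f = (\<integral>x. (norm (f x))\<^sup>2 \<partial>M)" for f :: "'a \<Rightarrow> 'e"
  have H0: "f \<in> H 0" if "f \<in> H n" for f n using decr[of 0 n] that by auto
  have N0: "0 \<le> N f" for f unfolding N_def by simp
  define d where "d n = Inf (N ` H n)" for n
  have bdb: "bdd_below (N ` H n)" for n by (rule bdd_belowI[of _ 0]) (use N0 in auto)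
  have d_le: "d n \<le> N f" if "f \<in> H n" for f n
    unfolding d_def by (rule cInf_lower) (use that bdb in auto)
  have d_mono: "d m \<le> d n" if "m \<le> n" for m n
    unfolding d_def by (rule cInf_superset_mono[OF _ bdb image_mono]) (use that ne decr in auto)
  have d_bd: "d n \<le> C" for n
  proof -
    obtain f where "f \<in> H n" using ne by blast
    thus ?thesis using d_le[of f n] bd[OF H0[of f n]] by (simp add: N_def)
  qed
  have bda: "bdd_above (range d)" by (rule bdd_aboveI[of _ C]) (use d_bd in auto)
  define D where "D = Sup (range d)"
  have dD: "d n \<le> D" for n unfolding D_def by (rule cSup_upper) (use bda in auto)
  have ex: "\<exists>n\<ge>k. D - (1/4)^k < d n" for k :: nat
  proof -
    have "D - (1/4)^k < Sup (range d)" unfolding D_def by simp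
    then obtain n where n: "D - (1/4)^k < d n" using less_cSup_iff[of "range d"] bda by auto
    have "d n \<le> d (max n k)" by (rule d_mono) simp
    with n show ?thesis by (intro exI[of _ "max n k"]) auto
  qed
  have "\<exists>n g. k \<le> n \<and> D - (1/4)^k < d n \<and> g \<in> H n \<and> N g < D + (1/4)^k" for k :: nat
  proof -
    obtain n where n: "k \<le> n" "D - (1/4)^k < d n" using ex by blast
    have "Inf (N ` H n) < D + (1/4)^k" using dD[of n] unfolding d_def[symmetric]
      by (rule le_less_trans) simp
    then obtain g where "g \<in> H n" "N g < D + (1/4)^k"
      using cInf_less_iff[of "N ` H n"] ne bdb by auto
    with n show ?thesis by blast
  qed
  then obtain n f where nf: "\<And>k::nat. k \<le> n k \<and> D - (1/4)^k < d (n k) \<and> f k \<in> H (n k) \<and> N (f k) < D + (1/4)^k"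
    by metis
  have nfN: "N (f k) < D + (1/4)^k" for k using nf by blast
  have fH: "f k \<in> H k" for k using nf[of k] decr[of k "n k"] by blast
  have fH0: "f k \<in> H 0" for k using fH H0 by blast
  have fm[measurable]: "f k \<in> borel_measurable M" for k using meas fH0 by blast
  have fsq: "integrable M (\<lambda>x. (norm (f k x))\<^sup>2)" for k using int fH0 by blast
  have fi: "integrable M (f k)" for k by (rule integrable_of_norm_sq) (use fsq in auto)
  have dsq: "integrable M (\<lambda>x. (norm (f k x - f l x))\<^sup>2)" for k l
    by (rule Bochner_Integration.integrable_bound[of M "\<lambda>x. 2 * (norm (f k x))\<^sup>2 + 2 * (norm (f l x))\<^sup>2"])
       (use fsq norm_sub_sq_le in auto)
  have close: "(\<integral>x. (norm (f k x - f (Suc k) x))\<^sup>2 \<partial>M) \<le> 8 * (1/4)^k" for k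
  proof -
    let ?m = "min (n k) (n (Suc k))"
    have pw: "(1/4::real)^Suc k \<le> (1/4)^k" by simp
    have dm: "D - (1/4)^k < d ?m" using nf[of k] nf[of "Suc k"] pw
      by (metis diff_left_mono le_less_trans min_def)
    have "(\<lambda>x. (1/2) *\<^sub>R (f k x + f (Suc k) x)) \<in> H ?m"
      by (rule mid) (use nf[of k] nf[of "Suc k"] decr[of ?m "n k"] decr[of ?m "n (Suc k)"] in auto)
    from d_le[OF this] have "d ?m \<le> N (\<lambda>x. (1/2) *\<^sub>R (f k x + f (Suc k) x))" .
    also have "\<dots> = N (f k) / 2 + N (f (Suc k)) / 2 - (\<integral>x. (norm (f k x - f (Suc k) x))\<^sup>2 \<partial>M) / 4"
      unfolding N_def norm_mid_sq using fsq dsq by simp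
    finally show ?thesis using dm nfN[of k] nfN[of "Suc k"] pw by linarith
  qed
  define g where "g k x = norm (f (Suc k) x - f k x)" for k x
  have gn: "norm (g k x) = g k x" and g0: "0 \<le> g k x" for k x unfolding g_def by auto
  have gi: "integrable M (g k)" for k unfolding g_def using fi by simp
  \<comment> \<open>Young's inequality with weight \<open>2 ^ k\<close> turns the \<open>L\<^sup>2\<close> bound into a summable \<open>L\<^sup>1\<close> bound.\<close>
  have gL1: "(\<integral>x. g k x \<partial>M) \<le> (8 + measure M (space M)) * (1/2)^k" for k
  proof -
    have p: "(2::real)^k * (1/2)^k = 1" using power_mult_distrib[of "2::real" "1/2" k] by simp
    have q: "(2::real)^k * (1/4)^k = (1/2)^k" using power_mult_distrib[of "2::real" "1/4" k] by simp
    have "(\<integral>x. g k x \<partial>M) \<le> (\<integral>x. 2^k * (norm (f k x - f (Suc k) x))\<^sup>2 + (1/2)^k \<partial>M)"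
    proof (rule integral_mono)
      fix x
      have "0 \<le> 2^k * (g k x - (1/2)^k)\<^sup>2" by simp
      also have "\<dots> = 2^k * (g k x)\<^sup>2 - 2 * g k x * (2^k * (1/2)^k) + (1/2)^k * (2^k * (1/2)^k)"
        by (simp add: power2_eq_square algebra_simps)
      finally have "2 * g k x \<le> 2^k * (g k x)\<^sup>2 + (1/2)^k" unfolding p by simp
      moreover have "0 \<le> g k x" unfolding g_def by simp
      ultimately have "g k x \<le> 2^k * (g k x)\<^sup>2 + (1/2)^k" by linarith
      thus "g k x \<le> 2^k * (norm (f k x - f (Suc k) x))\<^sup>2 + (1/2)^k"
        unfolding g_def by (metis norm_minus_commute)
    qed (use gi dsq in auto)
    also have "\<dots> = 2^k * (\<integral>x. (norm (f k x - f (Suc k) x))\<^sup>2 \<partial>M) + measure M (space M) * (1/2)^k"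
      using dsq by simp
    also have "\<dots> \<le> 2^k * (8 * (1/4)^k) + measure M (space M) * (1/2)^k"
      by (intro add_right_mono mult_left_mono close) simp
    also have "\<dots> = (8 + measure M (space M)) * (1/2)^k" using q by (simp add: algebra_simps)
    finally show ?thesis .
  qed
  have sumI: "summable (\<lambda>k. \<integral>x. norm (g k x) \<partial>M)"
  proof (rule summable_comparison_test)
    show "\<exists>N. \<forall>k\<ge>N. norm (\<integral>x. norm (g k x) \<partial>M) \<le> (8 + measure M (space M)) * (1/2)^k"
      using gL1 by (auto simp: g_def)
  qed (intro summable_mult summable_geometric, simp)
  have AEs: "AE x in M. summable (\<lambda>k. norm (g k x))"
  proof -
    have "(\<integral>\<^sup>+x. (\<Sum>k. ennreal (g k x)) \<partial>M) = (\<Sum>k. \<integral>\<^sup>+x. ennreal (g k x) \<partial>M)"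
      by (rule nn_integral_suminf) (auto simp: g_def)
    also have "\<dots> = (\<Sum>k. ennreal (\<integral>x. norm (g k x) \<partial>M))"
      by (intro suminf_cong) (subst nn_integral_eq_integral, use gi g0 in \<open>auto simp: gn\<close>)
    also have "\<dots> = ennreal (\<Sum>k. \<integral>x. norm (g k x) \<partial>M)"
      by (rule suminf_ennreal2) (use sumI in auto)
    finally have "(\<integral>\<^sup>+x. (\<Sum>k. ennreal (g k x)) \<partial>M) \<noteq> \<infinity>" by simp
    hence "AE x in M. (\<Sum>k. ennreal (g k x)) \<noteq> \<infinity>"
      by (intro nn_integral_PInf_AE) (auto simp: g_def)
    thus ?thesis
    proof eventually_elim
      case (elim x)
      hence "summable (\<lambda>k. g k x)" by (intro summable_suminf_not_top) (auto simp: g0)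
      thus ?case unfolding gn .
    qed
  qed
  have Si: "integrable M (\<lambda>x. \<Sum>k. g k x)"
    by (rule integrable_suminf[OF gi AEs sumI])
  define u where "u x = lim (\<lambda>k. f k x)" for x
  have um[measurable]: "u \<in> borel_measurable M" unfolding u_def by measurable
  have conv: "(\<lambda>k. f k x) \<longlonglongrightarrow> u x \<and> (\<forall>k. norm (f k x) \<le> norm (f 0 x) + (\<Sum>k. g k x))"
    if s: "summable (\<lambda>k. norm (g k x))" for x
  proof -
    have s2: "summable (\<lambda>k. f (Suc k) x - f k x)"
      by (rule summable_norm_cancel) (use s in \<open>simp add: g_def\<close>)
    have tel: "(\<Sum>i<k. f (Suc i) x - f i x) = f k x - f 0 x" for k
      by (rule sum_lessThan_telescope)
    from s2 have "convergent (\<lambda>k. \<Sum>i<k. f (Suc i) x - f i x)" by (simp add: summable_iff_convergent)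
    hence "convergent (\<lambda>k. f k x - f 0 x)" unfolding tel .
    hence "convergent (\<lambda>k. f k x)" using convergent_add_const_iff[of "- f 0 x" "\<lambda>k. f k x"] by simp
    moreover have "norm (f k x) \<le> norm (f 0 x) + (\<Sum>k. g k x)" for k
    proof -
      have "norm (f k x - f 0 x) \<le> (\<Sum>i<k. g i x)"
        unfolding tel[symmetric] g_def by (rule norm_sum)
      also have "\<dots> \<le> (\<Sum>k. g k x)" by (rule sum_le_suminf) (use s in \<open>auto simp: g_def\<close>)
      finally show ?thesis using norm_triangle_sub[of "f k x" "f 0 x"] by simp
    qed
    ultimately show ?thesis unfolding u_def using convergent_LIMSEQ_iff by blast
  qed
  have AEc: "AE x in M. (\<lambda>k. f k x) \<longlonglongrightarrow> u x" using AEs by eventually_elim (use conv in blast)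
  define w where "w x = norm (f 0 x) + (\<Sum>k. g k x)" for x
  have wi: "integrable M w" unfolding w_def using Si fi by simp
  have AEw: "AE x in M. \<forall>k. norm (f k x) \<le> w x" using AEs by eventually_elim (use conv in \<open>auto simp: w_def\<close>)
  have AEu: "AE x in M. norm (u x) \<le> w x" using AEw AEc
  proof eventually_elim
    case (elim x)
    show ?case by (rule LIMSEQ_le_const2[OF tendsto_norm[OF elim(2)]]) (use elim in auto)
  qed
  have usq: "integrable M (\<lambda>x. (norm (u x))\<^sup>2)"
  proof (rule integrableI_bounded)
    have "(\<integral>\<^sup>+x. ennreal (norm ((norm (u x))\<^sup>2)) \<partial>M) = (\<integral>\<^sup>+x. liminf (\<lambda>k. ennreal ((norm (f k x))\<^sup>2)) \<partial>M)"
    proof (rule nn_integral_cong_AE, use AEc in eventually_elim)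
      case (elim x)
      have "(\<lambda>k. ennreal ((norm (f k x))\<^sup>2)) \<longlonglongrightarrow> ennreal ((norm (u x))\<^sup>2)"
        by (intro tendsto_ennrealI tendsto_power tendsto_norm elim)
      from lim_imp_Liminf[OF _ this] show ?case by simp
    qed
    also have "\<dots> \<le> liminf (\<lambda>k. \<integral>\<^sup>+x. ennreal ((norm (f k x))\<^sup>2) \<partial>M)"
      by (rule nn_integral_liminf) simp
    also have "\<dots> = liminf (\<lambda>k. ennreal (N (f k)))"
      unfolding N_def by (subst nn_integral_eq_integral[OF fsq]) auto
    also have "\<dots> \<le> liminf (\<lambda>k::nat. ennreal C)"
      by (rule Liminf_mono) (use bd[OF fH0] in \<open>auto simp: N_def intro!: always_eventually ennreal_leI\<close>)
    also have "\<dots> < \<infinity>" by (simp add: Liminf_const)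
    finally show "(\<integral>\<^sup>+x. ennreal (norm ((norm (u x))\<^sup>2)) \<partial>M) < \<infinity>" .
  qed simp
  have L1: "(\<lambda>k. \<integral>x. norm (f k x - u x) \<partial>M) \<longlonglongrightarrow> (\<integral>x. 0 \<partial>M)"
  proof (rule integral_dominated_convergence[where w="\<lambda>x. 2 * w x"])
    show "AE x in M. (\<lambda>k. norm (f k x - u x)) \<longlonglongrightarrow> 0" using AEc
      by eventually_elim (simp add: LIM_zero_iff tendsto_norm_zero_iff)
    fix k show "AE x in M. norm (norm (f k x - u x)) \<le> 2 * w x" using AEw AEu
    proof eventually_elim
      case (elim x) thus ?case using norm_triangle_ineq4[of "f k x" "u x"]
        by (simp, use elim in \<open>metis add_mono mult_2 order_trans\<close>)
    qed
  qed (use wi in auto)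
  show ?thesis by (rule that[OF fH um usq AEc]) (use L1 in simp)
qed

section \<open>Difference quotients of primitives and a chain rule for convex functions\<close>

lemma small_multiple_of_length:
  fixes a b e :: real
  assumes "e > 0" "a \<le> b"
  obtains d where "d > 0" "d * (b - a) < e"
proof
  show "e / (b - a + 1) > 0" using assms by simp
  have "e / (b - a + 1) * (b - a) < e / (b - a + 1) * (b - a + 1)"
    using assms by (intro mult_strict_left_mono) auto
  thus "e / (b - a + 1) * (b - a) < e" using assms by simp
qed

text \<open>A Lebesgue measurable function is almost everywhere a limit of continuous ones. Truncating \<open>v\<close>
  and these functions by the projection to a large ball, which is continuous, turns that into convergence in \<open>L\<^sup>1\<close>.\<close>

lemma L1_approx_continuous:
  fixes v :: "real \<Rightarrow> 'e::euclidean_space"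
  assumes v: "integrable (lebesgue_on {a..b}) v" and e: "e > 0"
  obtains g where "continuous_on UNIV g" "(\<integral>x. norm (v x - g x) \<partial>lebesgue_on {a..b}) < e"
proof -
  let ?M = "lebesgue_on {a..b}"
  interpret finite_measure ?M by (rule finite_measure_lebesgue_on) simp
  have vm[measurable]: "v \<in> borel_measurable ?M" using v by simp
  define T where "T K = closest_point (cball (0::'e) K)" for K
  have Tc: "continuous_on UNIV (T (real K))" for K unfolding T_def
    by (rule continuous_on_closest_point) auto
  have Tm[measurable]: "T (real K) \<in> borel_measurable borel" for K
    using Tc by (rule borel_measurable_continuous_onI)
  have TK: "norm (T (real K) y) \<le> real K" for K y
    using closest_point_in_set[of "cball (0::'e) (real K)" y] unfolding T_def by simp
  have Tid: "T K y = y" if "norm y \<le> K" for K y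
    unfolding T_def by (rule closest_point_self) (use that in simp)
  have Tle: "norm (T (real K) y) \<le> norm y" for K y
    using closest_point_lipschitz[of "cball (0::'e) (real K)" y 0] Tid[of 0 "real K"] unfolding T_def by simp
  have "(\<lambda>K. \<integral>x. norm (v x - T (real K) (v x)) \<partial>?M) \<longlonglongrightarrow> (\<integral>x. 0 \<partial>?M)"
  proof (rule integral_dominated_convergence[where w="\<lambda>x. 2 * norm (v x)"])
    show "AE x in ?M. (\<lambda>K. norm (v x - T (real K) (v x))) \<longlonglongrightarrow> 0"
    proof (rule AE_I2)
      fix x
      obtain k :: nat where k: "norm (v x) \<le> real k" using real_arch_simple by blast
      have "eventually (\<lambda>K. norm (v x - T (real K) (v x)) = 0) sequentially"
        using eventually_ge_at_top[of k] by eventually_elim (subst Tid, use k in auto)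
      thus "(\<lambda>K. norm (v x - T (real K) (v x))) \<longlonglongrightarrow> 0" by (rule tendsto_eventually)
    qed
    fix K show "AE x in ?M. norm (norm (v x - T (real K) (v x))) \<le> 2 * norm (v x)"
    proof (rule AE_I2)
      fix x show "norm (norm (v x - T (real K) (v x))) \<le> 2 * norm (v x)"
        using norm_triangle_ineq4[of "v x" "T (real K) (v x)"] Tle[of K "v x"] by simp
    qed
  qed (use v in auto)
  hence "eventually (\<lambda>K. (\<integral>x. norm (v x - T (real K) (v x)) \<partial>?M) < e / 2) sequentially"
    using e by (intro order_tendstoD(2)[of _ "\<integral>x. 0 \<partial>?M"]) auto
  then obtain K :: nat where K: "(\<integral>x. norm (v x - T (real K) (v x)) \<partial>?M) < e / 2"
    unfolding eventually_sequentially by blast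
  have "v measurable_on {a..b}" using vm by (subst measurable_on_iff_borel_measurable) auto
  then obtain N g where N: "negligible N" and gc: "\<And>n. continuous_on UNIV (g n)"
    and lim: "\<And>x. x \<notin> N \<Longrightarrow> (\<lambda>n. g n x) \<longlonglongrightarrow> (if x \<in> {a..b} then v x else 0)"
    unfolding measurable_on_def by (auto simp: if_distrib)
  have AE: "AE x in ?M. (\<lambda>n. g n x) \<longlonglongrightarrow> v x"
  proof -
    have "AE x in lebesgue. x \<notin> N" using N unfolding negligible_iff_null_sets by (rule AE_not_in)
    hence "AE x in ?M. x \<notin> N" by (subst AE_restrict_space_iff) auto
    moreover have "AE x in ?M. x \<in> {a..b}" by (rule AE_I2) simp
    ultimately show ?thesis
    proof eventually_elim
      case (elim x) thus ?case using lim[of x] by simp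
    qed
  qed
  have gm[measurable]: "g n \<in> borel_measurable ?M" for n
    by (intro measurable_restrict_space1 measurable_completion) (use gc[of n] in \<open>simp add: borel_measurable_continuous_onI\<close>)
  have iT: "integrable ?M (\<lambda>x. T (real K) (v x))"
    by (rule Bochner_Integration.integrable_bound[OF v]) (use Tle in auto)
  have iG: "integrable ?M (\<lambda>x. T (real K) (g n x))" for n
    by (rule integrable_const_bound[where B="real K"]) (use TK in auto)
  have "(\<lambda>n. \<integral>x. norm (T (real K) (v x) - T (real K) (g n x)) \<partial>?M) \<longlonglongrightarrow> (\<integral>x. 0 \<partial>?M)"
  proof (rule integral_dominated_convergence[where w="\<lambda>x. 2 * real K"])
    show "AE x in ?M. (\<lambda>n. norm (T (real K) (v x) - T (real K) (g n x))) \<longlonglongrightarrow> 0" using AE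
    proof eventually_elim
      case (elim x)
      have "(\<lambda>n. T (real K) (g n x)) \<longlonglongrightarrow> T (real K) (v x)"
        using continuous_on_tendsto_compose[OF Tc elim] by simp
      from tendsto_norm[OF tendsto_diff[OF tendsto_const this, of "T (real K) (v x)"]] show ?case by simp
    qed
    fix n show "AE x in ?M. norm (norm (T (real K) (v x) - T (real K) (g n x))) \<le> 2 * real K"
    proof (rule AE_I2)
      fix x show "norm (norm (T (real K) (v x) - T (real K) (g n x))) \<le> 2 * real K"
        using norm_triangle_ineq4[of "T (real K) (v x)" "T (real K) (g n x)"] TK[of K "v x"] TK[of K "g n x"] by simp
    qed
  qed auto
  hence "eventually (\<lambda>n. (\<integral>x. norm (T (real K) (v x) - T (real K) (g n x)) \<partial>?M) < e / 2) sequentially"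
    using e by (intro order_tendstoD(2)[of _ "\<integral>x. 0 \<partial>?M"]) auto
  then obtain n where n: "(\<integral>x. norm (T (real K) (v x) - T (real K) (g n x)) \<partial>?M) < e / 2"
    unfolding eventually_sequentially by blast
  show ?thesis
  proof (rule that[of "\<lambda>x. T (real K) (g n x)"])
    show "continuous_on UNIV (\<lambda>x. T (real K) (g n x))"
      using continuous_on_compose2[OF Tc gc] by simp
    have "(\<integral>x. norm (v x - T (real K) (g n x)) \<partial>?M) \<le>
       (\<integral>x. norm (v x - T (real K) (v x)) + norm (T (real K) (v x) - T (real K) (g n x)) \<partial>?M)"
      using v iT iG by (intro integral_mono) (auto intro: norm_diff_triangle_ineq simp: norm_triangle_sub
          dest: norm_triangle_le_diff intro!: norm_diff_triangle_le)
    also have "\<dots> = (\<integral>x. norm (v x - T (real K) (v x)) \<partial>?M) + (\<integral>x. norm (T (real K) (v x) - T (real K) (g n x)) \<partial>?M)"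
      using v iT iG by simp
    finally show "(\<integral>x. norm (v x - T (real K) (g n x)) \<partial>?M) < e" using K n by linarith
  qed
qed

lemma has_vector_derivative_indefinite_integral:
  fixes g :: "real \<Rightarrow> 'e::euclidean_space"
  assumes "continuous_on {\<alpha>..\<beta>} g" "\<alpha> < x" "x < \<beta>"
  shows "((\<lambda>t. integral {\<alpha>..t} g) has_vector_derivative g x) (at x)"
proof -
  have "((\<lambda>t. integral {\<alpha>..t} g) has_vector_derivative g x) (at x within {\<alpha>..\<beta>})"
    by (rule integral_has_vector_derivative) (use assms in auto)
  thus ?thesis using assms at_within_interior[of x "{\<alpha>..\<beta>}"] by simp
qed

text \<open>For monotone \<open>W\<close> this is the bound of the \<open>L\<^sup>1\<close> norm of a difference quotient by the total variation,
  for increments of either sign. With a primitive \<open>J\<close> of \<open>W\<close> the integral is the difference of two quotients of \<open>J\<close>, each of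
  which is a value of \<open>W\<close> by the mean value theorem.\<close>

lemma integral_quotient_le_range:
  fixes W :: "real \<Rightarrow> real"
  assumes "\<alpha> < a" "a \<le> b" "b < \<beta>" and Wc: "continuous_on {\<alpha>..\<beta>} W"
    and mono: "\<And>s t. \<alpha> \<le> s \<Longrightarrow> s \<le> t \<Longrightarrow> t \<le> \<beta> \<Longrightarrow> W s \<le> W t"
    and h: "h \<noteq> 0" "\<bar>h\<bar> < a - \<alpha>" "\<bar>h\<bar> < \<beta> - b"
  shows "integrable (lebesgue_on {a..b}) (\<lambda>s. (W (s + h) - W s) / h)"
    and "(\<integral>s. (W (s + h) - W s) / h \<partial>lebesgue_on {a..b}) \<le> W \<beta> - W \<alpha>"
proof -
  let ?q = "\<lambda>s. (W (s + h) - W s) / h"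
  have "continuous_on {a..b} ?q"
    using h assms(1,2,3) by (intro continuous_intros continuous_on_compose2[OF Wc]) auto
  thus i: "integrable (lebesgue_on {a..b}) ?q" by (rule continuous_imp_integrable_real)
  define J where "J t = integral {\<alpha>..t} W" for t
  have J: "(J has_real_derivative W x) (at x)" if "\<alpha> < x" "x < \<beta>" for x
    using has_vector_derivative_indefinite_integral[OF Wc that]
    unfolding J_def has_real_derivative_iff_has_vector_derivative .
  define \<Phi> where "\<Phi> s = (J (s + h) - J s) / h" for s
  have D: "(\<Phi> has_real_derivative ?q s) (at s)" if "s \<in> {a..b}" for s
  proof -
    have "((\<lambda>s. J (s + h)) has_real_derivative W (s + h) * 1) (at s)"
      by (rule DERIV_chain2[OF J]) (use that h assms(1-3) in \<open>auto intro!: derivative_eq_intros\<close>)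
    thus ?thesis unfolding \<Phi>_def
      by (auto intro!: derivative_eq_intros J simp: assms) (use that assms(1-3) in auto)
  qed
  have "(?q has_integral \<Phi> b - \<Phi> a) {a..b}"
    by (rule fundamental_theorem_of_calculus[OF assms(2)])
       (use D in \<open>auto simp: has_real_derivative_iff_has_vector_derivative[symmetric] intro: has_field_derivative_at_within\<close>)
  hence "integral {a..b} ?q = \<Phi> b - \<Phi> a" by (rule integral_unique)
  moreover have "(\<integral>s. ?q s \<partial>lebesgue_on {a..b}) = integral {a..b} ?q"
    by (rule lebesgue_integral_eq_integral[OF i]) simp
  ultimately have eq: "(\<integral>s. ?q s \<partial>lebesgue_on {a..b}) = \<Phi> b - \<Phi> a" by (rule trans[rotated])
  have mv: "\<exists>\<xi>. \<alpha> \<le> \<xi> \<and> \<xi> \<le> \<beta> \<and> \<Phi> s = W \<xi>" if "s \<in> {a..b}" for s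
  proof (cases "h > 0")
    case True
    have "\<exists>z>s. z < s + h \<and> J (s + h) - J s = (s + h - s) * W z"
      by (rule MVT2) (use True that h assms(1-3) J in auto)
    then obtain z where z: "s < z" "z < s + h" "J (s + h) - J s = h * W z" by auto
    show ?thesis by (rule exI[of _ z]) (use z True that h assms(1-3) in \<open>auto simp: \<Phi>_def\<close>)
  next
    case False
    have "\<exists>z>s+h. z < s \<and> J s - J (s + h) = (s - (s + h)) * W z"
      by (rule MVT2) (use False that h assms(1-3) J in auto)
    then obtain z where z: "s + h < z" "z < s" "J (s + h) - J s = h * W z" by (auto simp: algebra_simps)
    show ?thesis by (rule exI[of _ z]) (use z False that h assms(1-3) in \<open>auto simp: \<Phi>_def\<close>)
  qed
  obtain x y where xy: "\<alpha> \<le> x" "x \<le> \<beta>" "\<Phi> b = W x" "\<alpha> \<le> y" "y \<le> \<beta>" "\<Phi> a = W y"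
    using mv[of a] mv[of b] assms(2) by auto
  show "(\<integral>s. ?q s \<partial>lebesgue_on {a..b}) \<le> W \<beta> - W \<alpha>"
    unfolding eq xy(3,6) using mono[of x \<beta>] mono[of \<alpha> y] xy by auto
qed

text \<open>Absolutely continuous curves enter only through the increments of \<open>V\<close>.\<close>

definition is_primitive :: "real \<Rightarrow> real \<Rightarrow> (real \<Rightarrow> 'e::euclidean_space) \<Rightarrow> (real \<Rightarrow> 'e) \<Rightarrow> bool" where
  "is_primitive a b V v \<longleftrightarrow> integrable (lebesgue_on {a..b}) v \<and>
     (\<forall>s t. a \<le> s \<longrightarrow> s \<le> t \<longrightarrow> t \<le> b \<longrightarrow> V t - V s = integral {s..t} v)"

lemma integrable_lebesgue_on_subinterval:
  fixes v :: "real \<Rightarrow> 'e::euclidean_space"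
  assumes "integrable (lebesgue_on {a..b}) v" "a \<le> s" "t \<le> b"
  shows "integrable (lebesgue_on {s..t}) v"
  by (rule integrable_subinterval[OF assms(1)]) (use assms in auto)

lemma integrable_on_subinterval_lebesgue:
  fixes v :: "real \<Rightarrow> 'e::euclidean_space"
  assumes "integrable (lebesgue_on {a..b}) v" "a \<le> s" "t \<le> b"
  shows "v integrable_on {s..t}"
  using integrable_lebesgue_on_subinterval[OF assms] by (rule integrable_on_lebesgue_on) simp

lemma is_primitive_indefinite_integral:
  fixes v :: "real \<Rightarrow> 'e::euclidean_space"
  assumes "integrable (lebesgue_on {a..b}) v"
  shows "is_primitive a b (\<lambda>t. integral {a..t} v) v"
  unfolding is_primitive_def
proof (intro conjI allI impI assms)
  fix s t assume "a \<le> s" "s \<le> t" "t \<le> b"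
  thus "integral {a..t} v - integral {a..s} v = integral {s..t} v"
    using Henstock_Kurzweil_Integration.integral_combine[of a s t v] integrable_on_subinterval_lebesgue[OF assms, of a t]
    by (simp add: algebra_simps)
qed

lemma is_primitive_continuous_on:
  fixes v :: "real \<Rightarrow> 'e::euclidean_space"
  assumes "is_primitive a b V v"
  shows "continuous_on {a..b} V"
proof -
  have "continuous_on {a..b} (\<lambda>t. V a + integral {a..t} v)"
    using assms integrable_on_subinterval_lebesgue[of a b v a b] unfolding is_primitive_def
    by (intro continuous_intros indefinite_integral_continuous_1) auto
  thus ?thesis
  proof (rule continuous_on_eq)
    fix x assume "x \<in> {a..b}"
    hence "V x - V a = integral {a..x} v" using assms by (auto simp: is_primitive_def)
    thus "V a + integral {a..x} v = V x" by (simp add: algebra_simps)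
  qed
qed

lemma is_primitive_norm_le:
  fixes v :: "real \<Rightarrow> 'e::euclidean_space"
  assumes "is_primitive a b V v" "a \<le> s" "s \<le> t" "t \<le> b"
  shows "norm (V t - V s) \<le> integral {s..t} (\<lambda>x. norm (v x))"
proof -
  have i: "integrable (lebesgue_on {a..b}) v" using assms(1) by (simp add: is_primitive_def)
  have "norm (integral {s..t} v) \<le> integral {s..t} (\<lambda>x. norm (v x))"
    by (rule integral_norm_bound_integral)
       (use integrable_on_subinterval_lebesgue[OF i] integrable_on_subinterval_lebesgue[OF integrable_norm[OF i]] assms in auto)
  thus ?thesis using assms by (auto simp: is_primitive_def)
qed

lemma quotient_uniform_of_continuous:
  fixes g :: "real \<Rightarrow> 'e::euclidean_space"
  assumes "\<alpha> < a" "a \<le> b" "b < \<beta>" and gc: "continuous_on {\<alpha>..\<beta>} g" and e: "e > 0"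
    and G: "is_primitive \<alpha> \<beta> G g"
  shows "eventually (\<lambda>h. \<forall>s\<in>{a..b}. norm ((1/h) *\<^sub>R (G (s + h) - G s) - g s) \<le> e) (at 0)"
proof -
  have "uniformly_continuous_on {\<alpha>..\<beta>} g" using gc by (intro compact_uniformly_continuous) auto
  then obtain d where d: "d > 0" "\<And>x y. x \<in> {\<alpha>..\<beta>} \<Longrightarrow> y \<in> {\<alpha>..\<beta>} \<Longrightarrow> dist y x < d \<Longrightarrow> dist (g y) (g x) < e"
    using e unfolding uniformly_continuous_on_def by metis
  have gi: "g integrable_on {x..y}" if "\<alpha> \<le> x" "y \<le> \<beta>" for x y
    using continuous_on_subset[OF gc] that by (intro integrable_continuous_real) auto
  have B: "norm (integral {x..y} g - (y - x) *\<^sub>R c) \<le> e * (y - x)"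
    if "\<alpha> \<le> x" "x \<le> y" "y \<le> \<beta>" "\<And>r. r \<in> {x..y} \<Longrightarrow> norm (g r - c) \<le> e" for x y c
  proof -
    have "norm (integral {x..y} (\<lambda>r. g r - c)) \<le> e * (y - x)"
      by (rule integral_bound) (use that continuous_on_subset[OF gc] in \<open>auto intro!: continuous_intros\<close>)
    also have "integral {x..y} (\<lambda>r. g r - c) = integral {x..y} g - (y - x) *\<^sub>R c"
      by (subst integral_diff) (use that gi in auto)
    finally show ?thesis .
  qed
  have "eventually (\<lambda>h::real. h \<noteq> 0 \<and> \<bar>h\<bar> < min d (min (a - \<alpha>) (\<beta> - b))) (at 0)"
    unfolding eventually_at by (rule exI[of _ "min d (min (a - \<alpha>) (\<beta> - b))"]) (use d assms in auto)
  thus ?thesis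
  proof eventually_elim
    case (elim h)
    show ?case
    proof
      fix s assume s: "s \<in> {a..b}"
      have near: "norm (g r - g s) \<le> e" if "\<bar>r - s\<bar> < d" "r \<in> {\<alpha>..\<beta>}" for r
        using d(2)[of s r] that s assms(1-3) by (auto simp: dist_norm)
      have "norm (G (s + h) - G s - h *\<^sub>R g s) \<le> e * \<bar>h\<bar>"
      proof (cases "h > 0")
        case True
        have "G (s + h) - G s = integral {s..s+h} g" using G s True elim assms(1-3) by (auto simp: is_primitive_def)
        thus ?thesis using B[of s "s + h" "g s"] near s True elim assms(1-3) by auto
      next
        case False
        have "G s - G (s + h) = integral {s+h..s} g" using G s False elim assms(1-3) by (auto simp: is_primitive_def)
        moreover have "norm (integral {s+h..s} g - (s - (s + h)) *\<^sub>R g s) \<le> e * (s - (s + h))"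
          by (rule B) (use near s False elim assms(1-3) in auto)
        moreover have "norm (G (s + h) - G s - h *\<^sub>R g s) = norm ((G s - G (s + h)) - (s - (s + h)) *\<^sub>R g s)"
          by (subst norm_minus_cancel[symmetric]) (simp add: algebra_simps)
        ultimately show ?thesis using False by simp
      qed
      moreover have "(1/h) *\<^sub>R (G (s + h) - G s) - g s = (1/h) *\<^sub>R (G (s + h) - G s - h *\<^sub>R g s)"
        using elim by (simp add: algebra_simps)
      ultimately have "norm ((1/h) *\<^sub>R (G (s + h) - G s) - g s) = norm (G (s + h) - G s - h *\<^sub>R g s) / \<bar>h\<bar>"
        and "norm (G (s + h) - G s - h *\<^sub>R g s) \<le> e * \<bar>h\<bar>" by simp_all
      thus "norm ((1/h) *\<^sub>R (G (s + h) - G s) - g s) \<le> e"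
        using elim by (simp add: divide_le_eq)
    qed
  qed
qed

text \<open>The difference quotients of a primitive converge in mean to the integrand. For a continuous
  integrand they converge uniformly, and by \<open>integral_quotient_le_range\<close> the \<open>L\<^sup>1\<close> error made in
  replacing \<open>v\<close> by a continuous function bounds the error of all its difference quotients. This replaces
  the pointwise differentiability of absolutely continuous functions.\<close>

lemma steklov_quotient_L1:
  fixes v :: "real \<Rightarrow> 'e::euclidean_space"
  assumes ab: "\<alpha> < a" "a \<le> b" "b < \<beta>" and V: "is_primitive \<alpha> \<beta> V v"
  shows "((\<lambda>h. \<integral>s. norm ((1/h) *\<^sub>R (V (s + h) - V s) - v s) \<partial>lebesgue_on {a..b}) \<longlongrightarrow> 0) (at 0)"
proof -
  let ?M = "lebesgue_on {a..b}"
  interpret finite_measure ?M by (rule finite_measure_lebesgue_on) simp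
  have vi: "integrable (lebesgue_on {\<alpha>..\<beta>}) v" using V by (simp add: is_primitive_def)
  have Vc: "continuous_on {\<alpha>..\<beta>} V" by (rule is_primitive_continuous_on[OF V])
  have "eventually (\<lambda>h. norm ((\<integral>s. norm ((1/h) *\<^sub>R (V (s + h) - V s) - v s) \<partial>?M) - 0) < e) (at 0)" if e: "e > 0" for e
  proof -
    obtain g where gc: "continuous_on UNIV g" and g: "(\<integral>x. norm (v x - g x) \<partial>lebesgue_on {\<alpha>..\<beta>}) < e / 3"
      using L1_approx_continuous[OF vi, of "e/3"] e by auto
    have gc': "continuous_on {x..y} g" for x y using gc continuous_on_subset by blast
    have gi: "integrable (lebesgue_on {\<alpha>..\<beta>}) g" by (rule continuous_imp_integrable_real[OF gc'])
    define w where "w x = v x - g x" for x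
    have wi: "integrable (lebesgue_on {\<alpha>..\<beta>}) w" unfolding w_def using vi gi by simp
    define G where "G t = integral {\<alpha>..t} g" for t
    define D where "D t = integral {\<alpha>..t} w" for t
    define W where "W t = integral {\<alpha>..t} (\<lambda>x. norm (w x))" for t
    have G: "is_primitive \<alpha> \<beta> G g" unfolding G_def by (rule is_primitive_indefinite_integral[OF gi])
    have D: "is_primitive \<alpha> \<beta> D w" unfolding D_def by (rule is_primitive_indefinite_integral[OF wi])
    have W: "is_primitive \<alpha> \<beta> W (\<lambda>x. norm (w x))" unfolding W_def
      by (rule is_primitive_indefinite_integral[OF integrable_norm[OF wi]])
    have Wd: "W t - W s = integral {s..t} (\<lambda>x. norm (w x))" if "\<alpha> \<le> s" "s \<le> t" "t \<le> \<beta>" for s t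
      using W that by (simp add: is_primitive_def)
    have Wmono: "W s \<le> W t" if "\<alpha> \<le> s" "s \<le> t" "t \<le> \<beta>" for s t
    proof -
      have "0 \<le> W t - W s" unfolding Wd[OF that]
        by (rule Henstock_Kurzweil_Integration.integral_nonneg)
           (use integrable_on_subinterval_lebesgue[OF integrable_norm[OF wi]] that in auto)
      thus ?thesis by simp
    qed
    have VGD: "V t - V s = (G t - G s) + (D t - D s)" if st: "\<alpha> \<le> s" "s \<le> t" "t \<le> \<beta>" for s t
    proof -
      have "integral {s..t} w = integral {s..t} v - integral {s..t} g"
        unfolding w_def
        by (rule integral_diff) (use integrable_on_subinterval_lebesgue[OF vi] integrable_on_subinterval_lebesgue[OF gi] st in auto)
      thus ?thesis using V G D st by (simp add: is_primitive_def)
    qed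
    have VGD': "V (s+h) - V s = (G (s+h) - G s) + (D (s+h) - D s)" if st: "\<alpha> \<le> s" "s \<le> \<beta>" "\<alpha> \<le> s + h" "s + h \<le> \<beta>" for s h
    proof (cases "h \<ge> 0")
      case True thus ?thesis using VGD[of s "s+h"] st by simp
    next
      case False
      hence "V s - V (s+h) = (G s - G (s+h)) + (D s - D (s+h))" using VGD[of "s+h" s] st by simp
      thus ?thesis by (simp add: algebra_simps)
    qed
    have Dq: "norm ((1/h) *\<^sub>R (D (s+h) - D s)) \<le> (W (s+h) - W s) / h"
      if st: "\<alpha> \<le> s" "s \<le> \<beta>" "\<alpha> \<le> s + h" "s + h \<le> \<beta>" "h \<noteq> 0" for s h
    proof (cases "h > 0")
      case True
      hence "norm (D (s+h) - D s) \<le> W (s+h) - W s" using is_primitive_norm_le[OF D, of s "s+h"] Wd[of s "s+h"] st by simp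
      thus ?thesis using True by (simp add: divide_right_mono)
    next
      case False
      hence "norm (D s - D (s+h)) \<le> W s - W (s+h)" using is_primitive_norm_le[OF D, of "s+h" s] Wd[of "s+h" s] st by simp
      hence "norm (D (s+h) - D s) / (- h) \<le> (W s - W (s+h)) / (- h)"
        using False by (intro divide_right_mono) (auto simp: norm_minus_commute)
      moreover have "(W s - W (s+h)) / (- h) = (W (s+h) - W s) / h" by (simp add: divide_simps)
      moreover have "norm ((1/h) *\<^sub>R (D (s+h) - D s)) = norm (D (s+h) - D s) / (- h)" using False st by simp
      ultimately show ?thesis by (metis)
    qed
    have gb: "(\<integral>s. norm (v s - g s) \<partial>?M) < e / 3"
    proof -
      have "(\<integral>s. norm (v s - g s) \<partial>?M) \<le> (\<integral>x. norm (v x - g x) \<partial>lebesgue_on {\<alpha>..\<beta>})"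
        by (rule integral_mono_lebesgue_on_AE) (use integrable_norm[OF wi, unfolded w_def] ab in auto)
      with g show ?thesis by simp
    qed
    have Wtot: "W \<beta> - W \<alpha> < e / 3"
    proof -
      have "W \<beta> - W \<alpha> = integral {\<alpha>..\<beta>} (\<lambda>x. norm (w x))" using Wd[of \<alpha> \<beta>] ab by simp
      also have "\<dots> = (\<integral>x. norm (v x - g x) \<partial>lebesgue_on {\<alpha>..\<beta>})"
        unfolding w_def by (rule lebesgue_integral_eq_integral[symmetric]) (use integrable_norm[OF wi, unfolded w_def] in auto)
      finally show ?thesis using g by simp
    qed
    \<comment> \<open>Three errors, each below a third of \<open>e\<close>: quotients of \<open>g\<close>, quotients of \<open>v - g\<close>, and \<open>v - g\<close> itself.\<close>
    obtain e' where e': "e' > 0" "e' * (b - a) < e / 3"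
      using small_multiple_of_length[of "e/3" a b] e ab by auto
    have ev1: "eventually (\<lambda>h. \<forall>s\<in>{a..b}. norm ((1/h) *\<^sub>R (G (s + h) - G s) - g s) \<le> e') (at 0)"
      by (rule quotient_uniform_of_continuous[OF ab gc' e'(1) G])
    have ev2: "eventually (\<lambda>h::real. h \<noteq> 0 \<and> \<bar>h\<bar> < min (a - \<alpha>) (\<beta> - b)) (at 0)"
      unfolding eventually_at by (rule exI[of _ "min (a - \<alpha>) (\<beta> - b)"]) (use ab in auto)
    from ev1 ev2 show ?thesis
    proof eventually_elim
      case (elim h)
      have h: "h \<noteq> 0" "\<bar>h\<bar> < a - \<alpha>" "\<bar>h\<bar> < \<beta> - b" using elim by auto
      note IQ = integral_quotient_le_range[OF ab is_primitive_continuous_on[OF W] Wmono h]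
      have vi': "integrable ?M v" "integrable ?M g"
        by (rule integrable_lebesgue_on_subinterval[OF vi], use ab in simp, use ab in simp)
           (rule integrable_lebesgue_on_subinterval[OF gi], use ab in simp, use ab in simp)
      have qi: "integrable ?M (\<lambda>s. (1/h) *\<^sub>R (V (s + h) - V s))"
        by (rule continuous_imp_integrable_real)
           (use h ab in \<open>auto intro!: continuous_intros continuous_on_compose2[OF Vc]\<close>)
      have "(\<integral>s. norm ((1/h) *\<^sub>R (V (s + h) - V s) - v s) \<partial>?M)
         \<le> (\<integral>s. (e' + (W (s+h) - W s) / h) + norm (v s - g s) \<partial>?M)"
      proof (rule integral_mono)
        fix s assume "s \<in> space ?M"
        hence s: "s \<in> {a..b}" by simp
        have b1: "norm ((1/h) *\<^sub>R (G (s + h) - G s) - g s) \<le> e'" using elim s by blast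
        have b2: "norm ((1/h) *\<^sub>R (D (s+h) - D s)) \<le> (W (s+h) - W s) / h" by (rule Dq) (use s h ab in auto)
        have "V (s+h) - V s = (G (s+h) - G s) + (D (s+h) - D s)" by (rule VGD') (use s h ab in auto)
        hence "(1/h) *\<^sub>R (V (s + h) - V s) - v s
           = ((1/h) *\<^sub>R (G (s + h) - G s) - g s) + (1/h) *\<^sub>R (D (s+h) - D s) + (g s - v s)"
          by (simp add: scaleR_add_right)
        also have "norm \<dots> \<le> norm ((1/h) *\<^sub>R (G (s + h) - G s) - g s) + norm ((1/h) *\<^sub>R (D (s+h) - D s)) + norm (g s - v s)"
          using norm_triangle_ineq[of "((1/h) *\<^sub>R (G (s + h) - G s) - g s) + (1/h) *\<^sub>R (D (s+h) - D s)" "g s - v s"]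
            norm_triangle_ineq[of "((1/h) *\<^sub>R (G (s + h) - G s) - g s)" "(1/h) *\<^sub>R (D (s+h) - D s)"] by linarith
        finally show "norm ((1/h) *\<^sub>R (V (s + h) - V s) - v s) \<le> (e' + (W (s+h) - W s) / h) + norm (v s - g s)"
          using b1 b2 norm_minus_commute[of "g s" "v s"] by linarith
      qed (use IQ(1) vi' qi in auto)
      also have "\<dots> = e' * (b - a) + (\<integral>s. (W (s+h) - W s) / h \<partial>?M) + (\<integral>s. norm (v s - g s) \<partial>?M)"
        using IQ(1) vi' ab by (simp add: measure_restrict_space)
      also have "\<dots> < e" using IQ(2) Wtot gb e'(2) by linarith
      finally show ?case by simp
    qed
  qed
  thus ?thesis unfolding tendsto_iff dist_norm by blast
qed

text \<open>Freezing the curve outside of \<open>{a..b}\<close> gives room for difference quotients up to the endpoints.\<close>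

lemma is_primitive_extend:
  fixes v :: "real \<Rightarrow> 'e::euclidean_space"
  assumes ab: "a \<le> b" and V: "is_primitive a b V v"
  shows "is_primitive \<alpha> \<beta> (\<lambda>t. V (max a (min b t))) (\<lambda>t. if t \<in> {a..b} then v t else 0)"
proof -
  let ?vc = "\<lambda>t. if t \<in> {a..b} then v t else 0"
  have "integrable lebesgue ?vc"
    using V Lebesgue_Measure.integrable_restrict_UNIV[of "{a..b}" v] by (simp add: is_primitive_def)
  hence "integrable lebesgue (\<lambda>x. indicat_real {\<alpha>..\<beta>} x *\<^sub>R ?vc x)"
    by (intro integrable_mult_indicator) auto
  hence i: "integrable (lebesgue_on {\<alpha>..\<beta>}) ?vc"
    by (subst integrable_restrict_space) auto
  have "V (max a (min b t)) - V (max a (min b s)) = integral {s..t} ?vc" if "s \<le> t" for s t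
  proof -
    have "integral {s..t} ?vc = integral ({s..t} \<inter> {a..b}) v" using Henstock_Kurzweil_Integration.integral_restrict_Int[of "{s..t}" "{a..b}" v]
      by (simp only: Int_commute)
    also have "{s..t} \<inter> {a..b} = {max s a..min t b}" by auto
    also have "integral {max s a..min t b} v = V (max a (min b t)) - V (max a (min b s))"
    proof (cases "max s a \<le> min t b")
      case True
      hence "V (min t b) - V (max s a) = integral {max s a..min t b} v" using V by (auto simp: is_primitive_def)
      moreover have "max a (min b t) = min t b" "max a (min b s) = max s a" using True that ab by linarith+
      ultimately show ?thesis by metis
    next
      case False
      hence "max a (min b t) = max a (min b s)" using that ab by linarith
      thus ?thesis using False by simp
    qed
    finally show ?thesis by simp
  qed
  thus ?thesis using i by (simp add: is_primitive_def)
qed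

text \<open>The zero function is a primitive of \<open>v\<close>, and its difference quotients vanish.\<close>

lemma AE_zero_of_integral_zero:
  fixes v :: "real \<Rightarrow> 'e::euclidean_space"
  assumes ab: "a \<le> b" and v: "integrable (lebesgue_on {a..b}) v"
    and 0: "\<And>s t. a \<le> s \<Longrightarrow> s \<le> t \<Longrightarrow> t \<le> b \<Longrightarrow> integral {s..t} v = 0"
  shows "AE x in lebesgue_on {a..b}. v x = 0"
proof -
  define vc where "vc x = (if x \<in> {a..b} then v x else 0)" for x
  have "is_primitive a b (\<lambda>t. 0) v" using v 0 by (simp add: is_primitive_def)
  from is_primitive_extend[OF ab this] have p: "is_primitive (a-1) (b+1) (\<lambda>t. 0) vc" unfolding vc_def .
  have "((\<lambda>h. \<integral>s. norm ((1/h) *\<^sub>R (0 - 0) - vc s) \<partial>lebesgue_on {a..b}) \<longlongrightarrow> 0) (at (0::real))"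
    by (rule steklov_quotient_L1[OF _ ab _ p]) auto
  hence "(\<integral>s. norm (vc s) \<partial>lebesgue_on {a..b}) = 0"
    using tendsto_unique[OF _ _ tendsto_const] by (simp add: tendsto_const_iff)
  moreover have "(\<integral>s. norm (vc s) \<partial>lebesgue_on {a..b}) = (\<integral>s. norm (v s) \<partial>lebesgue_on {a..b})"
    by (rule Bochner_Integration.integral_cong) (auto simp: vc_def)
  ultimately have "AE x in lebesgue_on {a..b}. norm (v x) = 0"
    using v by (subst integral_nonneg_eq_0_iff_AE[symmetric]) auto
  thus ?thesis by simp
qed

lemma tendsto_integral_of_uniform_limit:
  fixes l :: "real \<Rightarrow> 'e::euclidean_space"
  assumes ab: "a \<le> b" and u: "uniform_limit {a..b} f l F"
    and f: "eventually (\<lambda>i. integrable (lebesgue_on {a..b}) (f i)) F" and l: "integrable (lebesgue_on {a..b}) l"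
  shows "((\<lambda>i. \<integral>s. f i s \<partial>lebesgue_on {a..b}) \<longlongrightarrow> (\<integral>s. l s \<partial>lebesgue_on {a..b})) F"
proof (rule tendstoI)
  fix e :: real assume e: "e > 0"
  let ?M = "lebesgue_on {a..b}"
  interpret finite_measure ?M by (rule finite_measure_lebesgue_on) simp
  obtain d where d: "d > 0" "d * (b - a) < e" using small_multiple_of_length[OF e ab] .
  have "eventually (\<lambda>i. \<forall>s\<in>{a..b}. dist (f i s) (l s) < d) F" using uniform_limitD[OF u d(1)] .
  with f show "\<forall>\<^sub>F i in F. dist (\<integral>s. f i s \<partial>?M) (\<integral>s. l s \<partial>?M) < e"
  proof eventually_elim
    case (elim i)
    have "dist (\<integral>s. f i s \<partial>?M) (\<integral>s. l s \<partial>?M) = norm (\<integral>s. f i s - l s \<partial>?M)"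
      using elim l by (simp add: dist_norm)
    also have "\<dots> \<le> (\<integral>s. norm (f i s - l s) \<partial>?M)" by (rule integral_norm_bound)
    also have "\<dots> \<le> (\<integral>s. d \<partial>?M)"
      by (rule integral_mono) (use elim l in \<open>force simp: dist_norm\<close>)+
    also have "\<dots> = d * (b - a)" using ab by (simp add: measure_restrict_space)
    finally show ?case using d(2) by simp
  qed
qed

text \<open>A discrete integration by parts for a merely continuous \<open>u\<close>: its quotients are the derivatives of the quotients
  of a primitive of \<open>u\<close>, which themselves converge uniformly to \<open>u\<close>.\<close>

lemma integral_by_parts_quotient:
  fixes u \<psi> \<psi>' :: "real \<Rightarrow> real"
  assumes ab: "a < b" and uc: "continuous_on {a-1..b+1} u"
    and \<psi>: "\<And>s. s \<in> {a..b} \<Longrightarrow> (\<psi> has_real_derivative \<psi>' s) (at s within {a..b})"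
    and \<psi>'c: "continuous_on {a..b} \<psi>'"
  shows "((\<lambda>h. \<integral>s. \<psi> s * ((u (s + h) - u s) / h) \<partial>lebesgue_on {a..b})
     \<longlongrightarrow> \<psi> b * u b - \<psi> a * u a - (\<integral>s. \<psi>' s * u s \<partial>lebesgue_on {a..b})) (at 0)"
proof -
  let ?M = "lebesgue_on {a..b}"
  have \<psi>c: "continuous_on {a..b} \<psi>" using \<psi> DERIV_continuous_on by blast
  define J where "J t = integral {a-1..t} u" for t
  have Jp: "is_primitive (a-1) (b+1) J u" unfolding J_def
    by (rule is_primitive_indefinite_integral[OF continuous_imp_integrable_real[OF uc]])
  have Jc: "continuous_on {a-1..b+1} J" by (rule is_primitive_continuous_on[OF Jp])
  have J: "(J has_real_derivative u x) (at x)" if "a - 1 < x" "x < b + 1" for x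
    using has_vector_derivative_indefinite_integral[OF uc that]
    unfolding J_def has_real_derivative_iff_has_vector_derivative .
  define Q where "Q h s = (J (s + h) - J s) / h" for h s
  have uc': "continuous_on {a..b} u" by (rule continuous_on_subset[OF uc]) auto
  have ev2: "eventually (\<lambda>h::real. h \<noteq> 0 \<and> \<bar>h\<bar> < 1) (at 0)"
    unfolding eventually_at by (rule exI[of _ 1]) auto
  have Qc: "continuous_on {a..b} (Q h)" if "\<bar>h\<bar> < 1" "h \<noteq> 0" for h
    unfolding Q_def using that by (auto intro!: continuous_intros continuous_on_compose2[OF Jc])
  have eq: "(\<integral>s. \<psi> s * ((u (s + h) - u s) / h) \<partial>?M) = \<psi> b * Q h b - \<psi> a * Q h a - (\<integral>s. \<psi>' s * Q h s \<partial>?M)"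
    if h: "\<bar>h\<bar> < 1" "h \<noteq> 0" for h
  proof -
    have i1: "integrable ?M (\<lambda>s. \<psi> s * ((u (s + h) - u s) / h))"
      by (rule continuous_imp_integrable_real)
         (use h in \<open>auto intro!: continuous_intros \<psi>c continuous_on_compose2[OF uc]\<close>)
    have i2: "integrable ?M (\<lambda>s. \<psi>' s * Q h s)"
      by (rule continuous_imp_integrable_real) (use h Qc \<psi>'c in \<open>auto intro!: continuous_intros\<close>)
    have D: "((\<lambda>s. \<psi> s * Q h s) has_real_derivative (\<psi>' s * Q h s + \<psi> s * ((u (s + h) - u s) / h))) (at s within {a..b})"
      if s: "s \<in> {a..b}" for s
    proof -
      have "((\<lambda>s. J (s + h)) has_real_derivative u (s + h) * 1) (at s)"
        by (rule DERIV_chain2[OF J]) (use s h in \<open>auto intro!: derivative_eq_intros\<close>)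
      hence "(Q h has_real_derivative (u (s + h) - u s) / h) (at s within {a..b})"
        unfolding Q_def using s h
        by (auto intro!: derivative_eq_intros J intro: has_field_derivative_at_within)
      from DERIV_mult[OF \<psi>[OF s] this] show ?thesis by (simp add: algebra_simps)
    qed
    have "((\<lambda>s. \<psi>' s * Q h s + \<psi> s * ((u (s + h) - u s) / h)) has_integral \<psi> b * Q h b - \<psi> a * Q h a) {a..b}"
      by (rule fundamental_theorem_of_calculus)
         (use ab D in \<open>auto simp: has_real_derivative_iff_has_vector_derivative[symmetric]\<close>)
    moreover have "((\<lambda>s. \<psi>' s * Q h s + \<psi> s * ((u (s + h) - u s) / h)) has_integral
        (\<integral>s. \<psi>' s * Q h s \<partial>?M) + (\<integral>s. \<psi> s * ((u (s + h) - u s) / h) \<partial>?M)) {a..b}"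
      by (intro has_integral_add has_integral_integral_lebesgue_on i1 i2) auto
    ultimately have "\<psi> b * Q h b - \<psi> a * Q h a =
        (\<integral>s. \<psi>' s * Q h s \<partial>?M) + (\<integral>s. \<psi> s * ((u (s + h) - u s) / h) \<partial>?M)"
      by (rule has_integral_unique)
    thus ?thesis by linarith
  qed
  have unif: "uniform_limit {a..b} Q u (at 0)"
  proof (rule uniform_limitI)
    fix e :: real assume "e > 0"
    hence "eventually (\<lambda>h. \<forall>s\<in>{a..b}. norm ((1/h) *\<^sub>R (J (s + h) - J s) - u s) \<le> e/2) (at 0)"
      using ab by (intro quotient_uniform_of_continuous[OF _ _ _ uc _ Jp]) auto
    thus "\<forall>\<^sub>F h in at 0. \<forall>s\<in>{a..b}. dist (Q h s) (u s) < e"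
    proof eventually_elim
      case (elim h)
      thus ?case using \<open>e > 0\<close> by (force simp: Q_def dist_norm)
    qed
  qed
  have bQ: "((\<lambda>h. Q h b) \<longlongrightarrow> u b) (at 0)" "((\<lambda>h. Q h a) \<longlongrightarrow> u a) (at 0)"
    using tendsto_uniform_limitI[OF unif] ab by auto
  have "((\<lambda>h. \<integral>s. \<psi>' s * Q h s \<partial>?M) \<longlongrightarrow> (\<integral>s. \<psi>' s * u s \<partial>?M)) (at 0)"
  proof -
    have bd: "bounded (\<psi>' ` {a..b})" using \<psi>'c compact_continuous_image compact_imp_bounded compact_Icc by blast
    have bu: "bounded (u ` {a..b})" using uc' compact_continuous_image compact_imp_bounded compact_Icc by blast
    have unif2: "uniform_limit {a..b} (\<lambda>h s. \<psi>' s * Q h s) (\<lambda>s. \<psi>' s * u s) (at 0)"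
      by (rule uniform_lim_mult[OF uniform_limit_const unif bd bu])
    show ?thesis
    proof (rule tendsto_integral_of_uniform_limit[OF _ unif2])
      show "\<forall>\<^sub>F h in at 0. integrable ?M (\<lambda>s. \<psi>' s * Q h s)" using ev2
        by eventually_elim (intro continuous_imp_integrable_real continuous_intros \<psi>'c Qc, auto)
      show "integrable ?M (\<lambda>s. \<psi>' s * u s)"
        by (intro continuous_imp_integrable_real continuous_intros \<psi>'c uc')
    qed (use ab in simp)
  qed
  hence "((\<lambda>h. \<psi> b * Q h b - \<psi> a * Q h a - (\<integral>s. \<psi>' s * Q h s \<partial>?M))
     \<longlongrightarrow> \<psi> b * u b - \<psi> a * u a - (\<integral>s. \<psi>' s * u s \<partial>?M)) (at 0)"
    by (intro tendsto_intros bQ)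
  thus ?thesis
    by (rule tendsto_cong[THEN iffD1, rotated]) (use ev2 in eventually_elim, use eq in auto)
qed

text \<open>For every choice of subgradients \<open>q\<close> along the curve, \<open>q \<bullet> v\<close> is the derivative of \<open>F \<circ> z\<close>, in
  integrated form. The subgradient inequality bounds \<open>q s \<bullet> (z (s + h) - z s)\<close> by the increment of
  \<open>F \<circ> z\<close>. Dividing by \<open>h\<close> gives one inequality for \<open>h > 0\<close> and the opposite one for \<open>h < 0\<close>. Both
  sides have limits by \<open>steklov_quotient_L1\<close> and \<open>integral_by_parts_quotient\<close>, and the right-hand sides have the same limit.\<close>

lemma convex_chain_rule:
  fixes v :: "real \<Rightarrow> 'e::euclidean_space" and F :: "'e \<Rightarrow> real"
  assumes ab: "a < b" and z: "is_primitive a b z v" and Fc: "continuous_on UNIV F"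
    and qm: "q \<in> borel_measurable (lebesgue_on {a..b})" and qK: "\<And>s. s \<in> {a..b} \<Longrightarrow> norm (q s) \<le> K"
    and sub: "AE s in lebesgue_on {a..b}. q s \<in> subdifferential F (z s)"
    and \<psi>: "\<And>s. s \<in> {a..b} \<Longrightarrow> (\<psi> has_real_derivative \<psi>' s) (at s within {a..b})"
    and \<psi>'c: "continuous_on {a..b} \<psi>'" and \<psi>0: "\<And>s. s \<in> {a..b} \<Longrightarrow> 0 \<le> \<psi> s"
  shows "integrable (lebesgue_on {a..b}) (\<lambda>s. \<psi> s * (q s \<bullet> v s))"
    and "(\<integral>s. \<psi> s * (q s \<bullet> v s) \<partial>lebesgue_on {a..b})
      = \<psi> b * F (z b) - \<psi> a * F (z a) - (\<integral>s. \<psi>' s * F (z s) \<partial>lebesgue_on {a..b})"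
proof -
  let ?M = "lebesgue_on {a..b}"
  interpret finite_measure ?M by (rule finite_measure_lebesgue_on) simp
  have \<psi>c: "continuous_on {a..b} \<psi>" using \<psi> DERIV_continuous_on by blast
  have \<psi>m[measurable]: "\<psi> \<in> borel_measurable ?M"
    using continuous_imp_integrable_real[OF \<psi>c] by simp
  note qm[measurable]
  have vi: "integrable ?M v" using z by (simp add: is_primitive_def)
  hence vm[measurable]: "v \<in> borel_measurable ?M" by simp
  obtain C where C: "\<And>s. s \<in> {a..b} \<Longrightarrow> \<psi> s \<le> C"
    using continuous_attains_sup[of "{a..b}" \<psi>] \<psi>c ab by (metis atLeastAtMost_iff compact_Icc empty_iff less_imp_le order_refl)
  have C0: "0 \<le> C" using C[of a] \<psi>0[of a] ab by auto
  have K0: "0 \<le> K" using order_trans[OF norm_ge_zero qK[of a]] ab by simp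
  have bd: "\<bar>\<psi> s * (q s \<bullet> w)\<bar> \<le> C * K * norm w" if "s \<in> {a..b}" for s w
  proof -
    have "\<bar>q s \<bullet> w\<bar> \<le> K * norm w"
      using Cauchy_Schwarz_ineq2[of "q s" w] mult_right_mono[OF qK[OF that] norm_ge_zero[of w]] by linarith
    hence "\<bar>\<psi> s\<bar> * \<bar>q s \<bullet> w\<bar> \<le> C * (K * norm w)"
      using C[OF that] \<psi>0[OF that] C0 by (intro mult_mono) auto
    thus ?thesis by (simp add: abs_mult mult.assoc)
  qed
  have int: "integrable ?M (\<lambda>s. \<psi> s * (q s \<bullet> w s))" if "integrable ?M w" for w
    by (rule Bochner_Integration.integrable_bound[of ?M "\<lambda>s. C * K * norm (w s)"])
       (use that bd C0 K0 in \<open>auto intro!: AE_I2\<close>)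
  show "integrable ?M (\<lambda>s. \<psi> s * (q s \<bullet> v s))" by (rule int[OF vi])
  define zc where "zc t = z (max a (min b t))" for t
  define vc where "vc t = (if t \<in> {a..b} then v t else 0)" for t
  define u where "u t = F (zc t)" for t
  have p: "is_primitive (a-1) (b+1) zc vc"
    unfolding zc_def vc_def by (rule is_primitive_extend) (use ab z in auto)
  have zcc: "continuous_on {a-1..b+1} zc" by (rule is_primitive_continuous_on[OF p])
  have uc: "continuous_on {a-1..b+1} u"
    unfolding u_def by (rule continuous_on_compose2[OF Fc zcc]) auto
  define R where "R = \<psi> b * u b - \<psi> a * u a - (\<integral>s. \<psi>' s * u s \<partial>?M)"
  have Rl: "((\<lambda>h. \<integral>s. \<psi> s * ((u (s + h) - u s) / h) \<partial>?M) \<longlongrightarrow> R) (at 0)"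
    unfolding R_def by (rule integral_by_parts_quotient[OF ab uc \<psi> \<psi>'c])
  define I where "I h = (\<integral>s. \<psi> s * (q s \<bullet> ((1/h) *\<^sub>R (zc (s + h) - zc s))) \<partial>?M)" for h
  have ev2: "eventually (\<lambda>h::real. h \<noteq> 0 \<and> \<bar>h\<bar> < 1) (at 0)"
    unfolding eventually_at by (rule exI[of _ 1]) auto
  have qi: "integrable ?M (\<lambda>s. (1/h) *\<^sub>R (zc (s + h) - zc s))" if "\<bar>h\<bar> < 1" "h \<noteq> 0" for h
    by (rule continuous_imp_integrable_real)
       (use that in \<open>auto intro!: continuous_intros continuous_on_compose2[OF zcc]\<close>)
  have vci: "integrable ?M vc" using vi by (subst Bochner_Integration.integrable_cong[of _ _ _ v]) (auto simp: vc_def)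
  have Il: "(I \<longlongrightarrow> (\<integral>s. \<psi> s * (q s \<bullet> v s) \<partial>?M)) (at 0)"
  proof -
    have s: "((\<lambda>h. C * K * (\<integral>s. norm ((1/h) *\<^sub>R (zc (s + h) - zc s) - vc s) \<partial>?M)) \<longlongrightarrow> C * K * 0) (at 0)"
      by (intro tendsto_mult tendsto_const steklov_quotient_L1[OF _ _ _ p]) (use ab in auto)
    have "((\<lambda>h. I h - (\<integral>s. \<psi> s * (q s \<bullet> vc s) \<partial>?M)) \<longlongrightarrow> 0) (at 0)"
    proof (rule Lim_null_comparison[OF _ s[unfolded mult_zero_right]], use ev2 in eventually_elim)
      case (elim h)
      have "I h - (\<integral>s. \<psi> s * (q s \<bullet> vc s) \<partial>?M) =
        (\<integral>s. \<psi> s * (q s \<bullet> ((1/h) *\<^sub>R (zc (s + h) - zc s))) - \<psi> s * (q s \<bullet> vc s) \<partial>?M)"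
        unfolding I_def by (rule Bochner_Integration.integral_diff[symmetric]; intro int qi vci) (use elim in auto)
      also have "\<dots> = (\<integral>s. \<psi> s * (q s \<bullet> ((1/h) *\<^sub>R (zc (s + h) - zc s) - vc s)) \<partial>?M)"
        by (simp add: inner_diff_right right_diff_distrib)
      also have "norm \<dots> \<le> (\<integral>s. norm (\<psi> s * (q s \<bullet> ((1/h) *\<^sub>R (zc (s + h) - zc s) - vc s))) \<partial>?M)"
        by (rule integral_norm_bound)
      also have "\<dots> \<le> (\<integral>s. C * K * norm ((1/h) *\<^sub>R (zc (s + h) - zc s) - vc s) \<partial>?M)"
        by (rule integral_mono; (intro integrable_norm int Bochner_Integration.integrable_diff integrable_mult_right qi vci)?)
           (use elim bd in auto)
      finally show ?case by simp
    qed
    moreover have "(\<integral>s. \<psi> s * (q s \<bullet> vc s) \<partial>?M) = (\<integral>s. \<psi> s * (q s \<bullet> v s) \<partial>?M)"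
      by (rule Bochner_Integration.integral_cong) (auto simp: vc_def)
    ultimately show ?thesis by (simp add: LIM_zero_iff)
  qed
  have ui: "integrable ?M (\<lambda>s. \<psi> s * ((u (s + h) - u s) / h))" if "\<bar>h\<bar> < 1" "h \<noteq> 0" for h
    by (rule continuous_imp_integrable_real)
       (use that in \<open>auto intro!: continuous_intros \<psi>c continuous_on_compose2[OF uc]\<close>)
  have zcs: "zc s = z s" if "s \<in> {a..b}" for s using that by (auto simp: zc_def min_def max_def)
  have key: "AE s in ?M. \<forall>h. q s \<bullet> (zc (s + h) - zc s) \<le> u (s + h) - u s"
    using sub AE_space[of ?M]
  proof eventually_elim
    case (elim s)
    thus ?case by (auto simp: subdifferential_def u_def zcs algebra_simps)
  qed
  have "(\<integral>s. \<psi> s * (q s \<bullet> v s) \<partial>?M) \<le> R"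
  proof (rule tendsto_le[OF _ filterlim_mono[OF Rl order.refl at_le] filterlim_mono[OF Il order.refl at_le]])
    have "eventually (\<lambda>h::real. h > 0) (at_right 0)" by (rule eventually_at_right_less)
    moreover have "eventually (\<lambda>h::real. h \<noteq> 0 \<and> \<bar>h\<bar> < 1) (at_right 0)" using ev2 eventually_at_split by blast
    ultimately show "\<forall>\<^sub>F h in at_right 0. I h \<le> (\<integral>s. \<psi> s * ((u (s + h) - u s) / h) \<partial>?M)"
    proof eventually_elim
      case (elim h)
      show ?case unfolding I_def
      proof (rule integral_mono_AE)
        show "AE s in ?M. \<psi> s * (q s \<bullet> (1 / h) *\<^sub>R (zc (s + h) - zc s)) \<le> \<psi> s * ((u (s + h) - u s) / h)"
          using key AE_space[of ?M]
        proof eventually_elim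
          case (elim s)
          thus ?case using \<psi>0[of s] \<open>h > 0\<close> by (intro mult_left_mono) (auto simp: divide_right_mono)
        qed
      qed (intro int qi ui; use elim in auto)+
    qed
  qed auto
  moreover have "R \<le> (\<integral>s. \<psi> s * (q s \<bullet> v s) \<partial>?M)"
  proof (rule tendsto_le[OF _ filterlim_mono[OF Il order.refl at_le] filterlim_mono[OF Rl order.refl at_le]])
    have "eventually (\<lambda>h::real. h < 0) (at_left 0)" by (simp add: eventually_at_filter)
    moreover have "eventually (\<lambda>h::real. h \<noteq> 0 \<and> \<bar>h\<bar> < 1) (at_left 0)" using ev2 eventually_at_split by blast
    ultimately show "\<forall>\<^sub>F h in at_left 0. (\<integral>s. \<psi> s * ((u (s + h) - u s) / h) \<partial>?M) \<le> I h"
    proof eventually_elim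
      case (elim h)
      show ?case unfolding I_def
      proof (rule integral_mono_AE)
        show "AE s in ?M. \<psi> s * ((u (s + h) - u s) / h) \<le> \<psi> s * (q s \<bullet> (1 / h) *\<^sub>R (zc (s + h) - zc s))"
          using key AE_space[of ?M]
        proof eventually_elim
          case (elim s)
          thus ?case using \<psi>0[of s] \<open>h < 0\<close> by (intro mult_left_mono) (auto simp: divide_right_mono_neg)
        qed
      qed (intro int qi ui; use elim in auto)+
    qed
  qed auto
  moreover have "(\<integral>s. \<psi>' s * u s \<partial>?M) = (\<integral>s. \<psi>' s * F (z s) \<partial>?M)"
    by (rule Bochner_Integration.integral_cong) (auto simp: u_def zcs)
  ultimately show "(\<integral>s. \<psi> s * (q s \<bullet> v s) \<partial>?M)
      = \<psi> b * F (z b) - \<psi> a * F (z a) - (\<integral>s. \<psi>' s * F (z s) \<partial>?M)"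
    using ab by (simp add: R_def u_def zcs)
qed

section \<open>Weak derivatives\<close>

lemma square_integrable_onD:
  fixes V :: "real \<Rightarrow> 'e::euclidean_space"
  assumes "square_integrable_on a b V"
  shows "V \<in> borel_measurable (lebesgue_on {a..b})" "integrable (lebesgue_on {a..b}) (\<lambda>t. (norm (V t))\<^sup>2)"
    "integrable (lebesgue_on {a..b}) V"
proof -
  interpret finite_measure "lebesgue_on {a..b}" by (rule finite_measure_lebesgue_on) simp
  show 1: "V \<in> borel_measurable (lebesgue_on {a..b})" and 2: "integrable (lebesgue_on {a..b}) (\<lambda>t. (norm (V t))\<^sup>2)"
    using assms by (auto simp: square_integrable_on_def)
  show "integrable (lebesgue_on {a..b}) V" by (rule integrable_of_norm_sq[OF 1 2])
qed

lemma square_integrable_on_bound: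
  fixes V :: "real \<Rightarrow> 'e::euclidean_space" and m :: "real \<Rightarrow> 'f::euclidean_space"
  assumes "square_integrable_on a b m" "V \<in> borel_measurable (lebesgue_on {a..b})"
    and "\<And>t. t \<in> {a..b} \<Longrightarrow> norm (V t) \<le> norm (m t)"
  shows "square_integrable_on a b V"
  unfolding square_integrable_on_def
proof
  show "integrable (lebesgue_on {a..b}) (\<lambda>t. (norm (V t))\<^sup>2)"
    by (rule Bochner_Integration.integrable_bound[OF square_integrable_onD(2)[OF assms(1)]])
       (use assms in \<open>auto intro!: AE_I2 power_mono\<close>)
qed fact

lemma borel_measurable_lebesgue_on_continuous:
  fixes V :: "real \<Rightarrow> 'e::euclidean_space"
  assumes "continuous_on {a..b} V"
  shows "V \<in> borel_measurable (lebesgue_on {a..b})"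
  using continuous_imp_integrable_real[OF assms] by simp

lemma square_integrable_on_continuous:
  fixes V :: "real \<Rightarrow> 'e::euclidean_space"
  assumes "continuous_on {a..b} V"
  shows "square_integrable_on a b V"
  unfolding square_integrable_on_def
  by (intro conjI borel_measurable_lebesgue_on_continuous continuous_imp_integrable_real continuous_intros assms)

lemma square_integrable_on_add:
  fixes V W :: "real \<Rightarrow> 'e::euclidean_space"
  assumes "square_integrable_on a b V" "square_integrable_on a b W"
  shows "square_integrable_on a b (\<lambda>t. V t + W t)"
  unfolding square_integrable_on_def
proof
  note [measurable] = square_integrable_onD(1)[OF assms(1)] square_integrable_onD(1)[OF assms(2)]
  show "(\<lambda>t. V t + W t) \<in> borel_measurable (lebesgue_on {a..b})" by simp
  show "integrable (lebesgue_on {a..b}) (\<lambda>t. (norm (V t + W t))\<^sup>2)"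
    by (rule Bochner_Integration.integrable_bound[where f="\<lambda>t. 2 * (norm (V t))\<^sup>2 + 2 * (norm (W t))\<^sup>2"])
       (use square_integrable_onD(2)[OF assms(1)] square_integrable_onD(2)[OF assms(2)] norm_add_sq_le in auto)
qed

lemma square_integrable_on_scaleR:
  fixes V :: "real \<Rightarrow> 'e::euclidean_space"
  assumes "square_integrable_on a b V" "continuous_on {a..b} \<eta>"
  shows "square_integrable_on a b (\<lambda>t. \<eta> t *\<^sub>R V t)"
proof (cases "a \<le> b")
  case True
  note [measurable] = square_integrable_onD(1)[OF assms(1)] borel_measurable_lebesgue_on_continuous[OF assms(2)]
  have "continuous_on {a..b} (\<lambda>t. \<bar>\<eta> t\<bar>)" using assms(2) by (intro continuous_intros)
  then obtain C where C: "\<And>t. t \<in> {a..b} \<Longrightarrow> \<bar>\<eta> t\<bar> \<le> C"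
    using continuous_attains_sup[of "{a..b}" "\<lambda>t. \<bar>\<eta> t\<bar>"] True by (metis atLeastAtMost_iff compact_Icc empty_iff order_refl)
  have m: "square_integrable_on a b (\<lambda>t. C *\<^sub>R V t)"
    unfolding square_integrable_on_def
    using square_integrable_onD(1,2)[OF assms(1)] by (simp add: power_mult_distrib)
  show ?thesis
  proof (rule square_integrable_on_bound[OF m])
    fix t assume "t \<in> {a..b}"
    thus "norm (\<eta> t *\<^sub>R V t) \<le> norm (C *\<^sub>R V t)" using C[of t] by (auto intro!: mult_right_mono)
  qed simp
next
  case False
  hence "{a..b} = {}" by simp
  thus ?thesis by (simp add: square_integrable_on_def measurable_def space_restrict_space)
qed

lemma weak_derivativeD:
  assumes "is_weak_derivative a b X V"
  shows "square_integrable_on a b V"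
    "test_function a b \<phi> \<Longrightarrow> (\<integral>t. deriv \<phi> t *\<^sub>R X t \<partial>lebesgue_on {a..b}) = - (\<integral>t. \<phi> t *\<^sub>R V t \<partial>lebesgue_on {a..b})"
  using assms by (auto simp: is_weak_derivative_def)

lemma test_functionD:
  assumes "test_function a b \<phi>"
  shows "(\<phi> has_real_derivative deriv \<phi> t) (at t)" "continuous_on UNIV (deriv \<phi>)" "continuous_on UNIV \<phi>"
    "t \<notin> {a<..<b} \<Longrightarrow> \<phi> t = 0"
proof -
  obtain D where D: "\<And>t. (\<phi> has_vector_derivative D t) (at t)" and Dc: "continuous_on UNIV D"
    using assms by (auto simp: test_function_def C1_differentiable_on_def)
  have r: "(\<phi> has_real_derivative D t) (at t)" for t using D by (simp add: has_real_derivative_iff_has_vector_derivative)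
  have e: "deriv \<phi> = D" by (intro ext DERIV_imp_deriv r)
  show "(\<phi> has_real_derivative deriv \<phi> t) (at t)" using r e by simp
  show "continuous_on UNIV (deriv \<phi>)" using Dc e by simp
  show "continuous_on UNIV \<phi>"
    by (intro continuous_at_imp_continuous_on ballI) (rule DERIV_isCont[OF r])
  assume t: "t \<notin> {a<..<b}"
  show "\<phi> t = 0"
  proof (rule ccontr)
    assume "\<phi> t \<noteq> 0"
    hence "t \<in> closure {t. \<phi> t \<noteq> 0}" by (intro subsetD[OF closure_subset]) simp
    thus False using assms t by (auto simp: test_function_def)
  qed
qed

lemma test_functionI:
  assumes "\<And>t. (\<phi> has_real_derivative D t) (at t)" "continuous_on UNIV D"
    "closure {t. \<phi> t \<noteq> 0} \<subseteq> {a<..<b}"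
  shows "test_function a b \<phi>"
  using assms by (auto simp: test_function_def C1_differentiable_on_def has_real_derivative_iff_has_vector_derivative)

lemma weak_derivative_C1:
  fixes y :: "real \<Rightarrow> 'e::euclidean_space"
  assumes ab: "a < b" and y: "\<And>t. t \<in> {a..b} \<Longrightarrow> (y has_vector_derivative y' t) (at t within {a..b})"
    and y'c: "continuous_on {a..b} y'"
  shows "is_weak_derivative a b y y'"
  unfolding is_weak_derivative_def
proof (intro conjI allI impI)
  show "square_integrable_on a b y'" by (rule square_integrable_on_continuous[OF y'c])
  fix \<phi> assume tf: "test_function a b \<phi>"
  note \<phi> = test_functionD[OF tf]
  let ?M = "lebesgue_on {a..b}"
  have yc: "continuous_on {a..b} y" by (rule continuous_on_vector_derivative[OF y])
  have c: "continuous_on {a..b} (deriv \<phi>)" "continuous_on {a..b} \<phi>" by (rule continuous_on_subset[OF \<phi>(2)] continuous_on_subset[OF \<phi>(3)]; simp)+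
  have i1: "integrable ?M (\<lambda>t. deriv \<phi> t *\<^sub>R y t)" and i2: "integrable ?M (\<lambda>t. \<phi> t *\<^sub>R y' t)"
    by (intro continuous_imp_integrable_real continuous_intros c yc y'c)+
  have "((\<lambda>t. \<phi> t *\<^sub>R y t) has_vector_derivative (\<phi> t *\<^sub>R y' t + deriv \<phi> t *\<^sub>R y t)) (at t within {a..b})"
    if "t \<in> {a..b}" for t
    by (rule has_vector_derivative_scaleR[OF has_field_derivative_at_within[OF \<phi>(1)] y[OF that]])
  hence "((\<lambda>t. \<phi> t *\<^sub>R y' t + deriv \<phi> t *\<^sub>R y t) has_integral \<phi> b *\<^sub>R y b - \<phi> a *\<^sub>R y a) {a..b}"
    by (intro fundamental_theorem_of_calculus) (use ab in auto)
  moreover have "((\<lambda>t. \<phi> t *\<^sub>R y' t + deriv \<phi> t *\<^sub>R y t) has_integral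
     (\<integral>t. \<phi> t *\<^sub>R y' t \<partial>?M) + (\<integral>t. deriv \<phi> t *\<^sub>R y t \<partial>?M)) {a..b}"
    by (intro has_integral_add has_integral_integral_lebesgue_on i1 i2) auto
  ultimately have "(\<integral>t. \<phi> t *\<^sub>R y' t \<partial>?M) + (\<integral>t. deriv \<phi> t *\<^sub>R y t \<partial>?M) = \<phi> b *\<^sub>R y b - \<phi> a *\<^sub>R y a"
    by (rule has_integral_unique[rotated])
  also have "\<dots> = 0" using \<phi>(4) by simp
  finally show "(\<integral>t. deriv \<phi> t *\<^sub>R y t \<partial>?M) = - (\<integral>t. \<phi> t *\<^sub>R y' t \<partial>?M)"
    by (simp add: eq_neg_iff_add_eq_0 add.commute)
qed

text \<open>The product of \<open>\<eta>\<close> with a test function is again a test function, although \<open>\<eta>\<close> is differentiable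
  only on \<open>{a..b}\<close>: outside of the support of the test function the product vanishes.\<close>

lemma weak_derivative_scaleR:
  fixes X :: "real \<Rightarrow> 'e::euclidean_space"
  assumes X: "is_weak_derivative a b X V" and Xc: "continuous_on {a..b} X"
    and \<eta>: "\<And>t. t \<in> {a..b} \<Longrightarrow> (\<eta> has_real_derivative \<eta>' t) (at t)" and \<eta>'c: "continuous_on {a..b} \<eta>'"
  shows "is_weak_derivative a b (\<lambda>t. \<eta> t *\<^sub>R X t) (\<lambda>t. \<eta>' t *\<^sub>R X t + \<eta> t *\<^sub>R V t)"
  unfolding is_weak_derivative_def
proof (intro conjI allI impI)
  let ?M = "lebesgue_on {a..b}"
  have \<eta>c: "continuous_on {a..b} \<eta>" by (intro continuous_at_imp_continuous_on ballI) (rule DERIV_isCont[OF \<eta>])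
  show "square_integrable_on a b (\<lambda>t. \<eta>' t *\<^sub>R X t + \<eta> t *\<^sub>R V t)"
    by (intro square_integrable_on_add square_integrable_on_scaleR weak_derivativeD(1)[OF X]
          square_integrable_on_continuous Xc \<eta>c \<eta>'c)
  fix \<phi> assume tf: "test_function a b \<phi>"
  note \<phi> = test_functionD[OF tf]
  have c: "continuous_on {a..b} (deriv \<phi>)" "continuous_on {a..b} \<phi>" by (rule continuous_on_subset[OF \<phi>(2)] continuous_on_subset[OF \<phi>(3)]; simp)+
  let ?S = "closure {t. \<phi> t \<noteq> 0}"
  have S: "?S \<subseteq> {a<..<b}" using tf by (simp add: test_function_def)
  define \<xi> where "\<xi> t = \<phi> t * \<eta> t" for t
  define D :: "real \<Rightarrow> real" where "D t = (if t \<in> {a<..<b} then deriv \<phi> t * \<eta> t + \<phi> t * \<eta>' t else 0)" for t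
  have D1: "(\<xi> has_real_derivative deriv \<phi> t * \<eta> t + \<phi> t * \<eta>' t) (at t)" if "t \<in> {a..b}" for t
    using DERIV_mult[OF \<phi>(1)[of t] \<eta>[OF that]] unfolding \<xi>_def by (simp add: algebra_simps)
  have out0: "(\<xi> has_real_derivative 0) (at t)" "deriv \<phi> t = 0" "\<phi> t = 0" if t: "t \<in> - ?S" for t
  proof -
    have o: "open (- ?S)" by (intro open_Compl closed_closure)
    have z: "\<phi> x = 0" if "x \<in> - ?S" for x
      using that subsetD[OF closure_subset, of x "{t. \<phi> t \<noteq> 0}"] by auto
    have z2: "0 = \<xi> x" if "x \<in> - ?S" for x unfolding \<xi>_def z[OF that] by simp
    show "\<phi> t = 0" by (rule z[OF t])
    have "((\<lambda>x. 0) has_real_derivative 0) (at t)" by simp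
    thus "(\<xi> has_real_derivative 0) (at t)"
      by (rule has_field_derivative_transform_within_open[OF _ o t]) (rule z2)
    have "((\<lambda>x. 0) has_real_derivative 0) (at t)" by simp
    hence "(\<phi> has_real_derivative 0) (at t)"
      by (rule has_field_derivative_transform_within_open[OF _ o t]) (rule z[symmetric])
    thus "deriv \<phi> t = 0" by (rule DERIV_imp_deriv)
  qed
  have D0: "D t = 0" if "t \<in> - ?S" for t using out0[OF that] by (simp add: D_def)
  have Dd: "(\<xi> has_real_derivative D t) (at t)" for t
  proof (cases "t \<in> - ?S")
    case True thus ?thesis using out0(1)[OF True] D0[OF True] by simp
  next
    case False
    hence "t \<in> {a<..<b}" using S by blast
    thus ?thesis using D1[of t] by (simp add: D_def)
  qed
  have "continuous_on ({a<..<b} \<union> - ?S) D"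
  proof (rule continuous_on_open_Un)
    have "continuous_on {a<..<b} (\<lambda>t. deriv \<phi> t * \<eta> t + \<phi> t * \<eta>' t)"
      by (intro continuous_intros continuous_on_subset[OF c(1)] continuous_on_subset[OF c(2)]
           continuous_on_subset[OF \<eta>c] continuous_on_subset[OF \<eta>'c]) auto
    thus "continuous_on {a<..<b} D" by (rule continuous_on_eq) (simp add: D_def)
    show "continuous_on (- ?S) D" by (rule continuous_on_eq[OF continuous_on_const[of _ 0]]) (use D0 in simp)
  qed auto
  also have "{a<..<b} \<union> - ?S = UNIV" using S by blast
  finally have Dc: "continuous_on UNIV D" .
  have "closure {t. \<xi> t \<noteq> 0} \<subseteq> ?S" by (rule closure_mono) (auto simp: \<xi>_def)
  hence t\<xi>: "test_function a b \<xi>" using Dd Dc S by (intro test_functionI[of _ D]) auto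
  have d\<xi>: "deriv \<xi> t = deriv \<phi> t * \<eta> t + \<phi> t * \<eta>' t" if "t \<in> {a..b}" for t using D1[OF that] by (rule DERIV_imp_deriv)
  have i1: "integrable ?M (\<lambda>t. deriv \<phi> t *\<^sub>R \<eta> t *\<^sub>R X t)" "integrable ?M (\<lambda>t. \<phi> t *\<^sub>R \<eta>' t *\<^sub>R X t)"
    by (intro continuous_imp_integrable_real continuous_intros c Xc \<eta>c \<eta>'c)+
  have "square_integrable_on a b (\<lambda>t. \<phi> t *\<^sub>R \<eta> t *\<^sub>R V t)"
    by (intro square_integrable_on_scaleR weak_derivativeD(1)[OF X] c \<eta>c)
  hence i2: "integrable ?M (\<lambda>t. \<phi> t *\<^sub>R \<eta> t *\<^sub>R V t)" by (rule square_integrable_onD)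
  have "(\<integral>t. deriv \<xi> t *\<^sub>R X t \<partial>?M) = (\<integral>t. deriv \<phi> t *\<^sub>R \<eta> t *\<^sub>R X t + \<phi> t *\<^sub>R \<eta>' t *\<^sub>R X t \<partial>?M)"
    by (rule Bochner_Integration.integral_cong) (auto simp: d\<xi> algebra_simps)
  also have "\<dots> = (\<integral>t. deriv \<phi> t *\<^sub>R \<eta> t *\<^sub>R X t \<partial>?M) + (\<integral>t. \<phi> t *\<^sub>R \<eta>' t *\<^sub>R X t \<partial>?M)" using i1 by simp
  also have "(\<integral>t. deriv \<xi> t *\<^sub>R X t \<partial>?M) = - (\<integral>t. \<phi> t *\<^sub>R \<eta> t *\<^sub>R V t \<partial>?M)"
    using weak_derivativeD(2)[OF X t\<xi>] by (simp add: \<xi>_def)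
  finally have e: "- (\<integral>t. \<phi> t *\<^sub>R \<eta> t *\<^sub>R V t \<partial>?M) = (\<integral>t. deriv \<phi> t *\<^sub>R \<eta> t *\<^sub>R X t \<partial>?M) + (\<integral>t. \<phi> t *\<^sub>R \<eta>' t *\<^sub>R X t \<partial>?M)" .
  have "(\<integral>t. deriv \<phi> t *\<^sub>R \<eta> t *\<^sub>R X t \<partial>?M) = - (\<integral>t. \<phi> t *\<^sub>R \<eta> t *\<^sub>R V t \<partial>?M) - (\<integral>t. \<phi> t *\<^sub>R \<eta>' t *\<^sub>R X t \<partial>?M)"
    unfolding e by simp
  also have "\<dots> = - (\<integral>t. \<phi> t *\<^sub>R (\<eta>' t *\<^sub>R X t + \<eta> t *\<^sub>R V t) \<partial>?M)"
    using i1(2) i2 by (simp add: scaleR_add_right)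
  finally show "(\<integral>t. deriv \<phi> t *\<^sub>R \<eta> t *\<^sub>R X t \<partial>?M) = - (\<integral>t. \<phi> t *\<^sub>R (\<eta>' t *\<^sub>R X t + \<eta> t *\<^sub>R V t) \<partial>?M)" .
qed

text \<open>The weak formulation is linear in the curve and in the velocity, hence closed under these convergences.\<close>

lemma weak_derivative_limit:
  fixes y :: "real \<Rightarrow> 'e::euclidean_space"
  assumes ab: "a \<le> b" and w: "\<And>n. is_weak_derivative a b (f n) (g n)" and fc: "\<And>n. continuous_on {a..b} (f n)"
    and u: "uniform_limit {a..b} f y sequentially"
    and v: "square_integrable_on a b v" and L1: "(\<lambda>n. \<integral>t. norm (g n t - v t) \<partial>lebesgue_on {a..b}) \<longlonglongrightarrow> 0"
  shows "is_weak_derivative a b y v"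
  unfolding is_weak_derivative_def
proof (intro conjI allI impI v)
  let ?M = "lebesgue_on {a..b}"
  fix \<phi> assume tf: "test_function a b \<phi>"
  note \<phi> = test_functionD[OF tf]
  have c: "continuous_on {a..b} (deriv \<phi>)" "continuous_on {a..b} \<phi>" by (rule continuous_on_subset[OF \<phi>(2)] continuous_on_subset[OF \<phi>(3)]; simp)+
  have yc: "continuous_on {a..b} y" by (rule uniform_limit_theorem[OF _ u]) (use fc in auto)
  have l1: "(\<lambda>n. \<integral>t. deriv \<phi> t *\<^sub>R f n t \<partial>?M) \<longlonglongrightarrow> (\<integral>t. deriv \<phi> t *\<^sub>R y t \<partial>?M)"
  proof (rule tendsto_integral_of_uniform_limit[OF ab])
    have b1: "bounded (deriv \<phi> ` {a..b})" using c compact_continuous_image compact_imp_bounded compact_Icc by blast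
    have b2: "bounded (y ` {a..b})" using yc compact_continuous_image compact_imp_bounded compact_Icc by blast
    show "uniform_limit {a..b} (\<lambda>n t. deriv \<phi> t *\<^sub>R f n t) (\<lambda>t. deriv \<phi> t *\<^sub>R y t) sequentially"
      by (rule bounded_bilinear.bounded_uniform_limit[OF bounded_bilinear_scaleR _ u b2 b1])
         (rule uniform_limit_const)
    show "\<forall>\<^sub>F n in sequentially. integrable ?M (\<lambda>t. deriv \<phi> t *\<^sub>R f n t)"
      by (intro always_eventually allI continuous_imp_integrable_real continuous_intros c fc)
    show "integrable ?M (\<lambda>t. deriv \<phi> t *\<^sub>R y t)" by (intro continuous_imp_integrable_real continuous_intros c yc)
  qed
  have gi: "integrable ?M (g n)" for n using weak_derivativeD(1)[OF w] by (rule square_integrable_onD)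
  have vi: "integrable ?M v" using v by (rule square_integrable_onD)
  have l2: "(\<lambda>n. \<integral>t. \<phi> t *\<^sub>R g n t \<partial>?M) \<longlonglongrightarrow> (\<integral>t. \<phi> t *\<^sub>R v t \<partial>?M)"
  proof -
    have "continuous_on {a..b} (\<lambda>t. \<bar>\<phi> t\<bar>)" using c by (intro continuous_intros)
    then obtain C where C: "\<And>t. t \<in> {a..b} \<Longrightarrow> \<bar>\<phi> t\<bar> \<le> C"
      using continuous_attains_sup[of "{a..b}" "\<lambda>t. \<bar>\<phi> t\<bar>"] ab by (metis atLeastAtMost_iff compact_Icc empty_iff order_refl)
    have i: "integrable ?M (\<lambda>t. \<phi> t *\<^sub>R h t)" if "integrable ?M h" for h :: "real \<Rightarrow> 'e"
      by (rule Bochner_Integration.integrable_bound[of ?M "\<lambda>t. C *\<^sub>R h t"])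
         (use that C borel_measurable_lebesgue_on_continuous[OF c(2)] in \<open>force intro!: AE_I2 mult_right_mono\<close>)+
    have "(\<lambda>n. C * (\<integral>t. norm (g n t - v t) \<partial>?M)) \<longlonglongrightarrow> C * 0" by (intro tendsto_intros L1)
    hence s: "(\<lambda>n. C * (\<integral>t. norm (g n t - v t) \<partial>?M)) \<longlonglongrightarrow> 0" by simp
    have "(\<lambda>n. (\<integral>t. \<phi> t *\<^sub>R g n t \<partial>?M) - (\<integral>t. \<phi> t *\<^sub>R v t \<partial>?M)) \<longlonglongrightarrow> 0"
    proof (rule Lim_null_comparison[OF always_eventually s], rule allI)
      fix n
      have "(\<integral>t. \<phi> t *\<^sub>R g n t \<partial>?M) - (\<integral>t. \<phi> t *\<^sub>R v t \<partial>?M) = (\<integral>t. \<phi> t *\<^sub>R (g n t - v t) \<partial>?M)"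
        using i[OF gi] i[OF vi] by (simp add: scaleR_diff_right)
      also have "norm \<dots> \<le> (\<integral>t. norm (\<phi> t *\<^sub>R (g n t - v t)) \<partial>?M)" by (rule integral_norm_bound)
      also have "\<dots> \<le> (\<integral>t. C * norm (g n t - v t) \<partial>?M)"
        by (rule integral_mono; (intro integrable_norm i integrable_mult_right Bochner_Integration.integrable_diff gi vi)?)
           (use C in \<open>auto intro!: mult_right_mono\<close>)
      finally show "norm ((\<integral>t. \<phi> t *\<^sub>R g n t \<partial>?M) - (\<integral>t. \<phi> t *\<^sub>R v t \<partial>?M)) \<le> C * (\<integral>t. norm (g n t - v t) \<partial>?M)" by simp
    qed
    thus ?thesis by (simp add: LIM_zero_iff)
  qed
  have "(\<lambda>n. \<integral>t. deriv \<phi> t *\<^sub>R f n t \<partial>?M) \<longlonglongrightarrow> - (\<integral>t. \<phi> t *\<^sub>R v t \<partial>?M)"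
    unfolding weak_derivativeD(2)[OF w tf] by (intro tendsto_minus l2)
  thus "(\<integral>t. deriv \<phi> t *\<^sub>R y t \<partial>?M) = - (\<integral>t. \<phi> t *\<^sub>R v t \<partial>?M)"
    using LIMSEQ_unique[OF l1] by simp
qed

section \<open>Weak derivatives and primitives\<close>

lemma has_real_derivative_pos_part_sq:
  "((\<lambda>x. (max 0 x)\<^sup>2) has_real_derivative 2 * max 0 x) (at (x::real))"
proof -
  consider "x > 0" | "x < 0" | "x = 0" by linarith
  thus ?thesis
  proof cases
    case 1
    have "((\<lambda>x. x\<^sup>2) has_real_derivative 2 * max 0 x) (at x)"
      using 1 by (auto intro!: derivative_eq_intros)
    thus ?thesis by (rule has_field_derivative_transform_within_open[of _ _ _ "{0<..}"]) (use 1 in auto)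
  next
    case 2
    have "((\<lambda>x. 0) has_real_derivative 2 * max 0 x) (at x)" using 2 by auto
    thus ?thesis by (rule has_field_derivative_transform_within_open[of _ _ _ "{..<0}"]) (use 2 in auto)
  next
    case 3
    have "((\<lambda>h::real. (max 0 h)\<^sup>2 / h) \<longlongrightarrow> 0) (at 0)"
    proof (rule Lim_null_comparison)
      show "\<forall>\<^sub>F h in at 0. norm ((max 0 h)\<^sup>2 / h) \<le> \<bar>h\<bar>"
        by (rule always_eventually) (auto simp: max_def power2_eq_square)
      show "((\<lambda>h::real. \<bar>h\<bar>) \<longlongrightarrow> 0) (at 0)" by (auto intro!: tendsto_eq_intros)
    qed
    thus ?thesis using 3 by (simp add: has_field_derivative_iff)
  qed
qed

text \<open>A continuously differentiable step from 0 to 1 on the unit interval, a quadratic spline.\<close>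

definition spline_step :: "real \<Rightarrow> real" where
  "spline_step x = 2 * ((max 0 x)\<^sup>2 - 2 * (max 0 (x - 1/2))\<^sup>2 + (max 0 (x - 1))\<^sup>2)"

text \<open>The derivative of the step: a piecewise linear bump of integral 1.\<close>

definition hat :: "real \<Rightarrow> real" where
  "hat x = 4 * (max 0 x - 2 * max 0 (x - 1/2) + max 0 (x - 1))"

lemma spline_step_derivative: "(spline_step has_real_derivative hat x) (at x)"
proof -
  have s: "((\<lambda>x. (max 0 (x - c))\<^sup>2) has_real_derivative 2 * max 0 (x - c) * 1) (at x)" for c
    by (rule DERIV_chain2[OF has_real_derivative_pos_part_sq]) (auto intro!: derivative_eq_intros)
  show ?thesis unfolding spline_step_def[abs_def] hat_def
    by (rule DERIV_cong[OF DERIV_cmult[OF DERIV_add[OF DERIV_diff[OF has_real_derivative_pos_part_sq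
            DERIV_cmult[OF s[of "1/2"]]] s[of 1]]]]) simp
qed

lemma hat_continuous: "continuous_on UNIV hat"
  unfolding hat_def[abs_def] by (intro continuous_intros)

lemma hat_nonneg: "0 \<le> hat x" and hat_eq_0: "x \<notin> {0..1} \<Longrightarrow> hat x = 0"
  by (auto simp: hat_def max_def)

lemma spline_step_0: "x \<le> 0 \<Longrightarrow> spline_step x = 0"
  by (simp add: spline_step_def max_def)

lemma spline_step_1: "1 \<le> x \<Longrightarrow> spline_step x = 1"
  by (simp add: spline_step_def max_def power2_eq_square algebra_simps)

lemma spline_step_mono: "x \<le> y \<Longrightarrow> spline_step x \<le> spline_step y"
  by (rule DERIV_nonneg_imp_nondecreasing) (use spline_step_derivative hat_nonneg in blast)+

lemma spline_step_range: "0 \<le> spline_step x" "spline_step x \<le> 1"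
  using spline_step_mono[of "min x 0" x] spline_step_mono[of x "max x 1"] spline_step_0[of "min x 0"] spline_step_1[of "max x 1"]
  by auto

lemma scaled_step_derivative: "((\<lambda>x. spline_step (c * (x - s))) has_real_derivative c * hat (c * (x - s))) (at x)"
proof -
  have "((\<lambda>x. spline_step (c * (x - s))) has_real_derivative hat (c * (x - s)) * c) (at x)"
    by (rule DERIV_chain2[OF spline_step_derivative]) (auto intro!: derivative_eq_intros)
  thus ?thesis by (simp add: mult.commute)
qed

text \<open>The rescaled bump has integral 1 and lives on an interval of length \<open>1 / n\<close> to the right of \<open>s\<close>.\<close>

lemma hat_approximate_identity:
  fixes X :: "real \<Rightarrow> 'e::euclidean_space"
  assumes s: "a \<le> s" "s < b" and Xc: "continuous_on {a..b} X"
  shows "((\<lambda>n. \<integral>x. (real n * hat (real n * (x - s))) *\<^sub>R X x \<partial>lebesgue_on {a..b}) \<longlonglongrightarrow> X s)"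
proof (rule LIMSEQ_I)
  fix e :: real assume e: "e > 0"
  let ?M = "lebesgue_on {a..b}"
  have "\<exists>d>0. \<forall>x\<in>{a..b}. dist x s < d \<longrightarrow> dist (X x) (X s) < e/2"
    using Xc e s unfolding continuous_on_iff by (metis atLeastAtMost_iff half_gt_zero less_imp_le)
  then obtain d where d: "d > 0" "\<And>x. x \<in> {a..b} \<Longrightarrow> dist x s < d \<Longrightarrow> dist (X x) (X s) < e/2" by blast
  obtain N :: nat where N: "N > 0" "1 / real N < min d (b - s)"
    using real_arch_inverse[of "min d (b - s)"] d s by (auto simp: inverse_eq_divide)
  have "norm ((\<integral>x. (real n * hat (real n * (x - s))) *\<^sub>R X x \<partial>?M) - X s) < e" if n: "n \<ge> N" for n
  proof -
    let ?k = "\<lambda>x. real n * hat (real n * (x - s))"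
    have n0: "real n > 0" using n N by simp
    have nn: "1 / real n < min d (b - s)"
    proof -
      have "1 / real n \<le> 1 / real N" using n N by (simp add: frac_le)
      thus ?thesis using N by linarith
    qed
    have kc: "continuous_on {a..b} ?k"
      by (intro continuous_intros continuous_on_compose2[OF hat_continuous]) auto
    have ki: "integrable ?M ?k" by (rule continuous_imp_integrable_real[OF kc])
    have k0: "0 \<le> ?k x" for x using hat_nonneg by simp
    have "(?k has_integral spline_step (real n * (b - s)) - spline_step (real n * (a - s))) {a..b}"
    proof (rule fundamental_theorem_of_calculus)
      fix x
      show "((\<lambda>x. spline_step (real n * (x - s))) has_vector_derivative ?k x) (at x within {a..b})"
        unfolding has_real_derivative_iff_has_vector_derivative[symmetric]
        by (rule has_field_derivative_at_within[OF scaled_step_derivative])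
    qed (use s in simp)
    moreover have "spline_step (real n * (b - s)) = 1"
      by (rule spline_step_1) (use nn n0 in \<open>simp add: field_simps\<close>)
    moreover have "spline_step (real n * (a - s)) = 0"
      by (rule spline_step_0) (use s n0 in \<open>simp add: mult_nonneg_nonpos\<close>)
    ultimately have "(?k has_integral 1) {a..b}" by simp
    hence k1: "(\<integral>x. ?k x \<partial>?M) = 1"
      using has_integral_unique[OF has_integral_integral_lebesgue_on[OF ki]] by simp
    have i1: "integrable ?M (\<lambda>x. ?k x *\<^sub>R X x)" by (intro continuous_imp_integrable_real continuous_intros kc Xc)
    have i2: "integrable ?M (\<lambda>x. ?k x *\<^sub>R X s)" by (intro continuous_imp_integrable_real continuous_intros kc)
    have i3: "integrable ?M (\<lambda>x. ?k x *\<^sub>R (X x - X s))" by (intro continuous_imp_integrable_real continuous_intros kc Xc)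
    have "(\<integral>x. ?k x *\<^sub>R X x \<partial>?M) - X s = (\<integral>x. ?k x *\<^sub>R X x \<partial>?M) - (\<integral>x. ?k x *\<^sub>R X s \<partial>?M)"
      using k1 ki by simp
    also have "\<dots> = (\<integral>x. ?k x *\<^sub>R (X x - X s) \<partial>?M)" using i1 i2 by (simp add: scaleR_diff_right)
    also have "norm \<dots> \<le> (\<integral>x. norm (?k x *\<^sub>R (X x - X s)) \<partial>?M)" by (rule integral_norm_bound)
    also have "\<dots> \<le> (\<integral>x. ?k x * (e / 2) \<partial>?M)"
    proof (rule integral_mono)
      fix x assume "x \<in> space ?M"
      hence x: "x \<in> {a..b}" by simp
      show "norm (?k x *\<^sub>R (X x - X s)) \<le> ?k x * (e/2)"
      proof (cases "real n * (x - s) \<in> {0..1}")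
        case True
        hence "x - s \<le> 1 / real n" "0 \<le> x - s" using n0 by (auto simp: field_simps zero_le_mult_iff)
        hence "dist x s < d" using nn by (simp add: dist_norm)
        hence "norm (X x - X s) \<le> e/2" using d(2)[OF x] by (simp add: dist_norm)
        from mult_left_mono[OF this k0[of x]] show ?thesis by (simp only: norm_scaleR abs_of_nonneg[OF k0])
      next
        case False
        thus ?thesis using hat_eq_0 by simp
      qed
    qed (rule integrable_norm[OF i3], rule integrable_mult_left[OF ki])
    also have "\<dots> = e / 2" using k1 by simp
    finally show ?thesis using e by simp
  qed
  thus "\<exists>N. \<forall>n\<ge>N. norm ((\<integral>x. (real n * hat (real n * (x - s))) *\<^sub>R X x \<partial>?M) - X s) < e" by blast
qed

text \<open>Test with a smooth version of the indicator function of \<open>{s..r}\<close>, the difference of two steps of width \<open>1 / n\<close>. Its derivative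
  is a difference of two approximate identities, which picks out the values of \<open>X\<close> at \<open>s\<close> and \<open>r\<close>.\<close>

lemma weak_derivative_increment:
  fixes X :: "real \<Rightarrow> 'e::euclidean_space"
  assumes X: "is_weak_derivative a b X V" and Xc: "continuous_on {a..b} X"
    and sr: "a < s" "s \<le> r" "r < b"
  shows "X r - X s = integral {s..r} V"
proof -
  let ?M = "lebesgue_on {a..b}"
  have Vi: "integrable ?M V" and [measurable]: "V \<in> borel_measurable ?M"
    using square_integrable_onD[OF weak_derivativeD(1)[OF X]] by auto
  define \<phi> where "\<phi> n x = spline_step (real n * (x - s)) - spline_step (real n * (x - r))" for n x
  define D where "D n x = real n * hat (real n * (x - s)) - real n * hat (real n * (x - r))" for n x
  have dphi: "(\<phi> n has_real_derivative D n x) (at x)" for n x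
    unfolding \<phi>_def[abs_def] D_def by (intro DERIV_diff scaled_step_derivative)
  have Dc: "continuous_on UNIV (D n)" for n unfolding D_def[abs_def]
    by (intro continuous_intros continuous_on_compose2[OF hat_continuous]) auto
  have dD: "deriv (\<phi> n) = D n" for n by (intro ext DERIV_imp_deriv dphi)
  obtain N :: nat where N: "N > 0" "1 / real N < b - r"
    using real_arch_inverse[of "b - r"] sr by (auto simp: inverse_eq_divide)
  have tf: "test_function a b (\<phi> n)" if n: "n \<ge> N" for n
  proof (rule test_functionI[OF dphi Dc])
    have n0: "real n > 0" using n N by simp
    have nn: "1 / real n < b - r"
    proof -
      have "1 / real n \<le> 1 / real N" using n N by (simp add: frac_le)
      thus ?thesis using N by linarith
    qed
    have "{t. \<phi> n t \<noteq> 0} \<subseteq> {s..r + 1 / real n}"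
    proof (rule subsetI, rule ccontr)
      fix t assume t: "t \<in> {t. \<phi> n t \<noteq> 0}" and "t \<notin> {s..r + 1 / real n}"
      then consider "t < s" | "t > r + 1 / real n" by auto
      hence "\<phi> n t = 0"
      proof cases
        case 1
        have "real n * (t - s) \<le> 0" "real n * (t - r) \<le> 0" using 1 sr n0 by (auto simp: mult_le_0_iff)
        thus ?thesis by (simp add: \<phi>_def spline_step_0)
      next
        case 2
        hence "1 \<le> real n * (t - r)" using n0 by (simp add: field_simps)
        moreover have "real n * (t - r) \<le> real n * (t - s)" using sr n0 by simp
        ultimately show ?thesis by (simp add: \<phi>_def spline_step_1)
      qed
      thus False using t by simp
    qed
    hence "closure {t. \<phi> n t \<noteq> 0} \<subseteq> {s..r + 1 / real n}" by (rule closure_minimal) simp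
    also have "\<dots> \<subseteq> {a<..<b}" using sr nn by auto
    finally show "closure {t. \<phi> n t \<noteq> 0} \<subseteq> {a<..<b}" .
  qed
  have l1: "(\<lambda>n. \<integral>x. D n x *\<^sub>R X x \<partial>?M) \<longlonglongrightarrow> X s - X r"
  proof -
    have i: "integrable ?M (\<lambda>x. (real n * hat (real n * (x - t))) *\<^sub>R X x)" for n t
      by (intro continuous_imp_integrable_real continuous_intros Xc continuous_on_compose2[OF hat_continuous]) auto
    have "(\<integral>x. D n x *\<^sub>R X x \<partial>?M) = (\<integral>x. (real n * hat (real n * (x - s))) *\<^sub>R X x \<partial>?M) - (\<integral>x. (real n * hat (real n * (x - r))) *\<^sub>R X x \<partial>?M)" for n
      unfolding D_def scaleR_diff_left by (rule Bochner_Integration.integral_diff[OF i i])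
    thus ?thesis using sr by (simp only:) (intro tendsto_diff hat_approximate_identity Xc; simp)
  qed
  let ?l = "\<lambda>x. if x \<in> {s..r} then V x else 0"
  have l2: "(\<lambda>n. \<integral>x. \<phi> n x *\<^sub>R V x \<partial>?M) \<longlonglongrightarrow> (\<integral>x. ?l x \<partial>?M)"
  proof (rule integral_dominated_convergence[where w="\<lambda>x. norm (V x)"])
    have \<phi>c: "continuous_on {a..b} (\<phi> n)" for n
      by (intro continuous_at_imp_continuous_on ballI) (rule DERIV_isCont[OF dphi])
    note [measurable] = borel_measurable_lebesgue_on_continuous[OF \<phi>c]
    show "(\<lambda>x. \<phi> n x *\<^sub>R V x) \<in> borel_measurable ?M" for n by simp
    have [measurable]: "{x \<in> space ?M. x \<in> {s..r}} \<in> sets ?M"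
      by (auto simp: sets_restrict_space_iff)
    show "?l \<in> borel_measurable ?M" by measurable
    show "AE x in ?M. norm (\<phi> n x *\<^sub>R V x) \<le> norm (V x)" for n
    proof (rule AE_I2)
      fix x
      have "\<bar>\<phi> n x\<bar> \<le> 1" unfolding \<phi>_def
        using spline_step_range[of "real n * (x - s)"] spline_step_range[of "real n * (x - r)"] by linarith
      thus "norm (\<phi> n x *\<^sub>R V x) \<le> norm (V x)" by (simp add: mult_left_le_one_le)
    qed
    have "{s} \<in> null_sets lebesgue" by simp
    hence "AE x in lebesgue. x \<notin> {s}" by (rule AE_not_in)
    hence "AE x in ?M. x \<notin> {s}" by (subst AE_restrict_space_iff) auto
    thus "AE x in ?M. (\<lambda>n. \<phi> n x *\<^sub>R V x) \<longlonglongrightarrow> ?l x"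
    proof eventually_elim
      case (elim x)
      have lim: "(\<lambda>n. spline_step (real n * (x - t))) \<longlonglongrightarrow> (if t < x then 1 else 0)" for t
      proof (cases "t < x")
        case True
        obtain n0 :: nat where n0: "1 / (x - t) \<le> real n0" using real_arch_simple by blast
        have "spline_step (real n * (x - t)) = 1" if "n \<ge> n0" for n
        proof (rule spline_step_1)
          have "1 / (x - t) \<le> real n" using n0 that by linarith
          thus "1 \<le> real n * (x - t)" using True by (simp add: field_simps)
        qed
        hence "\<forall>\<^sub>F n in sequentially. spline_step (real n * (x - t)) = 1" unfolding eventually_sequentially by blast
        thus ?thesis using True by (simp add: tendsto_eventually)
      next
        case False
        thus ?thesis by (simp add: spline_step_0 mult_nonneg_nonpos)
      qed
      have "(\<lambda>n. \<phi> n x *\<^sub>R V x) \<longlonglongrightarrow> ((if s < x then 1 else 0) - (if r < x then 1 else 0)) *\<^sub>R V x"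
        unfolding \<phi>_def by (intro tendsto_intros lim)
      thus ?case using elim sr by (auto split: if_splits)
    qed
  qed (use Vi in auto)
  have li: "integrable ?M ?l"
  proof (rule Bochner_Integration.integrable_bound[OF Vi])
    have [measurable]: "{x \<in> space ?M. x \<in> {s..r}} \<in> sets ?M"
      by (auto simp: sets_restrict_space_iff)
    show "?l \<in> borel_measurable ?M" by measurable
  qed auto
  have "(\<integral>x. ?l x \<partial>?M) = integral {a..b} ?l" by (rule lebesgue_integral_eq_integral[OF li]) simp
  also have "\<dots> = integral ({s..r} \<inter> {a..b}) V" by (rule Henstock_Kurzweil_Integration.integral_restrict_Int)
  also have "{s..r} \<inter> {a..b} = {s..r}" using sr by auto
  finally have l3: "(\<integral>x. ?l x \<partial>?M) = integral {s..r} V" .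
  have "eventually (\<lambda>n. (\<integral>x. D n x *\<^sub>R X x \<partial>?M) = - (\<integral>x. \<phi> n x *\<^sub>R V x \<partial>?M)) sequentially"
    unfolding eventually_sequentially
    by (rule exI[of _ N]) (use weak_derivativeD(2)[OF X tf] dD in auto)
  hence "(\<lambda>n. \<integral>x. D n x *\<^sub>R X x \<partial>?M) \<longlonglongrightarrow> - integral {s..r} V"
    using tendsto_minus[OF l2] l3 by (simp add: tendsto_cong)
  from LIMSEQ_unique[OF l1 this] show ?thesis by (simp add: algebra_simps eq_neg_iff_add_eq_0)
qed

text \<open>The increments are known in the open interval, and both sides are continuous up to its ends.\<close>

lemma weak_derivative_is_primitive:
  fixes X :: "real \<Rightarrow> 'e::euclidean_space"
  assumes ab: "a < b" and X: "is_weak_derivative a b X V" and Xc: "continuous_on {a..b} X"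
  shows "is_primitive a b X V"
proof -
  have Vi: "integrable (lebesgue_on {a..b}) V" by (rule square_integrable_onD(3)[OF weak_derivativeD(1)[OF X]])
  define P where "P t = integral {a..t} V" for t
  have P: "is_primitive a b P V" unfolding P_def by (rule is_primitive_indefinite_integral[OF Vi])
  have Pc: "continuous_on {a..b} P" by (rule is_primitive_continuous_on[OF P])
  define m where "m = (a + b) / 2"
  have m: "a < m" "m < b" using ab by (auto simp: m_def)
  have inner: "X t - P t = X m - P m" if t: "t \<in> {a<..<b}" for t
  proof (cases "t \<le> m")
    case True
    hence "X m - X t = P m - P t" using weak_derivative_increment[OF X Xc, of t m] P t m by (simp add: is_primitive_def)
    thus ?thesis by (simp add: algebra_simps)
  next
    case False
    hence "X t - X m = P t - P m" using weak_derivative_increment[OF X Xc, of m t] P t m by (simp add: is_primitive_def)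
    thus ?thesis by (simp add: algebra_simps)
  qed
  have cl: "closure {a<..<b} = {a..b}" using ab by simp
  have all: "X t - P t = X m - P m" if t: "t \<in> {a..b}" for t
    by (rule continuous_constant_on_closure[of "{a<..<b}" "\<lambda>t. X t - P t"])
       (use inner t Xc Pc in \<open>auto simp only: cl intro!: continuous_intros\<close>)
  have "X t - X s = P t - P s" if "s \<in> {a..b}" "t \<in> {a..b}" for s t
    using all[OF that(1)] all[OF that(2)] by (simp add: diff_eq_eq)
  thus ?thesis using P by (simp add: is_primitive_def)
qed

lemma weak_derivative_unique:
  fixes X :: "real \<Rightarrow> 'e::euclidean_space"
  assumes ab: "a < b" and V: "is_weak_derivative a b X V" and W: "is_weak_derivative a b X W" and Xc: "continuous_on {a..b} X"
  shows "AE t in lebesgue_on {a..b}. V t = W t"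
proof -
  have p: "is_primitive a b X V" "is_primitive a b X W" by (rule weak_derivative_is_primitive[OF ab _ Xc], fact)+
  have i: "integrable (lebesgue_on {a..b}) V" "integrable (lebesgue_on {a..b}) W" using p by (auto simp: is_primitive_def)
  have "AE t in lebesgue_on {a..b}. V t - W t = 0"
  proof (rule AE_zero_of_integral_zero)
    fix s t assume st: "a \<le> s" "s \<le> t" "t \<le> b"
    have "integral {s..t} V = integral {s..t} W" using p st unfolding is_primitive_def by metis
    thus "integral {s..t} (\<lambda>t. V t - W t) = 0"
      using integrable_on_subinterval_lebesgue[OF i(1)] integrable_on_subinterval_lebesgue[OF i(2)] st by (simp add: integral_diff)
  qed (use ab i in auto)
  thus ?thesis by simp
qed

text \<open>Jensen's inequality for the square, from the integral of \<open>(m - c)\<^sup>2\<close> with \<open>c\<close> the mean of \<open>m\<close>.\<close>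

lemma increment_sq_le:
  fixes m :: "real \<Rightarrow> real"
  assumes W: "is_primitive \<alpha> \<beta> W m" and W2: "is_primitive \<alpha> \<beta> W2 (\<lambda>x. (m x)\<^sup>2)"
    and sh: "\<alpha> \<le> s" "0 < h" "s + h \<le> \<beta>"
  shows "((W (s + h) - W s) / h)\<^sup>2 \<le> (W2 (s + h) - W2 s) / h"
proof -
  have mi: "integrable (lebesgue_on {\<alpha>..\<beta>}) m" "integrable (lebesgue_on {\<alpha>..\<beta>}) (\<lambda>x. (m x)\<^sup>2)"
    using W W2 by (auto simp: is_primitive_def)
  have i: "m integrable_on {s..s+h}" "(\<lambda>x. (m x)\<^sup>2) integrable_on {s..s+h}"
    using integrable_on_subinterval_lebesgue[OF mi(1)] integrable_on_subinterval_lebesgue[OF mi(2)] sh by auto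
  define c where "c = (W (s + h) - W s) / h"
  have ch: "integral {s..s+h} m = c * h" "integral {s..s+h} (\<lambda>x. (m x)\<^sup>2) = W2 (s + h) - W2 s"
    using W W2 sh by (auto simp: is_primitive_def c_def)
  have "0 \<le> integral {s..s+h} (\<lambda>x. (m x)\<^sup>2 - 2 * c * m x + c\<^sup>2)"
  proof (rule Henstock_Kurzweil_Integration.integral_nonneg)
    show "(\<lambda>x. (m x)\<^sup>2 - 2 * c * m x + c\<^sup>2) integrable_on {s..s+h}"
      by (intro integrable_add integrable_diff i integrable_on_mult_right integrable_const_ivl)
    show "0 \<le> (m x)\<^sup>2 - 2 * c * m x + c\<^sup>2" for x
      using zero_le_power2[of "m x - c"] unfolding power2_diff by (simp add: mult.commute mult.left_commute)
  qed
  also have "integral {s..s+h} (\<lambda>x. (m x)\<^sup>2 - 2 * c * m x + c\<^sup>2) = W2 (s + h) - W2 s - 2 * c * (c * h) + c\<^sup>2 * h"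
  proof (rule integral_unique)
    have "((\<lambda>x. (m x)\<^sup>2 - 2 * c * m x + c\<^sup>2) has_integral
        integral {s..s+h} (\<lambda>x. (m x)\<^sup>2) - 2 * c * integral {s..s+h} m + measure lborel {s..s+h} *\<^sub>R c\<^sup>2) {s..s+h}"
      by (intro has_integral_add has_integral_diff has_integral_mult_right integrable_integral i has_integral_const_real)
    thus "((\<lambda>x. (m x)\<^sup>2 - 2 * c * m x + c\<^sup>2) has_integral W2 (s + h) - W2 s - 2 * c * (c * h) + c\<^sup>2 * h) {s..s+h}"
      using sh unfolding ch by (simp add: mult.commute)
  qed
  finally have "c\<^sup>2 * h \<le> W2 (s + h) - W2 s" by (simp add: power2_eq_square)
  thus ?thesis using sh by (simp add: c_def pos_le_divide_eq)
qed

lemma is_weak_derivative_midpoint: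
  fixes X Y :: "real \<Rightarrow> 'e::euclidean_space"
  assumes X: "is_weak_derivative a b X V" "continuous_on {a..b} X" and Y: "is_weak_derivative a b Y W" "continuous_on {a..b} Y"
  shows "is_weak_derivative a b (\<lambda>t. (1/2) *\<^sub>R (X t + Y t)) (\<lambda>t. (1/2) *\<^sub>R (V t + W t))"
  unfolding is_weak_derivative_def
proof (intro conjI allI impI)
  let ?M = "lebesgue_on {a..b}"
  note V = weak_derivativeD(1)[OF X(1)] and W = weak_derivativeD(1)[OF Y(1)]
  show "square_integrable_on a b (\<lambda>t. (1/2) *\<^sub>R (V t + W t))"
    by (intro square_integrable_on_scaleR square_integrable_on_add V W continuous_intros)
  fix \<phi> assume tf: "test_function a b \<phi>"
  note \<phi> = test_functionD[OF tf]
  have c: "continuous_on {a..b} (deriv \<phi>)" "continuous_on {a..b} \<phi>"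
    by (rule continuous_on_subset[OF \<phi>(2)] continuous_on_subset[OF \<phi>(3)]; simp)+
  have i: "integrable ?M (\<lambda>t. deriv \<phi> t *\<^sub>R X t)" "integrable ?M (\<lambda>t. deriv \<phi> t *\<^sub>R Y t)"
    by (intro continuous_imp_integrable_real continuous_intros c X Y)+
  have j: "integrable ?M (\<lambda>t. \<phi> t *\<^sub>R V t)" "integrable ?M (\<lambda>t. \<phi> t *\<^sub>R W t)"
    by (intro square_integrable_onD(3) square_integrable_on_scaleR V W c)+
  have "(\<integral>t. deriv \<phi> t *\<^sub>R (1/2) *\<^sub>R (X t + Y t) \<partial>?M)
     = (\<integral>t. (1/2) *\<^sub>R (deriv \<phi> t *\<^sub>R X t + deriv \<phi> t *\<^sub>R Y t) \<partial>?M)"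
    by (simp add: scaleR_add_right)
  also have "\<dots> = (1/2) *\<^sub>R ((\<integral>t. deriv \<phi> t *\<^sub>R X t \<partial>?M) + (\<integral>t. deriv \<phi> t *\<^sub>R Y t \<partial>?M))" using i by simp
  also have "\<dots> = - ((1/2) *\<^sub>R ((\<integral>t. \<phi> t *\<^sub>R V t \<partial>?M) + (\<integral>t. \<phi> t *\<^sub>R W t \<partial>?M)))"
    unfolding weak_derivativeD(2)[OF X(1) tf] weak_derivativeD(2)[OF Y(1) tf] by (simp add: scaleR_add_right scaleR_diff_right)
  also have "(1/2) *\<^sub>R ((\<integral>t. \<phi> t *\<^sub>R V t \<partial>?M) + (\<integral>t. \<phi> t *\<^sub>R W t \<partial>?M)) = (\<integral>t. (1/2) *\<^sub>R (\<phi> t *\<^sub>R V t + \<phi> t *\<^sub>R W t) \<partial>?M)"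
    using j by simp
  also have "\<dots> = (\<integral>t. \<phi> t *\<^sub>R (1/2) *\<^sub>R (V t + W t) \<partial>?M)" by (simp add: scaleR_add_right)
  finally show "(\<integral>t. deriv \<phi> t *\<^sub>R (1/2) *\<^sub>R (X t + Y t) \<partial>?M) = - (\<integral>t. \<phi> t *\<^sub>R (1/2) *\<^sub>R (V t + W t) \<partial>?M)" .
qed

lemma inverse_Suc_tendsto_0_at: "filterlim (\<lambda>n. 1 / real (n + 2)) (at 0) sequentially"
proof -
  have "(\<lambda>n. 1 / real (n + 2)) \<longlonglongrightarrow> 0"
    using LIMSEQ_ignore_initial_segment[OF lim_1_over_n, of 2] by simp
  thus ?thesis by (simp add: filterlim_at)
qed

text \<open>A curve whose increments are dominated by integrals of an \<open>L\<^sup>2\<close> function \<open>m\<close> has a weak derivative dominated by \<open>m\<close>.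
  The Steklov averages of \<open>y\<close> are continuously differentiable, converge uniformly to \<open>y\<close>, and
  their derivatives are dominated by the difference quotients of a primitive of \<open>m\<close>, which converge to \<open>m\<close> in \<open>L\<^sup>1\<close> and are
  bounded in \<open>L\<^sup>2\<close>. So \<open>mazur_midpoint\<close> applies to the velocities of curves near \<open>y\<close> with an \<open>L\<^sup>1\<close> tolerance in the bound.\<close>

lemma weak_derivative_of_dominated_increments:
  fixes y :: "real \<Rightarrow> 'e::euclidean_space" and m :: "real \<Rightarrow> real"
  assumes ab: "a < b" and m: "square_integrable_on a b m"
    and le: "\<And>s t. a \<le> s \<Longrightarrow> s \<le> t \<Longrightarrow> t \<le> b \<Longrightarrow> norm (y t - y s) \<le> integral {s..t} m"
  obtains v where "continuous_on {a..b} y" "is_weak_derivative a b y v" "AE t in lebesgue_on {a..b}. norm (v t) \<le> m t"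
proof -
  let ?M = "lebesgue_on {a..b}"
  interpret finite_measure ?M by (rule finite_measure_lebesgue_on) simp
  have mi: "integrable ?M m" "integrable ?M (\<lambda>t. (m t)\<^sup>2)" using square_integrable_onD[OF m] by auto
  define \<alpha> where "\<alpha> = a - 1" define \<beta> where "\<beta> = b + 1"
  have \<alpha>\<beta>: "\<alpha> < a" "a \<le> b" "b < \<beta>" using ab by (auto simp: \<alpha>_def \<beta>_def)
  define cl where "cl t = max a (min b t)" for t
  have clr: "cl t \<in> {a..b}" for t using ab by (auto simp: cl_def)
  have clm: "cl s \<le> cl t" if "s \<le> t" for s t using that by (auto simp: cl_def)
  have cli: "cl t = t" if "t \<in> {a..b}" for t using that by (auto simp: cl_def)
  define P where "P t = integral {a..t} m" for t
  define P2 where "P2 t = integral {a..t} (\<lambda>x. (m x)\<^sup>2)" for t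
  define W where "W t = P (cl t)" for t
  define W2 where "W2 t = P2 (cl t)" for t
  define mc where "mc t = (if t \<in> {a..b} then m t else 0)" for t
  have W: "is_primitive \<alpha> \<beta> W mc" unfolding W_def mc_def cl_def P_def
    by (rule is_primitive_extend[OF _ is_primitive_indefinite_integral[OF mi(1)]]) (use ab in simp)
  have W2': "is_primitive \<alpha> \<beta> W2 (\<lambda>t. if t \<in> {a..b} then (m t)\<^sup>2 else 0)" unfolding W2_def cl_def P2_def
    by (rule is_primitive_extend[OF _ is_primitive_indefinite_integral[OF mi(2)]]) (use ab in simp)
  have sq: "(\<lambda>t. if t \<in> {a..b} then (m t)\<^sup>2 else 0) = (\<lambda>t. (mc t)\<^sup>2)" by (auto simp: mc_def)
  have W2: "is_primitive \<alpha> \<beta> W2 (\<lambda>t. (mc t)\<^sup>2)" using W2' unfolding sq .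
  have Wc: "continuous_on {\<alpha>..\<beta>} W" and W2c: "continuous_on {\<alpha>..\<beta>} W2"
    by (rule is_primitive_continuous_on, fact)+
  have Pinc: "norm (y t - y s) \<le> P t - P s" if "a \<le> s" "s \<le> t" "t \<le> b" for s t
    using le[OF that] is_primitive_indefinite_integral[OF mi(1)] that by (simp add: P_def is_primitive_def)
  define yc where "yc t = y (cl t)" for t
  have ycW: "norm (yc t - yc s) \<le> W t - W s" if "s \<le> t" for s t
    unfolding yc_def W_def using Pinc[of "cl s" "cl t"] clr[of s] clr[of t] clm[OF that] by simp
  have ycW': "norm (yc t - yc s) \<le> \<bar>W t - W s\<bar>" for s t
    using ycW[of s t] ycW[of t s] norm_minus_commute[of "yc t" "yc s"] by (cases "s \<le> t") auto
  have ycc: "continuous_on {\<alpha>..\<beta>} yc"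
    unfolding continuous_on_iff
  proof (intro ballI allI impI)
    fix x and e :: real assume x: "x \<in> {\<alpha>..\<beta>}" and e: "0 < e"
    then obtain d where d: "d > 0" "\<And>x'. x' \<in> {\<alpha>..\<beta>} \<Longrightarrow> dist x' x < d \<Longrightarrow> dist (W x') (W x) < e"
      using Wc unfolding continuous_on_iff by blast
    show "\<exists>d>0. \<forall>x'\<in>{\<alpha>..\<beta>}. dist x' x < d \<longrightarrow> dist (yc x') (yc x) < e"
      by (rule exI[of _ d]) (use d in \<open>auto simp: dist_norm intro: le_less_trans[OF ycW']\<close>)
  qed
  have yc_y: "yc t = y t" if "t \<in> {a..b}" for t using cli[OF that] by (simp add: yc_def)
  have yc: "continuous_on {a..b} y"
    by (rule continuous_on_eq[OF continuous_on_subset[OF ycc]]) (use yc_y \<alpha>\<beta> in auto)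
  define Y where "Y t = integral {\<alpha>..t} yc" for t
  have Y: "is_primitive \<alpha> \<beta> Y yc" unfolding Y_def
    by (rule is_primitive_indefinite_integral[OF continuous_imp_integrable_real[OF ycc]])
  define h where "h n = 1 / real (n + 2)" for n
  have h: "h n > 0" "h n < 1" for n by (auto simp: h_def)
  have hlim: "filterlim h (at 0) sequentially" using inverse_Suc_tendsto_0_at unfolding h_def .
  define yn where "yn n s = (1 / h n) *\<^sub>R (Y (s + h n) - Y s)" for n s
  define vn where "vn n s = (1 / h n) *\<^sub>R (yc (s + h n) - yc s)" for n s
  define mn where "mn n s = (W (s + h n) - W s) / h n" for n s
  have in\<alpha>\<beta>: "\<alpha> < s" "s < \<beta>" "\<alpha> < s + h n" "s + h n < \<beta>" if "s \<in> {a..b}" for s n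
    using that h[of n] by (auto simp: \<alpha>_def \<beta>_def)
  have vnc: "continuous_on {a..b} (vn n)" for n
    unfolding vn_def using in\<alpha>\<beta>(1,2) in\<alpha>\<beta>(3,4)[of _ n]
    by (intro continuous_intros continuous_on_compose2[OF ycc]) (auto intro: less_imp_le)
  have mnc: "continuous_on {a..b} (mn n)" for n
    unfolding mn_def using in\<alpha>\<beta>(1,2) in\<alpha>\<beta>(3,4)[of _ n] h(1)[of n]
    by (intro continuous_intros continuous_on_compose2[OF Wc]) (auto intro: less_imp_le)
  have ynd: "(yn n has_vector_derivative vn n s) (at s within {a..b})" if s: "s \<in> {a..b}" for n s
  proof -
    have Yd: "(Y has_vector_derivative yc x) (at x)" if "\<alpha> < x" "x < \<beta>" for x
      unfolding Y_def by (rule has_vector_derivative_indefinite_integral[OF ycc that])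
    have sh: "((\<lambda>s. s + h n) has_vector_derivative 1) (at s)" by (auto intro!: derivative_eq_intros)
    have "((\<lambda>s. Y (s + h n)) has_vector_derivative 1 *\<^sub>R yc (s + h n)) (at s)"
      using vector_diff_chain_at[OF sh Yd[OF in\<alpha>\<beta>(3,4)[OF s]]] by (simp add: o_def)
    hence "((\<lambda>s. Y (s + h n)) has_vector_derivative yc (s + h n)) (at s)" by simp
    from has_vector_derivative_diff[OF this Yd[OF in\<alpha>\<beta>(1,2)[OF s]]]
    have "((\<lambda>s. Y (s + h n) - Y s) has_vector_derivative yc (s + h n) - yc s) (at s)" .
    from bounded_linear.has_vector_derivative[OF bounded_linear_scaleR_right[of "1 / h n"] this]
    have "(yn n has_vector_derivative vn n s) (at s)" unfolding yn_def[abs_def] vn_def .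
    thus ?thesis by (rule has_vector_derivative_at_within)
  qed
  have ynw: "is_weak_derivative a b (yn n) (vn n)" for n by (rule weak_derivative_C1[OF ab ynd vnc])
  have ync: "continuous_on {a..b} (yn n)" for n by (rule continuous_on_vector_derivative[OF ynd])
  have vm: "norm (vn n s) \<le> mn n s" for n s
    using ycW[of s "s + h n"] h(1)[of n] by (simp add: vn_def mn_def divide_right_mono)
  have W2mono: "W2 s \<le> W2 t" if st: "\<alpha> \<le> s" "s \<le> t" "t \<le> \<beta>" for s t
  proof -
    have i: "integrable (lebesgue_on {\<alpha>..\<beta>}) (\<lambda>t. (mc t)\<^sup>2)" using W2 by (simp add: is_primitive_def)
    have "0 \<le> integral {s..t} (\<lambda>t. (mc t)\<^sup>2)"
      by (rule Henstock_Kurzweil_Integration.integral_nonneg) (use integrable_on_subinterval_lebesgue[OF i] st in auto)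
    moreover have "W2 t - W2 s = integral {s..t} (\<lambda>t. (mc t)\<^sup>2)" using W2 st by (simp add: is_primitive_def)
    ultimately show ?thesis by linarith
  qed
  define C where "C = W2 \<beta> - W2 \<alpha>"
  have vC: "(\<integral>t. (norm (vn n t))\<^sup>2 \<partial>?M) \<le> C" for n
  proof -
    have hh: "h n \<noteq> 0" "\<bar>h n\<bar> < a - \<alpha>" "\<bar>h n\<bar> < \<beta> - b" using h[of n] by (auto simp: \<alpha>_def \<beta>_def)
    note Q = integral_quotient_le_range[OF \<alpha>\<beta> W2c W2mono hh]
    have "(\<integral>t. (norm (vn n t))\<^sup>2 \<partial>?M) \<le> (\<integral>s. (W2 (s + h n) - W2 s) / h n \<partial>?M)"
    proof (rule integral_mono[OF _ Q(1)])
      show "integrable ?M (\<lambda>t. (norm (vn n t))\<^sup>2)" by (intro continuous_imp_integrable_real continuous_intros vnc)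
      fix s assume "s \<in> space ?M"
      hence s: "s \<in> {a..b}" by simp
      have "(norm (vn n s))\<^sup>2 \<le> (mn n s)\<^sup>2" using vm by (intro power_mono) auto
      also have "\<dots> \<le> (W2 (s + h n) - W2 s) / h n" unfolding mn_def
        by (rule increment_sq_le[OF W W2]) (use in\<alpha>\<beta>(1,2)[OF s] in\<alpha>\<beta>(3,4)[OF s, of n] h(1)[of n] in auto)
      finally show "(norm (vn n s))\<^sup>2 \<le> (W2 (s + h n) - W2 s) / h n" .
    qed
    also have "\<dots> \<le> C" unfolding C_def by (rule Q(2))
    finally show ?thesis .
  qed
  have mlim: "(\<lambda>n. \<integral>s. norm (mn n s - m s) \<partial>?M) \<longlonglongrightarrow> 0"
  proof -
    have "(\<lambda>n. \<integral>s. norm ((1 / h n) *\<^sub>R (W (s + h n) - W s) - mc s) \<partial>?M) \<longlonglongrightarrow> 0"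
      by (rule filterlim_compose[OF steklov_quotient_L1[OF \<alpha>\<beta> W] hlim])
    moreover have "(\<integral>s. norm ((1 / h n) *\<^sub>R (W (s + h n) - W s) - mc s) \<partial>?M) = (\<integral>s. norm (mn n s - m s) \<partial>?M)" for n
      by (rule Bochner_Integration.integral_cong) (auto simp: mn_def mc_def)
    ultimately show ?thesis by simp
  qed
  have yu: "eventually (\<lambda>n. \<forall>s\<in>{a..b}. norm (yn n s - y s) \<le> e) sequentially" if "e > 0" for e
  proof -
    have "eventually (\<lambda>n. \<forall>s\<in>{a..b}. norm ((1 / h n) *\<^sub>R (Y (s + h n) - Y s) - yc s) \<le> e) sequentially"
      using quotient_uniform_of_continuous[OF \<alpha>\<beta> ycc that Y] hlim by (rule eventually_compose_filterlim)
    thus ?thesis by eventually_elim (simp add: yn_def yc_y)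
  qed
  \<comment> \<open>The closeness of the curves is uniform, but the bound on the velocity is relaxed in \<open>L\<^sup>1\<close> only, so that it is convex.\<close>
  define H where "H n = {v. \<exists>y' m'. is_weak_derivative a b y' v \<and> continuous_on {a..b} y' \<and>
     (\<forall>s\<in>{a..b}. norm (y' s - y s) \<le> 1 / real (Suc n)) \<and> (\<integral>t. (norm (v t))\<^sup>2 \<partial>?M) \<le> C \<and>
     integrable ?M m' \<and> (\<forall>s. norm (v s) \<le> m' s) \<and> (\<integral>s. norm (m' s - m s) \<partial>?M) \<le> 1 / real (Suc n)}" for n
  have "\<exists>f u. (\<forall>k. f k \<in> H k) \<and> u \<in> borel_measurable ?M \<and> integrable ?M (\<lambda>x. (norm (u x))\<^sup>2)
    \<and> (AE x in ?M. (\<lambda>k. f k x) \<longlonglongrightarrow> u x) \<and> (\<lambda>k. \<integral>x. norm (f k x - u x) \<partial>?M) \<longlonglongrightarrow> 0"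
  proof (rule mazur_midpoint[where H=H and C=C])
    show "H n \<subseteq> H k" if "k \<le> n" for k n
    proof -
      have "1 / real (Suc n) \<le> 1 / real (Suc k)" using that by (simp add: frac_le)
      thus ?thesis unfolding H_def by (blast intro: order_trans)
    qed
    show "H n \<noteq> {}" for n
    proof -
      have e: "1 / real (Suc n) > 0" by simp
      have "eventually (\<lambda>k. (\<integral>s. norm (mn k s - m s) \<partial>?M) < 1 / real (Suc n)) sequentially"
        by (rule order_tendstoD(2)[OF mlim e])
      with yu[OF e] have "eventually (\<lambda>k. vn k \<in> H n) sequentially"
      proof eventually_elim
        case (elim k)
        show ?case unfolding H_def mem_Collect_eq
          by (rule exI[of _ "yn k"], rule exI[of _ "mn k"])
             (use elim ynw ync vC vm continuous_imp_integrable_real[OF mnc] in auto)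
      qed
      thus ?thesis unfolding eventually_sequentially by blast
    qed
    show "(\<lambda>x. (1/2) *\<^sub>R (f x + g x)) \<in> H n" if fH: "f \<in> H n" and gH: "g \<in> H n" for f g n
    proof -
      obtain y1 m1 where 1: "is_weak_derivative a b y1 f" "continuous_on {a..b} y1"
        "\<And>s. s \<in> {a..b} \<Longrightarrow> norm (y1 s - y s) \<le> 1 / real (Suc n)" "(\<integral>t. (norm (f t))\<^sup>2 \<partial>?M) \<le> C"
        "integrable ?M m1" "\<And>s. norm (f s) \<le> m1 s" "(\<integral>s. norm (m1 s - m s) \<partial>?M) \<le> 1 / real (Suc n)"
        using fH unfolding H_def by blast
      obtain y2 m2 where 2: "is_weak_derivative a b y2 g" "continuous_on {a..b} y2"
        "\<And>s. s \<in> {a..b} \<Longrightarrow> norm (y2 s - y s) \<le> 1 / real (Suc n)" "(\<integral>t. (norm (g t))\<^sup>2 \<partial>?M) \<le> C"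
        "integrable ?M m2" "\<And>s. norm (g s) \<le> m2 s" "(\<integral>s. norm (m2 s - m s) \<partial>?M) \<le> 1 / real (Suc n)"
        using gH unfolding H_def by blast
      note W' = is_weak_derivative_midpoint[OF 1(1,2) 2(1,2)]
      have b1: "norm ((1/2) *\<^sub>R (y1 s + y2 s) - y s) \<le> 1 / real (Suc n)" if "s \<in> {a..b}" for s
      proof -
        have "(1/2) *\<^sub>R (y1 s + y2 s) - y s = (1/2) *\<^sub>R (y1 s + y2 s) - (1/2) *\<^sub>R (y s + y s)" by simp
        also have "\<dots> = (1/2) *\<^sub>R ((y1 s - y s) + (y2 s - y s))" by (simp add: scaleR_add_right scaleR_diff_right)
        finally have "(1/2) *\<^sub>R (y1 s + y2 s) - y s = (1/2) *\<^sub>R ((y1 s - y s) + (y2 s - y s))" .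
        thus ?thesis using 1(3)[OF that] 2(3)[OF that] norm_triangle_ineq[of "y1 s - y s" "y2 s - y s"] by simp
      qed
      have "(\<integral>t. (norm ((1/2) *\<^sub>R (f t + g t)))\<^sup>2 \<partial>?M) \<le> (\<integral>t. (norm (f t))\<^sup>2 / 2 + (norm (g t))\<^sup>2 / 2 \<partial>?M)"
        by (rule integral_mono[OF _ _ norm_mid_sq_le])
           (use square_integrable_onD(2)[OF weak_derivativeD(1)[OF W']] square_integrable_onD(2)[OF weak_derivativeD(1)[OF 1(1)]]
             square_integrable_onD(2)[OF weak_derivativeD(1)[OF 2(1)]] in auto)
      also have "\<dots> = (\<integral>t. (norm (f t))\<^sup>2 \<partial>?M) / 2 + (\<integral>t. (norm (g t))\<^sup>2 \<partial>?M) / 2"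
        using square_integrable_onD(2)[OF weak_derivativeD(1)[OF 1(1)]] square_integrable_onD(2)[OF weak_derivativeD(1)[OF 2(1)]] by simp
      finally have b2: "(\<integral>t. (norm ((1/2) *\<^sub>R (f t + g t)))\<^sup>2 \<partial>?M) \<le> C" using 1(4) 2(4) by linarith
      have b3: "norm ((1/2) *\<^sub>R (f s + g s)) \<le> (m1 s + m2 s) / 2" for s
        using norm_triangle_ineq[of "f s" "g s"] 1(6)[of s] 2(6)[of s] by simp
      have "(\<integral>s. norm ((m1 s + m2 s) / 2 - m s) \<partial>?M) \<le> (\<integral>s. norm (m1 s - m s) / 2 + norm (m2 s - m s) / 2 \<partial>?M)"
      proof (rule integral_mono)
        show "norm ((m1 s + m2 s) / 2 - m s) \<le> norm (m1 s - m s) / 2 + norm (m2 s - m s) / 2" for s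
        proof -
          have "(m1 s + m2 s) / 2 - m s = ((m1 s - m s) + (m2 s - m s)) / 2" by (simp add: field_simps)
          hence "norm ((m1 s + m2 s) / 2 - m s) = \<bar>(m1 s - m s) + (m2 s - m s)\<bar> / 2"
            by (simp only: real_norm_def abs_divide abs_numeral)
          also have "\<dots> \<le> (norm (m1 s - m s) + norm (m2 s - m s)) / 2"
            unfolding real_norm_def by (intro divide_right_mono abs_triangle_ineq) simp
          finally show ?thesis unfolding add_divide_distrib .
        qed
      qed (use 1(5) 2(5) mi in auto)
      also have "\<dots> = (\<integral>s. norm (m1 s - m s) \<partial>?M) / 2 + (\<integral>s. norm (m2 s - m s) \<partial>?M) / 2"
        using 1(5) 2(5) mi by simp
      finally have b4: "(\<integral>s. norm ((m1 s + m2 s) / 2 - m s) \<partial>?M) \<le> 1 / real (Suc n)" using 1(7) 2(7) by linarith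
      show ?thesis unfolding H_def mem_Collect_eq
        by (rule exI[of _ "\<lambda>s. (1/2) *\<^sub>R (y1 s + y2 s)"], rule exI[of _ "\<lambda>s. (m1 s + m2 s) / 2"],
            intro conjI ballI allI W' b1 b2 b3 b4 continuous_intros 1(2) 2(2)) (use 1(5) 2(5) in auto)
    qed
    fix f assume "f \<in> H 0"
    then obtain y1 where f: "is_weak_derivative a b y1 f" "(\<integral>t. (norm (f t))\<^sup>2 \<partial>?M) \<le> C" unfolding H_def by blast
    show "f \<in> borel_measurable ?M" "integrable ?M (\<lambda>x. (norm (f x))\<^sup>2)" "(\<integral>x. (norm (f x))\<^sup>2 \<partial>?M) \<le> C"
      using square_integrable_onD[OF weak_derivativeD(1)[OF f(1)]] f(2) by auto
  qed blast
  then obtain f v where f: "\<And>k. f k \<in> H k" and v: "v \<in> borel_measurable ?M" "integrable ?M (\<lambda>x. (norm (v x))\<^sup>2)"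
    and fv: "AE x in ?M. (\<lambda>k. f k x) \<longlonglongrightarrow> v x" "(\<lambda>k. \<integral>x. norm (f k x - v x) \<partial>?M) \<longlonglongrightarrow> 0" by blast
  define R where "R k y' m' \<longleftrightarrow> is_weak_derivative a b y' (f k) \<and> continuous_on {a..b} y' \<and>
     (\<forall>s\<in>{a..b}. norm (y' s - y s) \<le> 1 / real (Suc k)) \<and> integrable ?M m' \<and> (\<forall>s. norm (f k s) \<le> m' s) \<and>
     (\<integral>s. norm (m' s - m s) \<partial>?M) \<le> 1 / real (Suc k)" for k y' m'
  have "\<forall>k. \<exists>y' m'. R k y' m'" using f unfolding H_def R_def by blast
  then obtain y' m' where R: "\<And>k. R k (y' k) (m' k)" by metis
  have y': "\<And>k. is_weak_derivative a b (y' k) (f k)" "\<And>k. continuous_on {a..b} (y' k)"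
    "\<And>k s. s \<in> {a..b} \<Longrightarrow> norm (y' k s - y s) \<le> 1 / real (Suc k)"
    and m': "\<And>k. integrable ?M (m' k)" "\<And>k s. norm (f k s) \<le> m' k s" "\<And>k. (\<integral>s. norm (m' k s - m s) \<partial>?M) \<le> 1 / real (Suc k)"
    using R unfolding R_def by simp_all
  have Suc0: "(\<lambda>k. 1 / real (Suc k)) \<longlonglongrightarrow> 0" using LIMSEQ_Suc[OF lim_1_over_n] .
  have w: "is_weak_derivative a b y v"
  proof (rule weak_derivative_limit[OF _ y'(1,2) _ _ fv(2)])
    show "uniform_limit {a..b} y' y sequentially"
    proof (rule uniform_limitI)
      fix e :: real assume "e > 0"
      from order_tendstoD(2)[OF Suc0 this] show "\<forall>\<^sub>F n in sequentially. \<forall>x\<in>{a..b}. dist (y' n x) (y x) < e"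
        by eventually_elim (auto simp only: dist_norm intro: le_less_trans[OF y'(3)])
    qed
    show "square_integrable_on a b v" using v by (simp add: square_integrable_on_def)
  qed (use ab in simp)
  have "(\<lambda>k. \<integral>s. norm (m' k s - m s) \<partial>?M) \<longlonglongrightarrow> 0"
    by (rule Lim_null_comparison[OF _ Suc0]) (use m'(3) in auto)
  hence "\<exists>r::nat\<Rightarrow>nat. strict_mono r \<and> (AE s in ?M. (\<lambda>k. m' (r k) s - m s) \<longlonglongrightarrow> 0)"
    by (intro tendsto_L1_AE_subseq) (use m'(1) mi in auto)
  then obtain r :: "nat \<Rightarrow> nat" where r: "strict_mono r" "AE s in ?M. (\<lambda>k. m' (r k) s - m s) \<longlonglongrightarrow> 0" by blast
  have "AE t in ?M. norm (v t) \<le> m t" using r(2) fv(1)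
  proof eventually_elim
    case (elim t)
    have l: "(\<lambda>k. m' (r k) t) \<longlonglongrightarrow> m t" using elim(1) by (simp add: LIM_zero_iff)
    have "(\<lambda>k. norm (f (r k) t)) \<longlonglongrightarrow> norm (v t)"
      using LIMSEQ_subseq_LIMSEQ[OF tendsto_norm[OF elim(2)] r(1)] by (simp add: o_def)
    thus ?case by (rule LIMSEQ_le[OF _ l]) (use m'(2) in auto)
  qed
  from that[OF yc w this] show ?thesis .
qed

section \<open>Maximum and soft maximum of finitely many linear functions\<close>

lemma gradient_eqI:
  assumes "GDERIV h X :> D"
  shows "gradient h X = D"
  unfolding gradient_def
proof (rule the_equality)
  show "GDERIV h X :> D" by (rule assms)
  fix D' assume "GDERIV h X :> D'"
  hence "(\<lambda>v. v \<bullet> D') = (\<lambda>v. v \<bullet> D)"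
    using assms has_derivative_unique unfolding gderiv_def by blast
  hence "(D' - D) \<bullet> D' = (D' - D) \<bullet> D" by (rule fun_cong)
  hence "(D' - D) \<bullet> (D' - D) = 0" by (simp add: inner_diff_right)
  thus "D' = D" by simp
qed

text \<open>In the application \<open>I\<close> is the symmetric group and \<open>c \<sigma> = A\<^sup>\<sigma>\<close>.\<close>

locale vector_family =
  fixes I :: "'i set" and c :: "'i \<Rightarrow> 'e::euclidean_space"
  assumes finI: "finite I" and neI: "I \<noteq> {}"
begin

definition soft_max :: "real \<Rightarrow> 'e \<Rightarrow> real" where
  "soft_max \<epsilon> z = \<epsilon> * ln ((1 / card I) * (\<Sum>i\<in>I. exp ((z \<bullet> c i) / \<epsilon>)))"

definition soft_grad :: "real \<Rightarrow> 'e \<Rightarrow> 'e" where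
  "soft_grad \<epsilon> z = (\<Sum>i\<in>I. (exp ((z \<bullet> c i) / \<epsilon>) / (\<Sum>j\<in>I. exp ((z \<bullet> c j) / \<epsilon>))) *\<^sub>R c i)"

definition hard_max :: "'e \<Rightarrow> real" where
  "hard_max z = (MAX i\<in>I. z \<bullet> c i)"

definition radius :: real where "radius = (\<Sum>i\<in>I. norm (c i))"

text \<open>The largest relative entropy with respect to the uniform weights on \<open>I\<close>; it measures the distance
  of the soft maximum from the maximum.\<close>

definition entropy_bound :: real where "entropy_bound = ln (real (card I))"

lemma card_pos: "real (card I) > 0" using finI neI by (simp add: card_gt_0_iff)

lemma partition_pos: "(\<Sum>i\<in>I. exp ((z \<bullet> c i) / \<epsilon>)) > 0"
  using finI neI by (intro sum_pos) auto

lemma entropy_bound_nonneg: "0 \<le> entropy_bound"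
proof -
  have "card I \<ge> 1" using finI neI by (simp add: Suc_le_eq card_gt_0_iff)
  thus ?thesis unfolding entropy_bound_def by simp
qed

lemma radius_nonneg: "0 \<le> radius" unfolding radius_def by (intro sum_nonneg) auto

lemma norm_le_radius: "i \<in> I \<Longrightarrow> norm (c i) \<le> radius"
  unfolding radius_def using finI by (intro member_le_sum) auto

lemma soft_weights: "(\<Sum>i\<in>I. exp ((z \<bullet> c i) / \<epsilon>) / (\<Sum>j\<in>I. exp ((z \<bullet> c j) / \<epsilon>))) = 1"
  unfolding sum_divide_distrib[symmetric] using partition_pos[of z \<epsilon>] by simp

lemma norm_soft_grad_le: "norm (soft_grad \<epsilon> z) \<le> radius"
proof -
  let ?w = "\<lambda>i. exp ((z \<bullet> c i) / \<epsilon>) / (\<Sum>j\<in>I. exp ((z \<bullet> c j) / \<epsilon>))"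
  have w0: "0 \<le> ?w i" for i using partition_pos[of z \<epsilon>] by simp
  have "norm (soft_grad \<epsilon> z) \<le> (\<Sum>i\<in>I. norm (?w i *\<^sub>R c i))" unfolding soft_grad_def by (rule norm_sum)
  also have "\<dots> \<le> (\<Sum>i\<in>I. ?w i * radius)"
  proof (rule sum_mono)
    fix i assume "i \<in> I"
    thus "norm (?w i *\<^sub>R c i) \<le> ?w i * radius"
      using mult_left_mono[OF norm_le_radius w0] w0[of i] by (simp only: norm_scaleR abs_of_nonneg)
  qed
  also have "\<dots> = radius" unfolding sum_distrib_right[symmetric] soft_weights by simp
  finally show ?thesis .
qed

lemma soft_grad_continuous: "continuous_on A (soft_grad \<epsilon>)"
proof -
  have e: "continuous_on A (\<lambda>z. exp ((z \<bullet> c i) / \<epsilon>))" for i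
    unfolding divide_inverse by (intro continuous_intros)
  have "\<forall>x\<in>A. (\<Sum>j\<in>I. exp ((x \<bullet> c j) / \<epsilon>)) \<noteq> 0" using partition_pos by (metis less_irrefl)
  thus ?thesis unfolding soft_grad_def[abs_def] by (intro continuous_intros e)
qed

text \<open>The gradient is the average of the vectors with the Gibbs weights.\<close>

lemma soft_max_gderiv:
  assumes "\<epsilon> > 0"
  shows "GDERIV (soft_max \<epsilon>) z :> soft_grad \<epsilon> z"
proof -
  let ?Z = "\<lambda>z. \<Sum>i\<in>I. exp ((z \<bullet> c i) / \<epsilon>)"
  have e: "((\<lambda>z. exp ((z \<bullet> c i) / \<epsilon>)) has_derivative (\<lambda>h. exp ((z \<bullet> c i) / \<epsilon>) * ((h \<bullet> c i) / \<epsilon>))) (at z)" for i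
    using assms by (auto intro!: derivative_eq_intros)
  have Z: "(?Z has_derivative (\<lambda>h. \<Sum>i\<in>I. exp ((z \<bullet> c i) / \<epsilon>) * ((h \<bullet> c i) / \<epsilon>))) (at z)"
    by (rule has_derivative_sum) (rule e)
  have pos: "(1 / card I) * ?Z z > 0" using partition_pos card_pos by simp
  have l: "(ln has_real_derivative 1 / ((1 / card I) * ?Z z)) (at ((1 / card I) * ?Z z))"
    using DERIV_ln_divide[OF pos] .
  have "(soft_max \<epsilon> has_derivative
      (\<lambda>h. \<epsilon> * (1 / ((1 / card I) * ?Z z) * ((1 / card I) * (\<Sum>i\<in>I. exp ((z \<bullet> c i) / \<epsilon>) * ((h \<bullet> c i) / \<epsilon>)))))) (at z)"
    unfolding soft_max_def[abs_def]
    by (intro has_derivative_mult_right has_derivative_compose[OF has_derivative_mult_right[OF Z] l[unfolded has_field_derivative_def]])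
  also have "(\<lambda>h. \<epsilon> * (1 / ((1 / card I) * ?Z z) * ((1 / card I) * (\<Sum>i\<in>I. exp ((z \<bullet> c i) / \<epsilon>) * ((h \<bullet> c i) / \<epsilon>)))))
     = (\<lambda>h. h \<bullet> soft_grad \<epsilon> z)"
  proof
    fix h
    have "\<epsilon> * (1 / ((1 / card I) * ?Z z) * ((1 / card I) * (\<Sum>i\<in>I. exp ((z \<bullet> c i) / \<epsilon>) * ((h \<bullet> c i) / \<epsilon>))))
      = \<epsilon> * ((\<Sum>i\<in>I. exp ((z \<bullet> c i) / \<epsilon>) * ((h \<bullet> c i) / \<epsilon>)) / ?Z z)"
      using card_pos by simp
    also have "\<dots> = (\<Sum>i\<in>I. \<epsilon> * (exp ((z \<bullet> c i) / \<epsilon>) * ((h \<bullet> c i) / \<epsilon>) / ?Z z))"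
      unfolding sum_divide_distrib sum_distrib_left ..
    also have "\<dots> = (\<Sum>i\<in>I. exp ((z \<bullet> c i) / \<epsilon>) / ?Z z * (h \<bullet> c i))"
      using assms by (intro sum.cong) auto
    also have "\<dots> = h \<bullet> soft_grad \<epsilon> z" unfolding soft_grad_def inner_sum_right inner_scaleR_right ..
    finally show "\<epsilon> * (1 / ((1 / card I) * ?Z z) * ((1 / card I) * (\<Sum>i\<in>I. exp ((z \<bullet> c i) / \<epsilon>) * ((h \<bullet> c i) / \<epsilon>)))) = h \<bullet> soft_grad \<epsilon> z" .
  qed
  finally show ?thesis unfolding gderiv_def .
qed

lemma soft_max_continuous: "\<epsilon> > 0 \<Longrightarrow> continuous_on A (soft_max \<epsilon>)"
  by (intro continuous_at_imp_continuous_on ballI has_derivative_continuous)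
     (use soft_max_gderiv in \<open>auto simp: gderiv_def\<close>)

text \<open>The temperature can be absorbed in the argument. This is what removes the time variable.\<close>

lemma soft_grad_rescale: "soft_grad (\<epsilon> * t) X = soft_grad \<epsilon> ((1 / t) *\<^sub>R X)"
  unfolding soft_grad_def by (simp add: field_simps)

lemma hard_max_ge: "i \<in> I \<Longrightarrow> z \<bullet> c i \<le> hard_max z"
  unfolding hard_max_def using finI by (intro Max_ge) auto

lemma hard_max_attained: "\<exists>i\<in>I. hard_max z = z \<bullet> c i"
proof -
  have "hard_max z \<in> (\<lambda>i. z \<bullet> c i) ` I" unfolding hard_max_def using finI neI by (intro Max_in) auto
  thus ?thesis by auto
qed

lemma soft_max_le_hard_max:
  assumes "\<epsilon> > 0"
  shows "soft_max \<epsilon> z \<le> hard_max z"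
proof -
  have "(\<Sum>i\<in>I. exp ((z \<bullet> c i) / \<epsilon>)) \<le> (\<Sum>i\<in>I. exp (hard_max z / \<epsilon>))"
    using assms by (intro sum_mono) (simp add: divide_right_mono hard_max_ge)
  hence "(1 / card I) * (\<Sum>i\<in>I. exp ((z \<bullet> c i) / \<epsilon>)) \<le> exp (hard_max z / \<epsilon>)"
    using card_pos by (simp add: field_simps)
  moreover have "(1 / card I) * (\<Sum>i\<in>I. exp ((z \<bullet> c i) / \<epsilon>)) > 0" using partition_pos card_pos by simp
  ultimately have "ln ((1 / card I) * (\<Sum>i\<in>I. exp ((z \<bullet> c i) / \<epsilon>))) \<le> hard_max z / \<epsilon>"
    by (metis exp_gt_zero ln_exp ln_le_cancel_iff)
  hence "\<epsilon> * ln ((1 / card I) * (\<Sum>i\<in>I. exp ((z \<bullet> c i) / \<epsilon>))) \<le> \<epsilon> * (hard_max z / \<epsilon>)"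
    using assms by (intro mult_left_mono) auto
  thus ?thesis using assms by (simp add: soft_max_def)
qed

lemma hard_max_le_soft_max:
  assumes "\<epsilon> > 0"
  shows "hard_max z - \<epsilon> * entropy_bound \<le> soft_max \<epsilon> z"
proof -
  obtain i where i: "i \<in> I" "hard_max z = z \<bullet> c i" using hard_max_attained by blast
  have "exp ((z \<bullet> c i) / \<epsilon>) \<le> (\<Sum>i\<in>I. exp ((z \<bullet> c i) / \<epsilon>))"
    using finI i by (intro member_le_sum) auto
  hence "ln (exp ((z \<bullet> c i) / \<epsilon>)) \<le> ln (\<Sum>i\<in>I. exp ((z \<bullet> c i) / \<epsilon>))"
    by (subst ln_le_cancel_iff) (auto simp: partition_pos)
  moreover have "ln ((1 / card I) * (\<Sum>i\<in>I. exp ((z \<bullet> c i) / \<epsilon>))) = ln (\<Sum>i\<in>I. exp ((z \<bullet> c i) / \<epsilon>)) - entropy_bound"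
    using partition_pos[of z \<epsilon>] card_pos by (simp add: entropy_bound_def ln_div)
  ultimately have "(z \<bullet> c i) / \<epsilon> - entropy_bound \<le> ln ((1 / card I) * (\<Sum>i\<in>I. exp ((z \<bullet> c i) / \<epsilon>)))" by simp
  hence "\<epsilon> * ((z \<bullet> c i) / \<epsilon> - entropy_bound) \<le> soft_max \<epsilon> z"
    unfolding soft_max_def using assms by (intro mult_left_mono) auto
  thus ?thesis using assms i by (simp add: right_diff_distrib)
qed

text \<open>Convexity of the soft maximum, by Jensen's inequality: the exponential is compared with its tangent at the
  Gibbs mean \<open>m\<close>.\<close>

lemma soft_grad_subgradient:
  assumes "\<epsilon> > 0"
  shows "soft_grad \<epsilon> z \<in> subdifferential (soft_max \<epsilon>) z"
  unfolding subdifferential_def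
proof (rule CollectI, rule allI)
  fix Y
  let ?Z = "\<lambda>z. \<Sum>i\<in>I. exp ((z \<bullet> c i) / \<epsilon>)"
  let ?w = "\<lambda>i. exp ((z \<bullet> c i) / \<epsilon>) / ?Z z"
  define m where "m = (soft_grad \<epsilon> z \<bullet> (Y - z)) / \<epsilon>"
  have w0: "0 \<le> ?w i" for i using partition_pos[of z \<epsilon>] by simp
  have m: "m = (\<Sum>i\<in>I. ?w i * (((Y - z) \<bullet> c i) / \<epsilon>))"
    unfolding m_def soft_grad_def inner_sum_left sum_divide_distrib by (simp add: inner_commute)
  have "exp m = (\<Sum>i\<in>I. ?w i * (exp m * (1 + ((Y - z) \<bullet> c i) / \<epsilon> - m)))"
  proof -
    have "(\<Sum>i\<in>I. ?w i * (exp m * (1 + ((Y - z) \<bullet> c i) / \<epsilon> - m)))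
      = exp m * ((1 - m) * (\<Sum>i\<in>I. ?w i) + (\<Sum>i\<in>I. ?w i * (((Y - z) \<bullet> c i) / \<epsilon>)))"
      unfolding sum_distrib_left sum.distrib[symmetric] by (intro sum.cong refl) (simp only: algebra_simps)
    also have "\<dots> = exp m" unfolding soft_weights m[symmetric] by simp
    finally show ?thesis by simp
  qed
  also have "\<dots> \<le> (\<Sum>i\<in>I. ?w i * exp (((Y - z) \<bullet> c i) / \<epsilon>))"
  proof (intro sum_mono mult_left_mono w0)
    fix i
    let ?x = "((Y - z) \<bullet> c i) / \<epsilon>"
    have "exp m * (1 + (?x - m)) \<le> exp m * exp (?x - m)" by (intro mult_left_mono exp_ge_add_one_self) simp
    also have "\<dots> = exp ?x" by (simp add: exp_add[symmetric])
    finally show "exp m * (1 + ?x - m) \<le> exp ?x" by (simp add: algebra_simps)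
  qed
  also have "\<dots> = (\<Sum>i\<in>I. exp ((Y \<bullet> c i) / \<epsilon>) / ?Z z)"
    by (intro sum.cong refl) (simp add: exp_add[symmetric] inner_diff_left diff_divide_distrib)
  also have "\<dots> = ?Z Y / ?Z z" by (simp add: sum_divide_distrib)
  finally have le: "exp m \<le> ?Z Y / ?Z z" .
  have "m \<le> ln (?Z Y / ?Z z)" using le by (metis exp_gt_zero less_le_trans ln_exp ln_le_cancel_iff)
  also have "\<dots> = ln ((1 / card I) * ?Z Y) - ln ((1 / card I) * ?Z z)"
    using partition_pos[of z \<epsilon>] partition_pos[of Y \<epsilon>] card_pos by (simp add: ln_div)
  finally have "\<epsilon> * m \<le> soft_max \<epsilon> Y - soft_max \<epsilon> z"
    unfolding soft_max_def right_diff_distrib[symmetric] using assms by (intro mult_left_mono) auto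
  moreover have "\<epsilon> * m = soft_grad \<epsilon> z \<bullet> (Y - z)" using assms by (simp add: m_def)
  ultimately show "soft_max \<epsilon> z + soft_grad \<epsilon> z \<bullet> (Y - z) \<le> soft_max \<epsilon> Y" by linarith
qed

lemma soft_max_zero: "soft_max \<epsilon> 0 = 0"
  unfolding soft_max_def using card_pos by simp

lemma soft_grad_approx_subgradient:
  assumes "\<epsilon> > 0"
  shows "hard_max Y \<ge> hard_max z + soft_grad \<epsilon> z \<bullet> (Y - z) - \<epsilon> * entropy_bound"
  using soft_grad_subgradient[OF assms, of z] soft_max_le_hard_max[OF assms, of Y] hard_max_le_soft_max[OF assms, of z]
  unfolding subdifferential_def by (auto dest!: spec[of _ Y])

text \<open>An approximate Euler identity. One half is the subgradient inequality between \<open>z\<close> and 0, the other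
  holds because an average does not exceed the maximum.\<close>

lemma soft_grad_inner_self:
  assumes "\<epsilon> > 0"
  shows "\<bar>z \<bullet> soft_grad \<epsilon> z - hard_max z\<bar> \<le> \<epsilon> * entropy_bound"
proof -
  have "hard_max z - \<epsilon> * entropy_bound \<le> z \<bullet> soft_grad \<epsilon> z"
  proof -
    have "soft_max \<epsilon> z + soft_grad \<epsilon> z \<bullet> (0 - z) \<le> soft_max \<epsilon> 0"
      using soft_grad_subgradient[OF assms, of z] unfolding subdifferential_def by blast
    hence "soft_max \<epsilon> z \<le> z \<bullet> soft_grad \<epsilon> z" by (simp add: soft_max_zero inner_commute)
    thus ?thesis using hard_max_le_soft_max[OF assms, of z] by linarith
  qed
  moreover have "z \<bullet> soft_grad \<epsilon> z \<le> hard_max z"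
  proof -
    let ?w = "\<lambda>i. exp ((z \<bullet> c i) / \<epsilon>) / (\<Sum>j\<in>I. exp ((z \<bullet> c j) / \<epsilon>))"
    have w0: "0 \<le> ?w i" for i using partition_pos[of z \<epsilon>] by simp
    have "z \<bullet> soft_grad \<epsilon> z = (\<Sum>i\<in>I. ?w i * (z \<bullet> c i))" unfolding soft_grad_def inner_sum_right inner_scaleR_right ..
    also have "\<dots> \<le> (\<Sum>i\<in>I. ?w i * hard_max z)" by (intro sum_mono mult_left_mono hard_max_ge w0)
    also have "\<dots> = hard_max z" unfolding sum_distrib_right[symmetric] soft_weights by simp
    finally show ?thesis .
  qed
  moreover have "0 \<le> \<epsilon> * entropy_bound" using assms entropy_bound_nonneg by simp
  ultimately show ?thesis by linarith
qed

lemma hard_max_lipschitz: "\<bar>hard_max y - hard_max z\<bar> \<le> radius * norm (y - z)"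
proof -
  have "hard_max y - hard_max z \<le> radius * norm (y - z)" for y z
  proof -
    obtain i where i: "i \<in> I" "hard_max y = y \<bullet> c i" using hard_max_attained by blast
    have "hard_max y - hard_max z \<le> (y - z) \<bullet> c i" using i hard_max_ge[OF i(1), of z] by (simp add: inner_diff_left)
    also have "\<dots> \<le> norm (y - z) * norm (c i)" by (rule norm_cauchy_schwarz)
    also have "\<dots> \<le> norm (y - z) * radius" by (intro mult_left_mono norm_le_radius i) simp
    finally show ?thesis by (simp add: mult.commute)
  qed
  from this[of y z] this[of z y] show ?thesis by (simp add: norm_minus_commute)
qed

lemma hard_max_continuous: "continuous_on A hard_max"
proof -
  have "radius-lipschitz_on A hard_max"
    by (rule lipschitz_onI) (use hard_max_lipschitz radius_nonneg in \<open>auto simp: dist_norm\<close>)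
  thus ?thesis by (rule lipschitz_on_continuous_on)
qed

lemma hard_max_scale: "t \<ge> 0 \<Longrightarrow> hard_max (t *\<^sub>R z) = t * hard_max z"
proof (rule antisym)
  assume t: "t \<ge> 0"
  obtain i where i: "i \<in> I" "hard_max (t *\<^sub>R z) = (t *\<^sub>R z) \<bullet> c i" using hard_max_attained by blast
  thus "hard_max (t *\<^sub>R z) \<le> t * hard_max z" using t hard_max_ge[OF i(1), of z] by (simp add: mult_left_mono)
  obtain j where j: "j \<in> I" "hard_max z = z \<bullet> c j" using hard_max_attained by blast
  thus "t * hard_max z \<le> hard_max (t *\<^sub>R z)" using t hard_max_ge[OF j(1), of "t *\<^sub>R z"] by simp
qed

text \<open>Euler's identity for a function that is homogeneous of degree one: compare \<open>z\<close> with 0 and with \<open>2 z\<close>.\<close>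

lemma subgradient_inner_self:
  assumes "p \<in> subdifferential hard_max z"
  shows "p \<bullet> z = hard_max z"
proof -
  have le: "hard_max z + p \<bullet> (Y - z) \<le> hard_max Y" for Y using assms by (auto simp: subdifferential_def)
  have "hard_max z \<le> p \<bullet> z" using le[of 0] hard_max_scale[of 0 z] by simp
  moreover have "p \<bullet> z \<le> hard_max z" using le[of "2 *\<^sub>R z"] hard_max_scale[of 2 z] by (simp add: inner_diff_right)
  ultimately show ?thesis by simp
qed

lemma subdifferential_hard_max_rescale:
  assumes "t > 0"
  shows "subdifferential hard_max (t *\<^sub>R z) = subdifferential hard_max z"
proof -
  have sub: "subdifferential hard_max z \<subseteq> subdifferential hard_max (t *\<^sub>R z)" if t: "t > 0" for t z
  proof
    fix p assume p: "p \<in> subdifferential hard_max z"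
    have le: "hard_max z + p \<bullet> (Y - z) \<le> hard_max Y" for Y using p by (auto simp: subdifferential_def)
    show "p \<in> subdifferential hard_max (t *\<^sub>R z)"
      unfolding subdifferential_def
    proof (rule CollectI, rule allI)
      fix Y
      have "t * (hard_max z + p \<bullet> ((1/t) *\<^sub>R Y - z)) \<le> t * hard_max ((1/t) *\<^sub>R Y)"
        using le[of "(1/t) *\<^sub>R Y"] t by (intro mult_left_mono) auto
      thus "hard_max (t *\<^sub>R z) + p \<bullet> (Y - t *\<^sub>R z) \<le> hard_max Y"
        using t by (simp add: hard_max_scale inner_diff_right algebra_simps)
    qed
  qed
  have "subdifferential hard_max (t *\<^sub>R z) \<subseteq> subdifferential hard_max ((1/t) *\<^sub>R (t *\<^sub>R z))"
    by (rule sub) (use assms in simp)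
  thus ?thesis using sub[OF assms, of z] assms by auto
qed

text \<open>The subdifferential is closed and contains the vector of every maximising index.\<close>

lemma ext_gradient_hard_max:
  shows "ext_gradient hard_max z \<in> subdifferential hard_max z"
    and "p \<in> subdifferential hard_max z \<Longrightarrow> norm (ext_gradient hard_max z) \<le> norm p"
    and "norm (ext_gradient hard_max z) \<le> radius"
proof -
  let ?S = "subdifferential hard_max z"
  obtain i where i: "i \<in> I" "hard_max z = z \<bullet> c i" using hard_max_attained by blast
  have ci: "c i \<in> ?S" unfolding subdifferential_def
  proof (rule CollectI, rule allI)
    fix Y show "hard_max z + c i \<bullet> (Y - z) \<le> hard_max Y"
      using hard_max_ge[OF i(1), of Y] i(2) by (simp add: inner_diff_right inner_commute)
  qed
  have "?S = (\<Inter>Y. {p. hard_max z + p \<bullet> (Y - z) \<le> hard_max Y})" by (auto simp: subdifferential_def)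
  moreover have "closed (\<Inter>Y. {p. hard_max z + p \<bullet> (Y - z) \<le> hard_max Y})"
    by (intro closed_INT ballI closed_Collect_le continuous_intros)
  ultimately have cl: "closed ?S" by simp
  have ne: "?S \<noteq> {}" using ci by auto
  obtain p0 where p0: "p0 \<in> ?S" "\<And>y. y \<in> ?S \<Longrightarrow> dist 0 p0 \<le> dist 0 y"
    using distance_attains_inf[OF cl ne, of 0] by metis
  hence "is_arg_min norm (\<lambda>x. x \<in> ?S) p0" by (auto simp: is_arg_min_linorder)
  hence "is_arg_min norm (\<lambda>x. x \<in> ?S) (ext_gradient hard_max z)"
    unfolding ext_gradient_def arg_min_on_def arg_min_def by (rule someI)
  hence *: "ext_gradient hard_max z \<in> ?S" "\<forall>p\<in>?S. norm (ext_gradient hard_max z) \<le> norm p"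
    by (auto simp: is_arg_min_linorder)
  show "ext_gradient hard_max z \<in> ?S" by (rule *(1))
  show "norm (ext_gradient hard_max z) \<le> norm p" if "p \<in> ?S" using *(2) that by blast
  show "norm (ext_gradient hard_max z) \<le> radius" using *(2) ci norm_le_radius[OF i(1)] by force
qed

definition active :: "'e \<Rightarrow> 'i set" where "active z = {i \<in> I. z \<bullet> c i = hard_max z}"

text \<open>The subdifferential depends on \<open>z\<close> only through the indices that attain the maximum, since the others do
  not matter in a neighbourhood of \<open>z\<close>.\<close>

lemma subdifferential_active:
  "subdifferential hard_max z = {p. \<forall>d. \<exists>i\<in>active z. p \<bullet> d \<le> c i \<bullet> d}"
proof (intro equalityI subsetI CollectI allI)
  fix p d assume p: "p \<in> subdifferential hard_max z"
  show "\<exists>i\<in>active z. p \<bullet> d \<le> c i \<bullet> d"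
  proof (rule ccontr)
    assume "\<not> ?thesis"
    hence lt: "c i \<bullet> d < p \<bullet> d" if "i \<in> active z" for i using that by force
    have "eventually (\<lambda>h. (z + h *\<^sub>R d) \<bullet> c i < hard_max z + h * (p \<bullet> d)) (at_right 0)" if i: "i \<in> I" for i
    proof (cases "i \<in> active z")
      case True
      have "eventually (\<lambda>h::real. h > 0) (at_right 0)" by (rule eventually_at_right_less)
      thus ?thesis
      proof eventually_elim
        case (elim h)
        have "(z + h *\<^sub>R d) \<bullet> c i = hard_max z + h * (c i \<bullet> d)"
          using True by (simp add: active_def inner_add_left inner_commute[of d])
        moreover have "h * (c i \<bullet> d) < h * (p \<bullet> d)" using elim lt[OF True] by simp
        ultimately show ?case by linarith
      qed
    next
      case False
      hence "z \<bullet> c i < hard_max z" using i hard_max_ge[OF i, of z] by (auto simp: active_def)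
      moreover have "((\<lambda>h. hard_max z + h * (p \<bullet> d) - (z + h *\<^sub>R d) \<bullet> c i) \<longlongrightarrow> hard_max z + 0 * (p \<bullet> d) - (z + 0 *\<^sub>R d) \<bullet> c i) (at_right 0)"
        by (intro tendsto_intros)
      ultimately have "eventually (\<lambda>h. 0 < hard_max z + h * (p \<bullet> d) - (z + h *\<^sub>R d) \<bullet> c i) (at_right 0)"
        by (intro order_tendstoD(1)[of _ _ "at_right 0" 0]) auto
      thus ?thesis by eventually_elim simp
    qed
    hence "eventually (\<lambda>h. \<forall>i\<in>I. (z + h *\<^sub>R d) \<bullet> c i < hard_max z + h * (p \<bullet> d)) (at_right 0)"
      using finI by (intro eventually_ball_finite) auto
    hence "\<exists>h. \<forall>i\<in>I. (z + h *\<^sub>R d) \<bullet> c i < hard_max z + h * (p \<bullet> d)"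
      using eventually_happens[of _ "at_right (0::real)"] by auto
    then obtain h where "\<forall>i\<in>I. (z + h *\<^sub>R d) \<bullet> c i < hard_max z + h * (p \<bullet> d)" by blast
    moreover obtain i where "i \<in> I" "hard_max (z + h *\<^sub>R d) = (z + h *\<^sub>R d) \<bullet> c i" using hard_max_attained by blast
    ultimately have "hard_max (z + h *\<^sub>R d) < hard_max z + p \<bullet> ((z + h *\<^sub>R d) - z)" by simp
    moreover have "hard_max z + p \<bullet> ((z + h *\<^sub>R d) - z) \<le> hard_max (z + h *\<^sub>R d)"
      using p unfolding subdifferential_def by blast
    ultimately show False by linarith
  qed
next
  fix p assume p: "p \<in> {p. \<forall>d. \<exists>i\<in>active z. p \<bullet> d \<le> c i \<bullet> d}"
  show "p \<in> subdifferential hard_max z" unfolding subdifferential_def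
  proof (rule CollectI, rule allI)
    fix Y
    obtain i where i: "i \<in> active z" "p \<bullet> (Y - z) \<le> c i \<bullet> (Y - z)" using p by blast
    hence "i \<in> I" "z \<bullet> c i = hard_max z" by (auto simp: active_def)
    thus "hard_max z + p \<bullet> (Y - z) \<le> hard_max Y"
      using i(2) hard_max_ge[of i Y] by (simp add: inner_diff_right inner_commute)
  qed
qed

text \<open>By \<open>subdifferential_active\<close> the extended gradient is constant on each of the finitely many sets where the active indices
  are prescribed, and these sets are Borel.\<close>

lemma ext_gradient_measurable: "ext_gradient hard_max \<in> borel_measurable borel"
proof -
  define \<Phi> where "\<Phi> J = (arg_min_on norm {p. \<forall>d. \<exists>i\<in>J. p \<bullet> d \<le> c i \<bullet> d} :: 'e)" for J
  have eq: "ext_gradient hard_max = (\<lambda>z. \<Phi> (active z))"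
    unfolding ext_gradient_def[abs_def] \<Phi>_def subdifferential_active ..
  have hm[measurable]: "hard_max \<in> borel_measurable borel"
    by (rule borel_measurable_continuous_onI[OF hard_max_continuous])
  have closed_eq: "closed {z. z \<bullet> c i = hard_max z}" for i
    by (intro closed_Collect_eq continuous_intros hard_max_continuous)
  have level: "active -` {J} \<in> sets borel" if "J \<in> Pow I" for J
  proof -
    have "active -` {J} = (\<Inter>i\<in>I. if i \<in> J then {z. z \<bullet> c i = hard_max z} else - {z. z \<bullet> c i = hard_max z})"
    proof (rule set_eqI)
      fix z
      have "active z = J \<longleftrightarrow> (\<forall>i\<in>I. i \<in> J \<longleftrightarrow> i \<in> active z)"
        using that by (auto simp only: active_def)
      also have "\<dots> \<longleftrightarrow> (\<forall>i\<in>I. z \<in> (if i \<in> J then {z. z \<bullet> c i = hard_max z} else - {z. z \<bullet> c i = hard_max z}))"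
        by (intro ball_cong refl) (simp add: active_def)
      finally show "z \<in> active -` {J} \<longleftrightarrow>
          z \<in> (\<Inter>i\<in>I. if i \<in> J then {z. z \<bullet> c i = hard_max z} else - {z. z \<bullet> c i = hard_max z})"
        by (simp only: vimage_singleton_eq INT_iff)
    qed
    moreover have "(\<Inter>i\<in>I. if i \<in> J then {z. z \<bullet> c i = hard_max z} else - {z. z \<bullet> c i = hard_max z}) \<in> sets borel"
      by (rule sets.finite_INT[OF finI neI]) (simp add: borel_closed[OF closed_eq] borel_comp)
    ultimately show ?thesis by simp
  qed
  have "finite (Pow I)" using finI by simp
  moreover have "active \<in> space borel \<rightarrow> Pow I \<and> (\<forall>a\<in>Pow I. active -` {a} \<inter> space borel \<in> sets borel)"
    using level by (auto simp: active_def)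
  ultimately have "active \<in> measurable borel (count_space (Pow I))"
    by (subst measurable_count_space_eq2) blast+
  moreover have "\<Phi> \<in> measurable (count_space (Pow I)) borel" by simp
  ultimately show ?thesis unfolding eq by (rule measurable_compose)
qed

text \<open>By Brouwer's theorem, since the gradient is continuous and bounded.\<close>

lemma resolvent_exists:
  assumes "\<tau> \<ge> 0"
  shows "\<exists>y. y + \<tau> *\<^sub>R soft_grad \<epsilon> y = x"
proof -
  let ?g = "\<lambda>y. x - \<tau> *\<^sub>R soft_grad \<epsilon> y"
  have "0 < \<tau> * radius + 1" using assms radius_nonneg by (simp add: add_nonneg_pos)
  moreover have "continuous_on (cball x (\<tau> * radius + 1)) ?g" by (intro continuous_intros soft_grad_continuous)
  moreover have "?g \<in> cball x (\<tau> * radius + 1) \<rightarrow> cball x (\<tau> * radius + 1)"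
  proof
    fix y
    have "\<tau> * norm (soft_grad \<epsilon> y) \<le> \<tau> * radius" using assms norm_soft_grad_le by (intro mult_left_mono)
    thus "?g y \<in> cball x (\<tau> * radius + 1)" using assms by (simp add: dist_norm)
  qed
  ultimately obtain y where "?g y = y" using brouwer_ball[of "\<tau> * radius + 1" x ?g] by blast
  thus ?thesis by (metis diff_add_cancel)
qed

definition resolvent :: "real \<Rightarrow> real \<Rightarrow> 'e \<Rightarrow> 'e" where
  "resolvent \<epsilon> \<tau> x = (SOME y. y + \<tau> *\<^sub>R soft_grad \<epsilon> y = x)"

lemma resolvent_eq: "\<tau> \<ge> 0 \<Longrightarrow> resolvent \<epsilon> \<tau> x + \<tau> *\<^sub>R soft_grad \<epsilon> (resolvent \<epsilon> \<tau> x) = x"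
  unfolding resolvent_def by (rule someI_ex[OF resolvent_exists])

lemma resolvent_zero: "resolvent \<epsilon> 0 x = x"
  using resolvent_eq[of 0 \<epsilon> x] by simp

lemma soft_grad_monotone:
  assumes "\<epsilon> > 0"
  shows "0 \<le> (soft_grad \<epsilon> x - soft_grad \<epsilon> y) \<bullet> (x - y)"
proof -
  have "soft_max \<epsilon> x + soft_grad \<epsilon> x \<bullet> (y - x) \<le> soft_max \<epsilon> y" "soft_max \<epsilon> y + soft_grad \<epsilon> y \<bullet> (x - y) \<le> soft_max \<epsilon> x"
    using soft_grad_subgradient[OF assms, of x] soft_grad_subgradient[OF assms, of y] unfolding subdifferential_def by blast+
  thus ?thesis by (simp add: inner_diff_left inner_diff_right)
qed

text \<open>The gradient is monotone, so subtracting the two equations and pairing with the difference of the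
  solutions leaves only the data. Dependence on \<open>\<tau>\<close> costs the bound of the gradient.\<close>

lemma resolvent_lipschitz:
  assumes \<epsilon>: "\<epsilon> > 0" and \<tau>: "\<tau>1 \<ge> 0" "\<tau>2 \<ge> 0"
  shows "norm (resolvent \<epsilon> \<tau>1 x1 - resolvent \<epsilon> \<tau>2 x2) \<le> norm (x1 - x2) + \<bar>\<tau>1 - \<tau>2\<bar> * radius"
proof -
  define y1 where "y1 = resolvent \<epsilon> \<tau>1 x1"
  define y2 where "y2 = resolvent \<epsilon> \<tau>2 x2"
  let ?G = "soft_grad \<epsilon>"
  have e: "y1 + \<tau>1 *\<^sub>R ?G y1 = x1" "y2 + \<tau>2 *\<^sub>R ?G y2 = x2" unfolding y1_def y2_def by (intro resolvent_eq \<tau>)+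
  define r where "r = x1 - x2 + (\<tau>2 - \<tau>1) *\<^sub>R ?G y2"
  have "(y1 - y2) + \<tau>1 *\<^sub>R (?G y1 - ?G y2) = r" unfolding r_def e[symmetric] by (simp add: algebra_simps)
  hence "r \<bullet> (y1 - y2) = (y1 - y2) \<bullet> (y1 - y2) + \<tau>1 * ((?G y1 - ?G y2) \<bullet> (y1 - y2))"
    by (metis inner_add_left inner_scaleR_left)
  moreover have "0 \<le> \<tau>1 * ((?G y1 - ?G y2) \<bullet> (y1 - y2))" using \<tau> soft_grad_monotone[OF \<epsilon>] by simp
  ultimately have "norm (y1 - y2) * norm (y1 - y2) \<le> r \<bullet> (y1 - y2)"
    by (simp add: dot_square_norm power2_eq_square)
  also have "\<dots> \<le> norm r * norm (y1 - y2)" by (rule norm_cauchy_schwarz)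
  finally have "norm (y1 - y2) \<le> norm r" by (cases "norm (y1 - y2) = 0") (auto simp: mult_le_cancel_right)
  also have "\<dots> \<le> norm (x1 - x2) + norm ((\<tau>2 - \<tau>1) *\<^sub>R ?G y2)" unfolding r_def by (rule norm_triangle_ineq)
  also have "norm ((\<tau>2 - \<tau>1) *\<^sub>R ?G y2) \<le> \<bar>\<tau>1 - \<tau>2\<bar> * radius"
    unfolding norm_scaleR abs_minus_commute[of \<tau>2] by (intro mult_left_mono norm_soft_grad_le) simp
  finally show ?thesis by (simp add: y1_def y2_def)
qed

text \<open>The approximate form of the fact that the gradient at the resolvent of \<open>x\<close> is not longer than any
  subgradient at \<open>x\<close>. Adding the two subgradient inequalities between \<open>x\<close> and its resolvent \<open>y\<close> gives
  \<open>\<tau> |q|\<^sup>2 \<le> \<tau> p \<bullet> q\<close> up to the error between the two maxima.\<close>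

lemma soft_grad_resolvent_le:
  assumes \<epsilon>: "\<epsilon> > 0" and \<tau>: "\<tau> > 0" and p: "p \<in> subdifferential hard_max x"
  shows "(norm (soft_grad \<epsilon> (resolvent \<epsilon> \<tau> x)))\<^sup>2 \<le> (norm p)\<^sup>2 + 2 * \<epsilon> * entropy_bound / \<tau>"
proof -
  define y where "y = resolvent \<epsilon> \<tau> x"
  define q where "q = soft_grad \<epsilon> y"
  have e: "y + \<tau> *\<^sub>R q = x" unfolding y_def q_def by (rule resolvent_eq) (use \<tau> in simp)
  have xy: "x - y = \<tau> *\<^sub>R q" "y - x = - (\<tau> *\<^sub>R q)" using e by (auto simp: algebra_simps)
  have "hard_max x + p \<bullet> (y - x) \<le> hard_max y" using p by (auto simp: subdifferential_def)
  moreover have "hard_max y + q \<bullet> (x - y) - \<epsilon> * entropy_bound \<le> hard_max x"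
    unfolding q_def by (rule soft_grad_approx_subgradient[OF \<epsilon>])
  ultimately have "\<tau> * (q \<bullet> q) \<le> \<tau> * (p \<bullet> q) + \<epsilon> * entropy_bound" unfolding xy by simp
  hence "q \<bullet> q \<le> p \<bullet> q + \<epsilon> * entropy_bound / \<tau>" using \<tau> by (simp add: field_simps)
  moreover have "2 * (p \<bullet> q) \<le> (norm p)\<^sup>2 + (norm q)\<^sup>2"
    using zero_le_power2[of "norm (p - q)"] by (simp add: power2_norm_eq_inner inner_diff_left inner_diff_right inner_commute)
  ultimately have "(norm q)\<^sup>2 \<le> (norm p)\<^sup>2 + 2 * (\<epsilon> * entropy_bound / \<tau>)" by (simp add: dot_square_norm)
  thus ?thesis unfolding q_def y_def by simp
qed

lemma hard_max_abs_le: "\<bar>hard_max x\<bar> \<le> radius * norm x"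
  using hard_max_lipschitz[of x 0] hard_max_scale[of 0 x] by simp

lemma soft_max_dist: "\<epsilon> > 0 \<Longrightarrow> \<bar>soft_max \<epsilon> x - hard_max x\<bar> \<le> \<epsilon> * entropy_bound"
  using soft_max_le_hard_max[of \<epsilon> x] hard_max_le_soft_max[of \<epsilon> x] by linarith

end

section \<open>The energy in the variable \<open>X / t\<close> and the lower bound\<close>

text \<open>With \<open>X = t z\<close> and velocity \<open>v\<close> of \<open>z\<close> this is \<open>X' - (X - g) / (2 t)\<close>; see \<open>action_eq_energy\<close>.\<close>

definition drift_defect :: "real \<Rightarrow> 'e::euclidean_space \<Rightarrow> 'e \<Rightarrow> 'e \<Rightarrow> 'e" where
  "drift_defect t v z g = t *\<^sub>R v + (1/2) *\<^sub>R z + (1 / (2 * t)) *\<^sub>R g"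

lemma drift_defect_midpoint:
  "drift_defect t ((1/2) *\<^sub>R (v + v')) ((1/2) *\<^sub>R (z + z')) ((1/2) *\<^sub>R (g + g')) =
   (1/2) *\<^sub>R (drift_defect t v z g + drift_defect t v' z' g')"
  unfolding drift_defect_def by (simp add: scaleR_add_right algebra_simps)

lemma norm_drift_defect_sq:
  assumes "t \<noteq> 0"
  shows "(norm (drift_defect t v z g))\<^sup>2 =
    t\<^sup>2 * (norm v)\<^sup>2 + (norm z)\<^sup>2 / 4 + (norm g)\<^sup>2 / (4 * t\<^sup>2) + t * (z \<bullet> v) + g \<bullet> v + (z \<bullet> g) / (2 * t)"
  using assms unfolding drift_defect_def power2_norm_eq_inner
  by (simp add: inner_add_left inner_add_right inner_commute field_simps power2_eq_square)

lemma has_subgradient_half_norm_sq: "z \<in> subdifferential (\<lambda>x. (norm x)\<^sup>2 / 2) z"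
  unfolding subdifferential_def
proof (rule CollectI, rule allI)
  fix Y
  have "0 \<le> (norm (Y - z))\<^sup>2" by simp
  thus "(norm z)\<^sup>2 / 2 + z \<bullet> (Y - z) \<le> (norm Y)\<^sup>2 / 2"
    by (simp add: power2_norm_eq_inner inner_diff_left inner_diff_right inner_commute)
qed

lemma bounded_convergence:
  fixes h :: "nat \<Rightarrow> real \<Rightarrow> real"
  assumes "\<And>n. h n \<in> borel_measurable (lebesgue_on {a..b})"
    and "\<And>n t. t \<in> {a..b} \<Longrightarrow> \<bar>h n t\<bar> \<le> C" and "AE t in lebesgue_on {a..b}. (\<lambda>n. h n t) \<longlonglongrightarrow> l t"
    and "l \<in> borel_measurable (lebesgue_on {a..b})"
  shows "(\<lambda>n. \<integral>t. h n t \<partial>lebesgue_on {a..b}) \<longlonglongrightarrow> (\<integral>t. l t \<partial>lebesgue_on {a..b})"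
proof -
  interpret finite_measure "lebesgue_on {a..b}" by (rule finite_measure_lebesgue_on) simp
  show ?thesis
    by (rule integral_dominated_convergence[where w="\<lambda>t. C"]) (use assms in \<open>auto intro!: AE_I2\<close>)
qed

lemma continuous_on_Icc_bounded:
  fixes f :: "real \<Rightarrow> 'e::real_normed_vector"
  assumes "continuous_on {a..b} f"
  shows "\<exists>C\<ge>0. \<forall>t\<in>{a..b}. norm (f t) \<le> C"
proof -
  have "bounded (f ` {a..b})" using assms compact_continuous_image compact_imp_bounded compact_Icc by blast
  then obtain C where C: "\<forall>x\<in>f ` {a..b}. norm x \<le> C" unfolding bounded_iff by blast
  show ?thesis by (intro exI[of _ "max C 0"]) (use C in \<open>auto simp: le_max_iff_disj\<close>)
qed

locale weighted_interval =
  fixes a b :: real and \<beta> \<beta>' :: "real \<Rightarrow> real"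
  assumes a_pos: "0 < a" and ab: "a < b"
    and \<beta>_pos: "\<And>t. t \<in> {a..b} \<Longrightarrow> 0 < \<beta> t"
    and \<beta>_deriv: "\<And>t. t \<in> {a..b} \<Longrightarrow> (\<beta> has_real_derivative \<beta>' t) (at t within {a..b})"
    and \<beta>'_cont: "continuous_on {a..b} \<beta>'"
begin

abbreviation "leb \<equiv> lebesgue_on {a..b}"

sublocale finite_measure leb by (rule finite_measure_lebesgue_on) simp

lemma \<beta>_cont: "continuous_on {a..b} \<beta>"
  using \<beta>_deriv DERIV_continuous_on by blast

lemma t_pos: "t \<in> {a..b} \<Longrightarrow> 0 < t" using a_pos by simp

definition energy :: "(real \<Rightarrow> 'e::euclidean_space) \<Rightarrow> (real \<Rightarrow> 'e) \<Rightarrow> (real \<Rightarrow> 'e) \<Rightarrow> real" where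
  "energy v z g = (\<integral>t. \<beta> t * (norm (drift_defect t (v t) (z t) (g t)))\<^sup>2 \<partial>leb)"

lemma inv_cont: "continuous_on {a..b} (\<lambda>t. 1 / (2 * t))"
  using a_pos by (intro continuous_intros) auto

lemma square_integrable_on_bounded:
  fixes g :: "real \<Rightarrow> 'e::euclidean_space"
  assumes "g \<in> borel_measurable leb" "\<And>t. t \<in> {a..b} \<Longrightarrow> norm (g t) \<le> K"
  shows "square_integrable_on a b g"
proof (rule square_integrable_on_bound[of a b "\<lambda>t. K" g])
  show "square_integrable_on a b (\<lambda>t. K)" by (rule square_integrable_on_continuous) (rule continuous_on_const)
  show "norm (g t) \<le> norm K" if "t \<in> {a..b}" for t using assms(2)[OF that] by simp
qed (rule assms(1))

lemma square_integrable_drift_defect: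
  fixes v z g :: "real \<Rightarrow> 'e::euclidean_space"
  assumes "square_integrable_on a b v" "continuous_on {a..b} z" "square_integrable_on a b g"
  shows "square_integrable_on a b (\<lambda>t. drift_defect t (v t) (z t) (g t))"
  unfolding drift_defect_def
  by (intro square_integrable_on_add square_integrable_on_scaleR assms square_integrable_on_continuous inv_cont
        continuous_intros)

lemma integrable_weighted_sq:
  fixes h :: "real \<Rightarrow> 'e::euclidean_space"
  assumes h: "square_integrable_on a b h" and \<gamma>: "continuous_on {a..b} \<gamma>"
  shows "integrable leb (\<lambda>t. \<gamma> t * (norm (h t))\<^sup>2)"
proof -
  obtain C where C: "C \<ge> 0" "\<And>t. t \<in> {a..b} \<Longrightarrow> norm (\<gamma> t) \<le> C" using continuous_on_Icc_bounded[OF \<gamma>] by auto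
  note [measurable] = borel_measurable_lebesgue_on_continuous[OF \<gamma>] square_integrable_onD(1)[OF h]
  show ?thesis
  proof (rule Bochner_Integration.integrable_bound[of leb "\<lambda>t. C * (norm (h t))\<^sup>2"])
    show "integrable leb (\<lambda>t. C * (norm (h t))\<^sup>2)" using square_integrable_onD(2)[OF h] by simp
    show "AE t in leb. norm (\<gamma> t * (norm (h t))\<^sup>2) \<le> norm (C * (norm (h t))\<^sup>2)"
    proof (rule AE_I2)
      fix t assume "t \<in> space leb"
      hence "\<bar>\<gamma> t\<bar> \<le> C" using C(2)[of t] by simp
      hence "\<bar>\<gamma> t\<bar> * (norm (h t))\<^sup>2 \<le> C * (norm (h t))\<^sup>2" by (rule mult_right_mono) simp
      thus "norm (\<gamma> t * (norm (h t))\<^sup>2) \<le> norm (C * (norm (h t))\<^sup>2)" using C(1) by (simp add: abs_mult)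
    qed
  qed simp
qed

lemma nn_integral_eq_energy:
  fixes v z g :: "real \<Rightarrow> 'e::euclidean_space"
  assumes "square_integrable_on a b v" "continuous_on {a..b} z" "square_integrable_on a b g"
  shows "(\<integral>\<^sup>+ t. ennreal ((norm (drift_defect t (v t) (z t) (g t)))\<^sup>2 * \<beta> t) \<partial>leb) = ennreal (energy v z g)"
  unfolding energy_def
proof (subst nn_integral_eq_integral[symmetric])
  show "integrable leb (\<lambda>t. \<beta> t * (norm (drift_defect t (v t) (z t) (g t)))\<^sup>2)"
    by (rule integrable_weighted_sq[OF square_integrable_drift_defect[OF assms] \<beta>_cont])
  show "AE t in leb. 0 \<le> \<beta> t * (norm (drift_defect t (v t) (z t) (g t)))\<^sup>2"
  proof (rule AE_I2)
    fix t assume "t \<in> space leb"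
    hence "0 \<le> \<beta> t" using \<beta>_pos[of t] by simp
    thus "0 \<le> \<beta> t * (norm (drift_defect t (v t) (z t) (g t)))\<^sup>2" by simp
  qed
qed (simp add: mult.commute)

text \<open>The part of the energy that depends only on the curve and on the values of the potential \<open>F\<close> along it. The two
  differences are the integrals of \<open>\<beta> t (|z|\<^sup>2 / 2)'\<close> and of \<open>\<beta> (F \<circ> z)'\<close> after integration by parts.\<close>

definition potential :: "('e::euclidean_space \<Rightarrow> real) \<Rightarrow> (real \<Rightarrow> 'e) \<Rightarrow> real" where
  "potential F z = (\<integral>t. \<beta> t * (norm (z t))\<^sup>2 / 4 \<partial>leb)
     + (\<beta> b * b * ((norm (z b))\<^sup>2 / 2) - \<beta> a * a * ((norm (z a))\<^sup>2 / 2) - (\<integral>t. (\<beta>' t * t + \<beta> t) * ((norm (z t))\<^sup>2 / 2) \<partial>leb))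
     + (\<beta> b * F (z b) - \<beta> a * F (z a) - (\<integral>t. \<beta>' t * F (z t) \<partial>leb))"

lemma integrable_bounded_on:
  fixes h :: "real \<Rightarrow> real"
  assumes "h \<in> borel_measurable leb" "\<And>t. t \<in> {a..b} \<Longrightarrow> \<bar>h t\<bar> \<le> C"
  shows "integrable leb h"
  by (rule integrable_const_bound[where B=C]) (use assms in \<open>auto intro!: AE_I2\<close>)

text \<open>The cross terms of the square with the velocity are evaluated by \<open>convex_chain_rule\<close>, once for \<open>F\<close> and once for
  half of the squared norm.\<close>

lemma energy_expand:
  fixes v z g :: "real \<Rightarrow> 'e::euclidean_space" and F :: "'e \<Rightarrow> real"
  assumes w: "is_weak_derivative a b z v" and zc: "continuous_on {a..b} z"
    and gm: "g \<in> borel_measurable leb" and gK: "\<And>t. t \<in> {a..b} \<Longrightarrow> norm (g t) \<le> K"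
    and Fc: "continuous_on UNIV F" and sub: "AE t in leb. g t \<in> subdifferential F (z t)"
  shows "integrable leb (\<lambda>t. (\<beta> t * t\<^sup>2) * (norm (v t))\<^sup>2)"
    and "integrable leb (\<lambda>t. (\<beta> t / (4 * t\<^sup>2)) * (norm (g t))\<^sup>2)"
    and "integrable leb (\<lambda>t. (\<beta> t / (2 * t)) * (z t \<bullet> g t))"
    and "energy v z g = (\<integral>t. (\<beta> t * t\<^sup>2) * (norm (v t))\<^sup>2 \<partial>leb) + (\<integral>t. (\<beta> t / (4 * t\<^sup>2)) * (norm (g t))\<^sup>2 \<partial>leb)
      + (\<integral>t. (\<beta> t / (2 * t)) * (z t \<bullet> g t) \<partial>leb) + potential F z"
proof -
  have v: "square_integrable_on a b v" by (rule weak_derivativeD(1)[OF w])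
  have g: "square_integrable_on a b g" by (rule square_integrable_on_bounded[OF gm gK])
  have p: "is_primitive a b z v" by (rule weak_derivative_is_primitive[OF ab w zc])
  have c4: "continuous_on {a..b} (\<lambda>t. \<beta> t / (4 * t\<^sup>2))" and c2: "continuous_on {a..b} (\<lambda>t. \<beta> t / (2 * t))"
    using a_pos by (intro continuous_intros \<beta>_cont; auto)+
  have c1: "continuous_on {a..b} (\<lambda>t. \<beta> t * t\<^sup>2)" by (intro continuous_intros \<beta>_cont)
  show i1: "integrable leb (\<lambda>t. (\<beta> t * t\<^sup>2) * (norm (v t))\<^sup>2)" by (rule integrable_weighted_sq[OF v c1])
  show i2: "integrable leb (\<lambda>t. (\<beta> t / (4 * t\<^sup>2)) * (norm (g t))\<^sup>2)" by (rule integrable_weighted_sq[OF g c4])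
  have i3: "integrable leb (\<lambda>t. \<beta> t * (norm (z t))\<^sup>2 / 4)"
    by (intro continuous_imp_integrable_real continuous_intros \<beta>_cont zc) auto
  obtain Z where Z: "Z \<ge> 0" "\<And>t. t \<in> {a..b} \<Longrightarrow> norm (z t) \<le> Z" using continuous_on_Icc_bounded[OF zc] by auto
  have zm: "z \<in> borel_measurable leb" by (rule borel_measurable_lebesgue_on_continuous[OF zc])
  note [measurable] = zm gm borel_measurable_lebesgue_on_continuous[OF c2]
  show i4: "integrable leb (\<lambda>t. (\<beta> t / (2 * t)) * (z t \<bullet> g t))"
  proof -
    obtain C where C: "C \<ge> 0" "\<And>t. t \<in> {a..b} \<Longrightarrow> norm (\<beta> t / (2 * t)) \<le> C" using continuous_on_Icc_bounded[OF c2] by auto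
    show ?thesis
    proof (rule integrable_bounded_on)
      fix t assume t: "t \<in> {a..b}"
      have "\<bar>z t \<bullet> g t\<bar> \<le> norm (z t) * norm (g t)" by (rule Cauchy_Schwarz_ineq2)
      also have "\<dots> \<le> Z * K" using Z gK[OF t] t by (intro mult_mono) auto
      finally show "\<bar>(\<beta> t / (2 * t)) * (z t \<bullet> g t)\<bar> \<le> C * (Z * K)"
        unfolding abs_mult using C t by (intro mult_mono) auto
    next
      show "(\<lambda>t. (\<beta> t / (2 * t)) * (z t \<bullet> g t)) \<in> borel_measurable leb" by measurable
    qed
  qed
  have \<beta>0: "0 \<le> \<beta> t" if "t \<in> {a..b}" for t using \<beta>_pos[OF that] by simp
  have n2c: "continuous_on UNIV (\<lambda>x::'e. (norm x)\<^sup>2 / 2)" by (intro continuous_intros) auto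
  have t\<beta>: "((\<lambda>t. \<beta> t * t) has_real_derivative \<beta>' t * t + \<beta> t) (at t within {a..b})" if "t \<in> {a..b}" for t
    using DERIV_mult[OF \<beta>_deriv[OF that] DERIV_ident] by (simp add: algebra_simps)
  have t\<beta>'c: "continuous_on {a..b} (\<lambda>t. \<beta>' t * t + \<beta> t)" by (intro continuous_intros \<beta>'_cont \<beta>_cont)
  have t\<beta>0: "0 \<le> \<beta> t * t" if "t \<in> {a..b}" for t using \<beta>0[OF that] t_pos[OF that] by simp
  note A = convex_chain_rule[OF ab p n2c zm Z(2) AE_I2[OF has_subgradient_half_norm_sq] t\<beta> t\<beta>'c t\<beta>0]
  note B = convex_chain_rule[OF ab p Fc gm gK sub \<beta>_deriv \<beta>'_cont \<beta>0]
  have "energy v z g = (\<integral>t. (\<beta> t * t\<^sup>2) * (norm (v t))\<^sup>2 + (\<beta> t / (4 * t\<^sup>2)) * (norm (g t))\<^sup>2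
      + (\<beta> t / (2 * t)) * (z t \<bullet> g t) + \<beta> t * (norm (z t))\<^sup>2 / 4 + (\<beta> t * t) * (z t \<bullet> v t) + \<beta> t * (g t \<bullet> v t) \<partial>leb)"
    unfolding energy_def
  proof (rule Bochner_Integration.integral_cong[OF refl])
    fix t assume "t \<in> space leb"
    hence "t \<noteq> 0" using t_pos[of t] by auto
    thus "\<beta> t * (norm (drift_defect t (v t) (z t) (g t)))\<^sup>2 = (\<beta> t * t\<^sup>2) * (norm (v t))\<^sup>2 + (\<beta> t / (4 * t\<^sup>2)) * (norm (g t))\<^sup>2
      + (\<beta> t / (2 * t)) * (z t \<bullet> g t) + \<beta> t * (norm (z t))\<^sup>2 / 4 + (\<beta> t * t) * (z t \<bullet> v t) + \<beta> t * (g t \<bullet> v t)"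
      unfolding norm_drift_defect_sq[OF \<open>t \<noteq> 0\<close>] by (simp add: algebra_simps)
  qed
  also have "\<dots> = (\<integral>t. (\<beta> t * t\<^sup>2) * (norm (v t))\<^sup>2 \<partial>leb) + (\<integral>t. (\<beta> t / (4 * t\<^sup>2)) * (norm (g t))\<^sup>2 \<partial>leb)
      + (\<integral>t. (\<beta> t / (2 * t)) * (z t \<bullet> g t) \<partial>leb) + (\<integral>t. \<beta> t * (norm (z t))\<^sup>2 / 4 \<partial>leb)
      + (\<integral>t. (\<beta> t * t) * (z t \<bullet> v t) \<partial>leb) + (\<integral>t. \<beta> t * (g t \<bullet> v t) \<partial>leb)"
    by (simp only: Bochner_Integration.integral_add Bochner_Integration.integrable_add i1 i2 i3 i4 A(1) B(1))
  finally show "energy v z g = (\<integral>t. (\<beta> t * t\<^sup>2) * (norm (v t))\<^sup>2 \<partial>leb) + (\<integral>t. (\<beta> t / (4 * t\<^sup>2)) * (norm (g t))\<^sup>2 \<partial>leb)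
      + (\<integral>t. (\<beta> t / (2 * t)) * (z t \<bullet> g t) \<partial>leb) + potential F z"
    unfolding potential_def using A(2) B(2) by linarith
qed

text \<open>Coercivity: the velocity is recovered from the defect up to bounded terms, and the weight is bounded
  below on the compact interval.\<close>

lemma velocity_bound:
  fixes Z R :: real
  shows "\<exists>c1\<ge>0. \<exists>c2\<ge>0. \<forall>t\<in>{a..b}. \<forall>v z g :: 'e::euclidean_space. norm z \<le> Z \<longrightarrow> norm g \<le> R \<longrightarrow>
    (norm v)\<^sup>2 \<le> c1 * (\<beta> t * (norm (drift_defect t v z g))\<^sup>2) + c2"
proof -
  obtain t0 where t0: "t0 \<in> {a..b}" "\<And>t. t \<in> {a..b} \<Longrightarrow> \<beta> t0 \<le> \<beta> t"
    using continuous_attains_inf[OF compact_Icc _ \<beta>_cont] ab by auto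
  define \<mu> where "\<mu> = \<beta> t0"
  have \<mu>: "0 < \<mu>" "\<And>t. t \<in> {a..b} \<Longrightarrow> \<mu> \<le> \<beta> t" using t0 \<beta>_pos by (auto simp: \<mu>_def)
  define q where "q = Z / 2 + R / (2 * a)"
  show ?thesis
  proof (rule exI[of _ "2 / (a\<^sup>2 * \<mu>)"], intro conjI, simp add: less_imp_le[OF \<mu>(1)],
      rule exI[of _ "2 * q\<^sup>2 / a\<^sup>2"], intro conjI ballI allI impI)
    fix t and v z g :: "'e::euclidean_space" assume t: "t \<in> {a..b}" and z: "norm z \<le> Z" and g: "norm g \<le> R"
    let ?D = "drift_defect t v z g"
    let ?e = "(1/2) *\<^sub>R z + (1 / (2 * t)) *\<^sub>R g"
    have R0: "0 \<le> R" using g norm_ge_zero[of g] by linarith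
    have "norm ?e \<le> norm z / 2 + norm g / (2 * t)"
      using norm_triangle_ineq[of "(1/2) *\<^sub>R z" "(1 / (2 * t)) *\<^sub>R g"] t_pos[OF t] by simp
    also have "\<dots> \<le> q"
    proof -
      have "norm z / 2 \<le> Z / 2" using z by simp
      moreover have "norm g / (2 * t) \<le> R / (2 * a)" using g t a_pos R0 by (intro frac_le) auto
      ultimately show ?thesis unfolding q_def by linarith
    qed
    finally have e: "(norm ?e)\<^sup>2 \<le> q\<^sup>2" by (intro power_mono) auto
    have "a\<^sup>2 * (norm v)\<^sup>2 \<le> t\<^sup>2 * (norm v)\<^sup>2" using t a_pos by (intro mult_right_mono power_mono) auto
    also have "\<dots> = (norm (?D - ?e))\<^sup>2" unfolding drift_defect_def by (simp add: power_mult_distrib)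
    also have "\<dots> \<le> 2 * (norm ?D)\<^sup>2 + 2 * (norm ?e)\<^sup>2" by (rule norm_sub_sq_le)
    also have "\<dots> \<le> 2 * (\<beta> t * (norm ?D)\<^sup>2 / \<mu>) + 2 * q\<^sup>2"
    proof -
      have "\<mu> * (norm ?D)\<^sup>2 \<le> \<beta> t * (norm ?D)\<^sup>2" using \<mu>(2)[OF t] by (rule mult_right_mono) simp
      hence "(norm ?D)\<^sup>2 \<le> \<beta> t * (norm ?D)\<^sup>2 / \<mu>" using \<mu>(1) by (simp add: pos_le_divide_eq mult.commute)
      thus ?thesis using e by linarith
    qed
    finally have "(norm v)\<^sup>2 \<le> (2 * (\<beta> t * (norm ?D)\<^sup>2 / \<mu>) + 2 * q\<^sup>2) / a\<^sup>2"
      using a_pos by (simp add: pos_le_divide_eq mult.commute)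
    also have "\<dots> = 2 / (a\<^sup>2 * \<mu>) * (\<beta> t * (norm ?D)\<^sup>2) + 2 * q\<^sup>2 / a\<^sup>2"
      by (simp add: add_divide_distrib mult.commute)
    finally show "(norm v)\<^sup>2 \<le> 2 / (a\<^sup>2 * \<mu>) * (\<beta> t * (norm ?D)\<^sup>2) + 2 * q\<^sup>2 / a\<^sup>2" .
  qed (use \<mu>(1) in auto)
qed

lemma energy_nonneg: "0 \<le> energy v z g"
  unfolding energy_def
proof (rule Bochner_Integration.integral_nonneg_AE, rule AE_I2)
  fix t assume "t \<in> space leb"
  hence "0 \<le> \<beta> t" using \<beta>_pos[of t] by simp
  thus "0 \<le> \<beta> t * (norm (drift_defect t (v t) (z t) (g t)))\<^sup>2" by simp
qed

lemma energy_midpoint_le: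
  fixes v v' z z' g g' :: "real \<Rightarrow> 'e::euclidean_space"
  assumes "square_integrable_on a b v" "continuous_on {a..b} z" "square_integrable_on a b g"
    and "square_integrable_on a b v'" "continuous_on {a..b} z'" "square_integrable_on a b g'"
    and m: "energy v z g \<le> m" "energy v' z' g' \<le> m"
  shows "energy (\<lambda>t. (1/2) *\<^sub>R (v t + v' t)) (\<lambda>t. (1/2) *\<^sub>R (z t + z' t)) (\<lambda>t. (1/2) *\<^sub>R (g t + g' t)) \<le> m"
proof -
  let ?D = "\<lambda>t. drift_defect t (v t) (z t) (g t)" and ?D' = "\<lambda>t. drift_defect t (v' t) (z' t) (g' t)"
  have s: "square_integrable_on a b ?D" "square_integrable_on a b ?D'"
    by (intro square_integrable_drift_defect assms)+
  have s': "square_integrable_on a b (\<lambda>t. (1/2) *\<^sub>R (?D t + ?D' t))"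
    by (intro square_integrable_on_scaleR square_integrable_on_add s continuous_intros)
  note i = integrable_weighted_sq[OF s(1) \<beta>_cont] integrable_weighted_sq[OF s(2) \<beta>_cont]
  have "energy (\<lambda>t. (1/2) *\<^sub>R (v t + v' t)) (\<lambda>t. (1/2) *\<^sub>R (z t + z' t)) (\<lambda>t. (1/2) *\<^sub>R (g t + g' t))
    = (\<integral>t. \<beta> t * (norm ((1/2) *\<^sub>R (?D t + ?D' t)))\<^sup>2 \<partial>leb)"
    unfolding energy_def drift_defect_midpoint ..
  also have "\<dots> \<le> (\<integral>t. \<beta> t * (norm (?D t))\<^sup>2 / 2 + \<beta> t * (norm (?D' t))\<^sup>2 / 2 \<partial>leb)"
  proof (rule integral_mono[OF integrable_weighted_sq[OF s' \<beta>_cont]])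
    fix t assume "t \<in> space leb"
    hence "0 \<le> \<beta> t" using \<beta>_pos[of t] by simp
    from mult_left_mono[OF norm_mid_sq_le this, of "?D t" "?D' t"]
    show "\<beta> t * (norm ((1/2) *\<^sub>R (?D t + ?D' t)))\<^sup>2 \<le> \<beta> t * (norm (?D t))\<^sup>2 / 2 + \<beta> t * (norm (?D' t))\<^sup>2 / 2"
      by (simp add: distrib_left)
  qed (use i in auto)
  also have "\<dots> = energy v z g / 2 + energy v' z' g' / 2" unfolding energy_def using i by simp
  finally show ?thesis using m by linarith
qed

lemma weighted_limit:
  fixes h :: "nat \<Rightarrow> real \<Rightarrow> real"
  assumes \<gamma>: "continuous_on {a..b} \<gamma>" and h: "\<And>n. continuous_on {a..b} (h n)"
    and C: "\<And>n t. t \<in> {a..b} \<Longrightarrow> \<bar>h n t\<bar> \<le> C" and lim: "\<And>t. t \<in> {a..b} \<Longrightarrow> (\<lambda>n. h n t) \<longlonglongrightarrow> l t"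
    and l: "continuous_on {a..b} l"
  shows "(\<lambda>n. \<integral>t. \<gamma> t * h n t \<partial>leb) \<longlonglongrightarrow> (\<integral>t. \<gamma> t * l t \<partial>leb)"
proof -
  obtain B where B: "B \<ge> 0" "\<And>t. t \<in> {a..b} \<Longrightarrow> norm (\<gamma> t) \<le> B" using continuous_on_Icc_bounded[OF \<gamma>] by auto
  show ?thesis
  proof (rule bounded_convergence)
    show "(\<lambda>t. \<gamma> t * h n t) \<in> borel_measurable leb" for n
      by (intro borel_measurable_lebesgue_on_continuous continuous_intros \<gamma> h)
    show "(\<lambda>t. \<gamma> t * l t) \<in> borel_measurable leb"
      by (intro borel_measurable_lebesgue_on_continuous continuous_intros \<gamma> l)
    show "\<bar>\<gamma> t * h n t\<bar> \<le> B * C" if "t \<in> {a..b}" for n t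
      unfolding abs_mult using B C that by (intro mult_mono) auto
    show "AE t in leb. (\<lambda>n. \<gamma> t * h n t) \<longlonglongrightarrow> \<gamma> t * l t"
      by (rule AE_I2) (auto intro!: tendsto_intros lim)
  qed
qed

end

locale soft_max_action = vector_family I c + weighted_interval a b \<beta> \<beta>'
  for I :: "'i set" and c :: "'i \<Rightarrow> 'e::euclidean_space" and a b :: real and \<beta> \<beta>' :: "real \<Rightarrow> real"
begin

lemma ext_gradient_curve_measurable:
  assumes "continuous_on {a..b} z"
  shows "(\<lambda>t. ext_gradient hard_max (z t)) \<in> borel_measurable leb"
  using measurable_compose[OF borel_measurable_lebesgue_on_continuous[OF assms] ext_gradient_measurable] .

text \<open>Both selections give the same cross terms and, by Euler's identity, the same \<open>z \<bullet> g\<close>. Only \<open>|g|\<^sup>2\<close>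
  differs.\<close>

lemma energy_ext_gradient_le:
  fixes v z g :: "real \<Rightarrow> 'e"
  assumes w: "is_weak_derivative a b z v" and zc: "continuous_on {a..b} z"
    and gm: "g \<in> borel_measurable leb" and gK: "\<And>t. t \<in> {a..b} \<Longrightarrow> norm (g t) \<le> K"
    and sub: "AE t in leb. g t \<in> subdifferential hard_max (z t)"
  shows "energy v z (\<lambda>t. ext_gradient hard_max (z t)) \<le> energy v z g"
proof -
  let ?p = "\<lambda>t. ext_gradient hard_max (z t)"
  note E1 = energy_expand[OF w zc ext_gradient_curve_measurable[OF zc] ext_gradient_hard_max(3) hard_max_continuous AE_I2[OF ext_gradient_hard_max(1)]]
  note E2 = energy_expand[OF w zc gm gK hard_max_continuous sub]
  have "(\<integral>t. (\<beta> t / (4 * t\<^sup>2)) * (norm (?p t))\<^sup>2 \<partial>leb) \<le> (\<integral>t. (\<beta> t / (4 * t\<^sup>2)) * (norm (g t))\<^sup>2 \<partial>leb)"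
  proof (rule integral_mono_AE[OF E1(2) E2(2)])
    show "AE t in leb. (\<beta> t / (4 * t\<^sup>2)) * (norm (?p t))\<^sup>2 \<le> (\<beta> t / (4 * t\<^sup>2)) * (norm (g t))\<^sup>2"
      using sub AE_space[of leb]
    proof eventually_elim
      case (elim t)
      hence "0 \<le> \<beta> t" using \<beta>_pos[of t] by simp
      thus ?case using ext_gradient_hard_max(2)[OF elim(1)] by (intro mult_left_mono power_mono) auto
    qed
  qed
  moreover have "(\<integral>t. (\<beta> t / (2 * t)) * (z t \<bullet> ?p t) \<partial>leb) = (\<integral>t. (\<beta> t / (2 * t)) * (z t \<bullet> g t) \<partial>leb)"
  proof (rule integral_cong_AE)
    show "AE t in leb. (\<beta> t / (2 * t)) * (z t \<bullet> ?p t) = (\<beta> t / (2 * t)) * (z t \<bullet> g t)" using sub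
    proof eventually_elim
      case (elim t)
      show ?case using subgradient_inner_self[OF elim] subgradient_inner_self[OF ext_gradient_hard_max(1), of "z t"]
        by (simp add: inner_commute)
    qed
  qed (use E1(3) E2(3) in auto)
  ultimately show ?thesis using E1(4) E2(4) by linarith
qed

text \<open>The constraint sets for \<open>mazur_midpoint\<close> consist of pairs of a velocity and a gradient. The approximate
  subgradient inequality is centred at \<open>z t\<close> instead of \<open>z' t\<close>, with an error uniform in \<open>Y\<close>. It is then affine in the gradient, so
  that combinations of gradients taken along different curves and at different \<open>\<epsilon>\<close> still satisfy it.\<close>

lemma energy_liminf:
  fixes z :: "real \<Rightarrow> 'e"
  assumes zc: "continuous_on {a..b} z" and \<kappa>: "0 \<le> \<kappa>"
    and approx: "\<And>n. \<exists>\<epsilon> z' v'. 0 < \<epsilon> \<and> \<epsilon> \<le> 1 / real (Suc n) \<and> is_weak_derivative a b z' v' \<and> continuous_on {a..b} z' \<and>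
       (\<forall>t\<in>{a..b}. norm (z' t - z t) \<le> \<kappa> / real (Suc n)) \<and> energy v' z' (\<lambda>t. soft_grad \<epsilon> (z' t)) \<le> m"
  shows "\<exists>v. is_weak_derivative a b z v \<and> energy v z (\<lambda>t. ext_gradient hard_max (z t)) \<le> m"
proof -
  define e0 where "e0 = 2 * radius * \<kappa> + entropy_bound"
  define S where "S n u z' \<longleftrightarrow> is_weak_derivative a b z' (\<lambda>t. fst (u t)) \<and> continuous_on {a..b} z' \<and>
     (\<forall>t\<in>{a..b}. norm (z' t - z t) \<le> \<kappa> / real (Suc n)) \<and> (\<lambda>t. snd (u t)) \<in> borel_measurable leb \<and>
     (\<forall>t\<in>{a..b}. norm (snd (u t)) \<le> radius) \<and>
     (\<forall>t\<in>{a..b}. \<forall>Y. hard_max (z t) + snd (u t) \<bullet> (Y - z t) - e0 / real (Suc n) \<le> hard_max Y) \<and>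
     energy (\<lambda>t. fst (u t)) z' (\<lambda>t. snd (u t)) \<le> m" for n and u :: "real \<Rightarrow> 'e \<times> 'e" and z'
  define H where "H n = {u. \<exists>z'. S n u z'}" for n
  obtain Z where Z: "Z \<ge> 0" "\<And>t. t \<in> {a..b} \<Longrightarrow> norm (z t) \<le> Z" using continuous_on_Icc_bounded[OF zc] by auto
  obtain c1 c2 where c12: "c1 \<ge> 0" "c2 \<ge> 0" "\<And>t v z g :: 'e. t \<in> {a..b} \<Longrightarrow> norm z \<le> Z + \<kappa> \<Longrightarrow> norm g \<le> radius \<Longrightarrow>
    (norm v)\<^sup>2 \<le> c1 * (\<beta> t * (norm (drift_defect t v z g))\<^sup>2) + c2"
    using velocity_bound[where 'e='e and Z="Z + \<kappa>" and R=radius] by auto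
  have e0: "e0 \<ge> 0" unfolding e0_def using radius_nonneg \<kappa> entropy_bound_nonneg by simp
  have frac: "x / real (Suc n) \<le> x / real (Suc k)" if "k \<le> n" "x \<ge> 0" for x k n using that by (simp add: frac_le)
  have sqS: "square_integrable_on a b (\<lambda>t. snd (u t))" if "S n u z'" for n u z'
    by (rule square_integrable_on_bounded) (use that in \<open>auto simp: S_def\<close>)
  have sqF: "square_integrable_on a b (\<lambda>t. fst (u t))" if "S n u z'" for n u z'
    using that weak_derivativeD(1) by (auto simp: S_def)
  have zcS: "continuous_on {a..b} z'" if "S n u z'" for n u z' using that by (simp add: S_def)
  have "\<exists>f u. (\<forall>k. f k \<in> H k) \<and> u \<in> borel_measurable leb \<and> integrable leb (\<lambda>x. (norm (u x))\<^sup>2)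
    \<and> (AE x in leb. (\<lambda>k. f k x) \<longlonglongrightarrow> u x) \<and> (\<lambda>k. \<integral>x. norm (f k x - u x) \<partial>leb) \<longlonglongrightarrow> 0"
  proof (rule mazur_midpoint[where H=H and C="c1 * m + (c2 + radius\<^sup>2) * (b - a)"])
    show "H n \<subseteq> H k" if kn: "k \<le> n" for k n
    proof
      fix u assume "u \<in> H n"
      then obtain z' where z': "S n u z'" by (auto simp: H_def)
      have "S k u z'" unfolding S_def
      proof (intro conjI ballI allI)
        fix t assume t: "t \<in> {a..b}"
        show "norm (z' t - z t) \<le> \<kappa> / real (Suc k)"
          by (rule order_trans[OF _ frac[OF kn \<kappa>]]) (use z' t in \<open>simp add: S_def\<close>)
        fix Y
        have "hard_max (z t) + snd (u t) \<bullet> (Y - z t) - e0 / real (Suc n) \<le> hard_max Y" using z' t unfolding S_def by blast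
        thus "hard_max (z t) + snd (u t) \<bullet> (Y - z t) - e0 / real (Suc k) \<le> hard_max Y" using frac[OF kn e0] by linarith
      qed (use z' in \<open>simp_all add: S_def\<close>)
      thus "u \<in> H k" by (auto simp: H_def)
    qed
    show "H n \<noteq> {}" for n
    proof -
      obtain \<epsilon> z' v' where 1: "0 < \<epsilon>" "\<epsilon> \<le> 1 / real (Suc n)" "is_weak_derivative a b z' v'" "continuous_on {a..b} z'"
        "\<And>t. t \<in> {a..b} \<Longrightarrow> norm (z' t - z t) \<le> \<kappa> / real (Suc n)" "energy v' z' (\<lambda>t. soft_grad \<epsilon> (z' t)) \<le> m"
        using approx[of n] by blast
      have "S n (\<lambda>t. (v' t, soft_grad \<epsilon> (z' t))) z'" unfolding S_def fst_conv snd_conv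
      proof (intro conjI ballI allI)
        show "(\<lambda>t. soft_grad \<epsilon> (z' t)) \<in> borel_measurable leb"
          by (rule borel_measurable_lebesgue_on_continuous)
             (rule continuous_on_compose2[OF soft_grad_continuous[of UNIV] 1(4)], simp)
        fix t Y assume t: "t \<in> {a..b}"
        let ?G = "soft_grad \<epsilon> (z' t)"
        have d: "norm (z' t - z t) \<le> \<kappa> / real (Suc n)" by (rule 1(5)[OF t])
        have "hard_max (z' t) + ?G \<bullet> (Y - z' t) - \<epsilon> * entropy_bound \<le> hard_max Y"
          by (rule soft_grad_approx_subgradient[OF 1(1)])
        moreover have "?G \<bullet> (Y - z t) - ?G \<bullet> (Y - z' t) \<le> radius * (\<kappa> / real (Suc n))"
        proof -
          have "?G \<bullet> (Y - z t) - ?G \<bullet> (Y - z' t) = ?G \<bullet> (z' t - z t)" by (simp add: inner_diff_right)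
          also have "\<dots> \<le> norm ?G * norm (z' t - z t)" by (rule norm_cauchy_schwarz)
          also have "\<dots> \<le> radius * (\<kappa> / real (Suc n))" by (rule mult_mono[OF norm_soft_grad_le d radius_nonneg]) simp
          finally show ?thesis .
        qed
        moreover have "hard_max (z t) - hard_max (z' t) \<le> radius * (\<kappa> / real (Suc n))"
          using hard_max_lipschitz[of "z t" "z' t"] mult_left_mono[OF d radius_nonneg] by (simp add: norm_minus_commute)
        moreover have "\<epsilon> * entropy_bound \<le> 1 / real (Suc n) * entropy_bound"
          by (rule mult_right_mono[OF 1(2) entropy_bound_nonneg])
        moreover have "e0 / real (Suc n) = radius * (\<kappa> / real (Suc n)) + radius * (\<kappa> / real (Suc n)) + 1 / real (Suc n) * entropy_bound"
          unfolding e0_def by (simp add: add_divide_distrib)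
        ultimately show "hard_max (z t) + ?G \<bullet> (Y - z t) - e0 / real (Suc n) \<le> hard_max Y" by linarith
      qed (use 1 norm_soft_grad_le in auto)
      thus ?thesis by (auto simp: H_def)
    qed
    show "(\<lambda>x. (1/2) *\<^sub>R (f x + g x)) \<in> H n" if fH: "f \<in> H n" and gH: "g \<in> H n" for f g n
    proof -
      obtain z1 where s1: "S n f z1" using fH by (auto simp: H_def)
      obtain z2 where s2: "S n g z2" using gH by (auto simp: H_def)
      have "S n (\<lambda>x. (1/2) *\<^sub>R (f x + g x)) (\<lambda>t. (1/2) *\<^sub>R (z1 t + z2 t))"
        unfolding S_def fst_scaleR snd_scaleR fst_add snd_add
      proof (intro conjI ballI allI)
        show "is_weak_derivative a b (\<lambda>t. (1/2) *\<^sub>R (z1 t + z2 t)) (\<lambda>t. (1/2) *\<^sub>R (fst (f t) + fst (g t)))"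
          by (rule is_weak_derivative_midpoint) (use s1 s2 in \<open>simp_all add: S_def\<close>)
        show "continuous_on {a..b} (\<lambda>t. (1/2) *\<^sub>R (z1 t + z2 t))" using zcS[OF s1] zcS[OF s2] by (intro continuous_intros)
        show "(\<lambda>t. (1/2) *\<^sub>R (snd (f t) + snd (g t))) \<in> borel_measurable leb"
          using s1 s2 unfolding S_def by (intro borel_measurable_scaleR borel_measurable_add borel_measurable_const) auto
        show "energy (\<lambda>t. (1/2) *\<^sub>R (fst (f t) + fst (g t))) (\<lambda>t. (1/2) *\<^sub>R (z1 t + z2 t)) (\<lambda>t. (1/2) *\<^sub>R (snd (f t) + snd (g t))) \<le> m"
          by (rule energy_midpoint_le[OF sqF[OF s1] zcS[OF s1] sqS[OF s1] sqF[OF s2] zcS[OF s2] sqS[OF s2]])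
             (use s1 s2 in \<open>simp_all add: S_def\<close>)
        fix t assume t: "t \<in> {a..b}"
        have "norm (z1 t - z t) \<le> \<kappa> / real (Suc n)" "norm (z2 t - z t) \<le> \<kappa> / real (Suc n)"
          using s1 s2 t by (simp_all add: S_def)
        moreover have e: "(1/2) *\<^sub>R (z1 t + z2 t) - z t = (1/2) *\<^sub>R ((z1 t - z t) + (z2 t - z t))"
        proof -
          have "(1/2) *\<^sub>R (z1 t + z2 t) - z t = (1/2) *\<^sub>R (z1 t + z2 t) - (1/2) *\<^sub>R (z t + z t)" by simp
          also have "\<dots> = (1/2) *\<^sub>R ((z1 t - z t) + (z2 t - z t))" by (simp add: scaleR_add_right scaleR_diff_right)
          finally show ?thesis .
        qed
        moreover have "norm ((1/2) *\<^sub>R (z1 t + z2 t) - z t) = norm ((z1 t - z t) + (z2 t - z t)) / 2" unfolding e by simp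
        ultimately show "norm ((1/2) *\<^sub>R (z1 t + z2 t) - z t) \<le> \<kappa> / real (Suc n)"
          using norm_triangle_ineq[of "z1 t - z t" "z2 t - z t"] by linarith
        have "norm (snd (f t)) \<le> radius" "norm (snd (g t)) \<le> radius" using s1 s2 t by (simp_all add: S_def)
        thus "norm ((1/2) *\<^sub>R (snd (f t) + snd (g t))) \<le> radius"
          using norm_triangle_ineq[of "snd (f t)" "snd (g t)"] by simp
        fix Y
        have "hard_max (z t) + snd (f t) \<bullet> (Y - z t) - e0 / real (Suc n) \<le> hard_max Y"
          "hard_max (z t) + snd (g t) \<bullet> (Y - z t) - e0 / real (Suc n) \<le> hard_max Y"
          using s1 s2 t unfolding S_def by blast+
        moreover have "((1/2) *\<^sub>R (snd (f t) + snd (g t))) \<bullet> (Y - z t) = (snd (f t) \<bullet> (Y - z t)) / 2 + (snd (g t) \<bullet> (Y - z t)) / 2"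
          by (simp add: inner_add_left add_divide_distrib)
        ultimately show "hard_max (z t) + ((1/2) *\<^sub>R (snd (f t) + snd (g t))) \<bullet> (Y - z t) - e0 / real (Suc n) \<le> hard_max Y"
          by linarith
      qed
      thus ?thesis by (auto simp: H_def)
    qed
    fix f assume "f \<in> H 0"
    then obtain z' where s: "S 0 f z'" by (auto simp: H_def)
    note sf = square_integrable_onD[OF sqF[OF s]] and ss = square_integrable_onD[OF sqS[OF s]]
    have "(\<lambda>t. (fst (f t), snd (f t))) \<in> borel_measurable leb"
      by (rule borel_measurable_Pair[OF sf(1) ss(1)])
    thus "f \<in> borel_measurable leb" by simp
    have np: "(norm (f t))\<^sup>2 = (norm (fst (f t)))\<^sup>2 + (norm (snd (f t)))\<^sup>2" for t
      by (simp add: norm_prod_def)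
    show i: "integrable leb (\<lambda>t. (norm (f t))\<^sup>2)" unfolding np using sf(2) ss(2) by simp
    let ?D = "\<lambda>t. drift_defect t (fst (f t)) (z' t) (snd (f t))"
    have iD: "integrable leb (\<lambda>t. \<beta> t * (norm (?D t))\<^sup>2)"
      by (rule integrable_weighted_sq[OF square_integrable_drift_defect[OF sqF[OF s] zcS[OF s] sqS[OF s]] \<beta>_cont])
    have "(\<integral>t. (norm (f t))\<^sup>2 \<partial>leb) \<le> (\<integral>t. c1 * (\<beta> t * (norm (?D t))\<^sup>2) + (c2 + radius\<^sup>2) \<partial>leb)"
    proof (rule integral_mono[OF i])
      fix t assume "t \<in> space leb"
      hence t: "t \<in> {a..b}" by simp
      have g: "norm (snd (f t)) \<le> radius" using s t by (simp add: S_def)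
      have "norm (z' t - z t) \<le> \<kappa>" using s t by (simp add: S_def)
      hence "norm (z' t) \<le> Z + \<kappa>" using Z(2)[OF t] norm_triangle_sub[of "z' t" "z t"] by linarith
      from c12(3)[OF t this g] power_mono[OF g norm_ge_zero, of 2]
      show "(norm (f t))\<^sup>2 \<le> c1 * (\<beta> t * (norm (?D t))\<^sup>2) + (c2 + radius\<^sup>2)" unfolding np by (metis add.assoc add_mono)
    qed (use iD in auto)
    also have "\<dots> = c1 * energy (\<lambda>t. fst (f t)) z' (\<lambda>t. snd (f t)) + (c2 + radius\<^sup>2) * (b - a)"
      unfolding energy_def using iD ab by (simp add: measure_restrict_space)
    also have "\<dots> \<le> c1 * m + (c2 + radius\<^sup>2) * (b - a)"
      using s c12(1) by (intro add_right_mono mult_left_mono) (auto simp: S_def)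
    finally show "(\<integral>t. (norm (f t))\<^sup>2 \<partial>leb) \<le> c1 * m + (c2 + radius\<^sup>2) * (b - a)" .
  qed blast
  then obtain f u where f: "\<And>k. f k \<in> H k" and um: "u \<in> borel_measurable leb" and u2: "integrable leb (\<lambda>x. (norm (u x))\<^sup>2)"
    and AEu: "AE x in leb. (\<lambda>k. f k x) \<longlonglongrightarrow> u x" and L1: "(\<lambda>k. \<integral>x. norm (f k x - u x) \<partial>leb) \<longlonglongrightarrow> 0" by blast
  have "\<forall>k. \<exists>z'. S k (f k) z'" using f by (simp add: H_def)
  then obtain zk where zk: "\<And>k. S k (f k) (zk k)" by metis
  define v where "v t = fst (u t)" for t
  \<comment> \<open>The bound on the gradients passes to the limit only almost everywhere; the truncation restores it everywhere.\<close>
  define g where "g t = (if norm (snd (u t)) \<le> radius then snd (u t) else 0)" for t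
  have "(fst :: 'e \<times> 'e \<Rightarrow> 'e) \<in> borel_measurable borel" "(snd :: 'e \<times> 'e \<Rightarrow> 'e) \<in> borel_measurable borel"
    by (rule borel_measurable_continuous_onI, rule continuous_on_fst[OF continuous_on_id])
       (rule borel_measurable_continuous_onI, rule continuous_on_snd[OF continuous_on_id])
  from measurable_compose[OF um this(1)] measurable_compose[OF um this(2)]
  have [measurable]: "(\<lambda>t. fst (u t)) \<in> borel_measurable leb" "(\<lambda>t. snd (u t)) \<in> borel_measurable leb" by simp_all
  have gm: "g \<in> borel_measurable leb" unfolding g_def by measurable
  have gR: "norm (g t) \<le> radius" for t using radius_nonneg by (simp add: g_def)
  have vs: "square_integrable_on a b v"
  proof -
    have "square_integrable_on a b u" using um u2 by (simp add: square_integrable_on_def)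
    thus ?thesis unfolding v_def
      by (rule square_integrable_on_bound) (simp, metis norm_fst_le prod.collapse)
  qed
  have Suc0: "(\<lambda>k. x / real (Suc k)) \<longlonglongrightarrow> 0" for x
    using tendsto_mult[OF tendsto_const[of x] LIMSEQ_Suc[OF lim_1_over_n]] by simp
  have zlim: "(\<lambda>k. zk k t) \<longlonglongrightarrow> z t" if t: "t \<in> {a..b}" for t
  proof -
    have "(\<lambda>k. zk k t - z t) \<longlonglongrightarrow> 0"
      by (rule Lim_null_comparison[OF _ Suc0[of \<kappa>]]) (use zk t in \<open>auto simp: S_def\<close>)
    thus ?thesis by (simp add: LIM_zero_iff)
  qed
  have w: "is_weak_derivative a b z v"
  proof (rule weak_derivative_limit)
    show "a \<le> b" using ab by simp
    show "is_weak_derivative a b (zk k) (\<lambda>t. fst (f k t))" "continuous_on {a..b} (zk k)" for k using zk by (auto simp: S_def)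
    show "square_integrable_on a b v" by (rule vs)
    show "uniform_limit {a..b} zk z sequentially"
    proof (rule uniform_limitI)
      fix e :: real assume "e > 0"
      from order_tendstoD(2)[OF Suc0 this, of \<kappa>] show "\<forall>\<^sub>F n in sequentially. \<forall>x\<in>{a..b}. dist (zk n x) (z x) < e"
      proof eventually_elim
        case (elim n)
        show ?case
        proof
          fix x assume "x \<in> {a..b}"
          hence "norm (zk n x - z x) \<le> \<kappa> / real (Suc n)" using zk[of n] by (simp add: S_def)
          thus "dist (zk n x) (z x) < e" using elim by (simp only: dist_norm)
        qed
      qed
    qed
    show "(\<lambda>k. \<integral>t. norm (fst (f k t) - v t) \<partial>leb) \<longlonglongrightarrow> 0"
    proof (rule Lim_null_comparison[OF always_eventually L1], rule allI)
      fix k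
      have iv: "integrable leb v" by (rule square_integrable_onD[OF vs])
      have iff: "integrable leb (\<lambda>t. fst (f k t))" by (rule square_integrable_onD[OF sqF[OF zk]])
      have iss: "integrable leb (\<lambda>t. snd (f k t))" by (rule square_integrable_onD[OF sqS[OF zk]])
      have "integrable leb u" using integrable_of_norm_sq[OF um u2] .
      moreover have "integrable leb (f k)"
      proof -
        have "(\<lambda>t. (fst (f k t), snd (f k t))) \<in> borel_measurable leb"
          by (rule borel_measurable_Pair) (use iff iss in auto)
        hence m: "f k \<in> borel_measurable leb" by simp
        have le: "norm (f k t) \<le> norm (norm (fst (f k t)) + norm (snd (f k t)))" for t
          using norm_Pair_le[of "fst (f k t)" "snd (f k t)"] by simp
        have "integrable leb (\<lambda>t. norm (fst (f k t)) + norm (snd (f k t)))"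
          by (intro Bochner_Integration.integrable_add integrable_norm iff iss)
        thus ?thesis by (rule Bochner_Integration.integrable_bound[OF _ m AE_I2[OF le]])
      qed
      ultimately have i: "integrable leb (\<lambda>x. norm (f k x - u x))" by simp
      have "(\<integral>t. norm (fst (f k t) - v t) \<partial>leb) \<le> (\<integral>x. norm (f k x - u x) \<partial>leb)"
      proof (rule integral_mono[OF _ i])
        show "integrable leb (\<lambda>t. norm (fst (f k t) - v t))" using iv iff by simp
        show "norm (fst (f k t) - v t) \<le> norm (f k t - u t)" for t
          unfolding v_def by (metis fst_diff norm_fst_le prod.collapse)
      qed
      moreover have "0 \<le> (\<integral>t. norm (fst (f k t) - v t) \<partial>leb)" by simp
      ultimately show "norm (\<integral>t. norm (fst (f k t) - v t) \<partial>leb) \<le> (\<integral>x. norm (f k x - u x) \<partial>leb)" by simp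
    qed
  qed
  have AEg: "AE t in leb. snd (u t) = g t" using AEu AE_space[of leb]
  proof eventually_elim
    case (elim t)
    have "(\<lambda>k. norm (snd (f k t))) \<longlonglongrightarrow> norm (snd (u t))" by (intro tendsto_norm tendsto_snd elim)
    hence "norm (snd (u t)) \<le> radius"
      by (rule LIMSEQ_le_const2) (use zk elim(2) in \<open>auto simp: S_def\<close>)
    thus ?case by (simp add: g_def)
  qed
  have sub: "AE t in leb. g t \<in> subdifferential hard_max (z t)" using AEu AEg AE_space[of leb]
  proof eventually_elim
    case (elim t)
    show ?case unfolding subdifferential_def
    proof (rule CollectI, rule allI)
      fix Y
      have "(\<lambda>k. hard_max (z t) + snd (f k t) \<bullet> (Y - z t) - e0 / real (Suc k)) \<longlonglongrightarrow> hard_max (z t) + snd (u t) \<bullet> (Y - z t) - 0"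
        by (intro tendsto_intros tendsto_snd elim Suc0)
      hence "hard_max (z t) + snd (u t) \<bullet> (Y - z t) - 0 \<le> hard_max Y"
      proof (rule LIMSEQ_le_const2)
        have "hard_max (z t) + snd (f k t) \<bullet> (Y - z t) - e0 / real (Suc k) \<le> hard_max Y" for k
          using zk[of k] elim(3) unfolding S_def by simp
        thus "\<exists>N. \<forall>n\<ge>N. hard_max (z t) + snd (f n t) \<bullet> (Y - z t) - e0 / real (Suc n) \<le> hard_max Y" by blast
      qed
      thus "hard_max (z t) + g t \<bullet> (Y - z t) \<le> hard_max Y" using elim(2) by simp
    qed
  qed
  have gs: "square_integrable_on a b g" by (rule square_integrable_on_bounded[OF gm gR])
  have m0: "0 \<le> m"
  proof -
    have "energy (\<lambda>t. fst (f 0 t)) (zk 0) (\<lambda>t. snd (f 0 t)) \<le> m" using zk[of 0] by (simp add: S_def)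
    thus ?thesis using energy_nonneg order_trans by blast
  qed
  have "ennreal (energy v z g) \<le> ennreal m"
  proof -
    let ?Dk = "\<lambda>k t. drift_defect t (fst (f k t)) (zk k t) (snd (f k t))"
    have sD: "square_integrable_on a b (?Dk k)" for k
      by (rule square_integrable_drift_defect[OF sqF[OF zk] zcS[OF zk] sqS[OF zk]])
    note [measurable] = square_integrable_onD(1)[OF sD] borel_measurable_lebesgue_on_continuous[OF \<beta>_cont]
    have "ennreal (energy v z g) = (\<integral>\<^sup>+ t. ennreal ((norm (drift_defect t (v t) (z t) (g t)))\<^sup>2 * \<beta> t) \<partial>leb)"
      by (rule nn_integral_eq_energy[OF vs zc gs, symmetric])
    also have "\<dots> = (\<integral>\<^sup>+ t. liminf (\<lambda>k. ennreal ((norm (?Dk k t))\<^sup>2 * \<beta> t)) \<partial>leb)"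
    proof (rule nn_integral_cong_AE, use AEu AEg AE_space[of leb] in eventually_elim)
      case (elim t)
      have "(\<lambda>k. ennreal ((norm (?Dk k t))\<^sup>2 * \<beta> t)) \<longlonglongrightarrow> ennreal ((norm (drift_defect t (fst (u t)) (z t) (snd (u t))))\<^sup>2 * \<beta> t)"
        unfolding drift_defect_def
        by (intro tendsto_ennrealI tendsto_intros tendsto_fst tendsto_snd elim zlim) (use elim in auto)
      from lim_imp_Liminf[OF _ this] show ?case using elim(2) by (simp add: v_def)
    qed
    also have "\<dots> \<le> liminf (\<lambda>k. \<integral>\<^sup>+ t. ennreal ((norm (?Dk k t))\<^sup>2 * \<beta> t) \<partial>leb)"
      by (rule nn_integral_liminf) measurable
    also have "\<dots> = liminf (\<lambda>k. ennreal (energy (\<lambda>t. fst (f k t)) (zk k) (\<lambda>t. snd (f k t))))"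
      unfolding nn_integral_eq_energy[OF sqF[OF zk] zcS[OF zk] sqS[OF zk]] ..
    also have "\<dots> \<le> liminf (\<lambda>k::nat. ennreal m)"
      by (rule Liminf_mono) (use zk in \<open>auto simp: S_def intro!: always_eventually ennreal_leI\<close>)
    also have "\<dots> = ennreal m" by (simp add: Liminf_const)
    finally show ?thesis .
  qed
  hence "energy v z g \<le> m" using m0 by (simp add: ennreal_le_iff)
  moreover have "energy v z (\<lambda>t. ext_gradient hard_max (z t)) \<le> energy v z g"
    by (rule energy_ext_gradient_le[OF w zc gm gR sub])
  ultimately show ?thesis using w by (intro exI[of _ v]) auto
qed

end

section \<open>The recovery family\<close>

context soft_max_action begin

text \<open>The resolvent parameter \<open>\<surd>\<epsilon> \<eta>\<close> vanishes at both ends and tends to 0, but slowly compared with \<open>\<epsilon>\<close>. In the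
  expansion of the energy every term is bounded by one that converges; \<open>U\<close> is the sum of these bounds.\<close>

lemma energy_limsup:
  fixes z v :: "real \<Rightarrow> 'e"
  assumes w: "is_weak_derivative a b z v" and zc: "continuous_on {a..b} z"
  obtains z\<epsilon> v\<epsilon> \<kappa> U where
    "\<And>\<epsilon>. \<epsilon> > 0 \<Longrightarrow> is_weak_derivative a b (z\<epsilon> \<epsilon>) (v\<epsilon> \<epsilon>)" "\<And>\<epsilon>. \<epsilon> > 0 \<Longrightarrow> continuous_on {a..b} (z\<epsilon> \<epsilon>)"
    "\<And>\<epsilon>. z\<epsilon> \<epsilon> a = z a" "\<And>\<epsilon>. z\<epsilon> \<epsilon> b = z b"
    "\<And>\<epsilon> t. \<epsilon> > 0 \<Longrightarrow> t \<in> {a..b} \<Longrightarrow> norm (z\<epsilon> \<epsilon> t - z t) \<le> sqrt \<epsilon> * \<kappa>"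
    "\<And>\<epsilon>. \<epsilon> > 0 \<Longrightarrow> energy (v\<epsilon> \<epsilon>) (z\<epsilon> \<epsilon>) (\<lambda>t. soft_grad \<epsilon> (z\<epsilon> \<epsilon> t)) \<le> U \<epsilon>"
    "(U \<longlongrightarrow> energy v z (\<lambda>t. ext_gradient hard_max (z t))) (at_right (0::real))"
proof -
  define \<eta> where "\<eta> t = (t - a) * (b - t)" for t
  have \<eta>0: "0 \<le> \<eta> t" if "t \<in> {a..b}" for t using that by (simp add: \<eta>_def)
  have \<eta>_pos: "0 < \<eta> t" if "a < t" "t < b" for t using that by (simp add: \<eta>_def)
  have \<eta>_le: "\<eta> t \<le> (b - a) * (b - a)" if "t \<in> {a..b}" for t
    unfolding \<eta>_def using that by (intro mult_mono) auto
  have \<eta>_lip: "\<bar>\<eta> t - \<eta> s\<bar> \<le> (b - a) * (t - s)" if "a \<le> s" "s \<le> t" "t \<le> b" for s t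
  proof -
    have "\<eta> t - \<eta> s = (a + b - t - s) * (t - s)" by (simp add: \<eta>_def algebra_simps)
    moreover have "\<bar>a + b - t - s\<bar> \<le> b - a" using that by linarith
    ultimately show ?thesis using that by (simp add: abs_mult mult_right_mono)
  qed
  define z\<epsilon> where "z\<epsilon> \<epsilon> t = resolvent \<epsilon> (sqrt \<epsilon> * \<eta> t) (z t)" for \<epsilon> t
  define \<kappa> where "\<kappa> = (b - a) * (b - a) * radius"
  \<comment> \<open>The speed of the resolvent due to the variation of its parameter.\<close>
  define k where "k \<epsilon> = sqrt \<epsilon> * ((b - a) * radius)" for \<epsilon>
  have k0: "0 \<le> k \<epsilon>" if "\<epsilon> > 0" for \<epsilon> using that ab radius_nonneg by (simp add: k_def)
  have vs: "square_integrable_on a b v" by (rule weak_derivativeD(1)[OF w])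
  have vi: "integrable leb v" by (rule square_integrable_onD(3)[OF vs])
  have vm[measurable]: "v \<in> borel_measurable leb" by (rule square_integrable_onD(1)[OF vs])
  have p: "is_primitive a b z v" by (rule weak_derivative_is_primitive[OF ab w zc])
  have ends: "z\<epsilon> \<epsilon> a = z a" "z\<epsilon> \<epsilon> b = z b" for \<epsilon> by (simp_all add: z\<epsilon>_def \<eta>_def resolvent_zero)
  have close: "norm (z\<epsilon> \<epsilon> t - z t) \<le> sqrt \<epsilon> * \<kappa>" if \<epsilon>: "\<epsilon> > 0" and t: "t \<in> {a..b}" for \<epsilon> t
  proof -
    have "norm (resolvent \<epsilon> (sqrt \<epsilon> * \<eta> t) (z t) - resolvent \<epsilon> 0 (z t)) \<le> norm (z t - z t) + \<bar>sqrt \<epsilon> * \<eta> t - 0\<bar> * radius"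
      by (rule resolvent_lipschitz) (use \<epsilon> \<eta>0[OF t] in auto)
    also have "\<dots> = sqrt \<epsilon> * \<eta> t * radius" using \<epsilon> \<eta>0[OF t] by simp
    also have "\<dots> \<le> sqrt \<epsilon> * ((b - a) * (b - a)) * radius"
      by (intro mult_right_mono mult_left_mono \<eta>_le[OF t] radius_nonneg) (use \<epsilon> in simp)
    finally show ?thesis by (simp add: z\<epsilon>_def resolvent_zero \<kappa>_def mult.assoc)
  qed
  have inc: "norm (z\<epsilon> \<epsilon> t - z\<epsilon> \<epsilon> s) \<le> integral {s..t} (\<lambda>x. norm (v x) + k \<epsilon>)"
    if \<epsilon>: "\<epsilon> > 0" and st: "a \<le> s" "s \<le> t" "t \<le> b" for \<epsilon> s t
  proof -
    have "norm (z\<epsilon> \<epsilon> t - z\<epsilon> \<epsilon> s) \<le> norm (z t - z s) + \<bar>sqrt \<epsilon> * \<eta> t - sqrt \<epsilon> * \<eta> s\<bar> * radius"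
      unfolding z\<epsilon>_def by (rule resolvent_lipschitz) (use \<epsilon> \<eta>0 st in auto)
    also have "\<bar>sqrt \<epsilon> * \<eta> t - sqrt \<epsilon> * \<eta> s\<bar> = sqrt \<epsilon> * \<bar>\<eta> t - \<eta> s\<bar>"
      using \<epsilon> by (simp add: right_diff_distrib[symmetric] abs_mult)
    also have "sqrt \<epsilon> * \<bar>\<eta> t - \<eta> s\<bar> * radius \<le> sqrt \<epsilon> * ((b - a) * (t - s)) * radius"
      using \<epsilon> \<eta>_lip[OF st] radius_nonneg by (intro mult_right_mono mult_left_mono) auto
    also have "\<dots> = k \<epsilon> * (t - s)" by (simp add: k_def)
    also have "norm (z t - z s) \<le> integral {s..t} (\<lambda>x. norm (v x))" by (rule is_primitive_norm_le[OF p st])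
    also have "integral {s..t} (\<lambda>x. norm (v x)) + k \<epsilon> * (t - s) = integral {s..t} (\<lambda>x. norm (v x) + k \<epsilon>)"
    proof (rule integral_unique[symmetric])
      have "((\<lambda>x. norm (v x) + k \<epsilon>) has_integral integral {s..t} (\<lambda>x. norm (v x)) + measure lborel {s..t} *\<^sub>R k \<epsilon>) {s..t}"
        by (intro has_integral_add integrable_integral has_integral_const_real
             integrable_on_subinterval_lebesgue[OF integrable_norm[OF vi]] st)
      thus "((\<lambda>x. norm (v x) + k \<epsilon>) has_integral integral {s..t} (\<lambda>x. norm (v x)) + k \<epsilon> * (t - s)) {s..t}"
        using st by (simp add: mult.commute)
    qed
    finally show ?thesis by simp
  qed
  have ms: "square_integrable_on a b (\<lambda>x. norm (v x) + k \<epsilon>)" for \<epsilon>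
  proof (rule square_integrable_on_add)
    show "square_integrable_on a b (\<lambda>x. norm (v x))" by (rule square_integrable_on_bound[OF vs]) auto
    show "square_integrable_on a b (\<lambda>x. k \<epsilon>)" by (rule square_integrable_on_continuous) (rule continuous_on_const)
  qed
  define P where "P \<epsilon> v' \<longleftrightarrow> is_weak_derivative a b (z\<epsilon> \<epsilon>) v' \<and> (AE t in leb. norm (v' t) \<le> norm (v t) + k \<epsilon>)" for \<epsilon> v'
  have ex: "continuous_on {a..b} (z\<epsilon> \<epsilon>) \<and> (\<exists>v'. P \<epsilon> v')" if "\<epsilon> > 0" for \<epsilon>
    by (rule weak_derivative_of_dominated_increments[OF ab ms inc[OF that]]) (auto simp: P_def)
  define v\<epsilon> where "v\<epsilon> \<epsilon> = (SOME v'. P \<epsilon> v')" for \<epsilon>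
  have Pv: "P \<epsilon> (v\<epsilon> \<epsilon>)" if \<epsilon>: "\<epsilon> > 0" for \<epsilon>
  proof -
    obtain v' where "P \<epsilon> v'" using ex[OF \<epsilon>] by blast
    thus ?thesis unfolding v\<epsilon>_def by (rule someI[of "P \<epsilon>"])
  qed
  have w\<epsilon>: "is_weak_derivative a b (z\<epsilon> \<epsilon>) (v\<epsilon> \<epsilon>)" and v\<epsilon>: "AE t in leb. norm (v\<epsilon> \<epsilon> t) \<le> norm (v t) + k \<epsilon>"
    if "\<epsilon> > 0" for \<epsilon> using Pv[OF that] by (simp_all add: P_def)
  have z\<epsilon>c: "continuous_on {a..b} (z\<epsilon> \<epsilon>)" if "\<epsilon> > 0" for \<epsilon> using ex[OF that] by simp
  let ?p = "\<lambda>t. ext_gradient hard_max (z t)"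
  note pm[measurable] = ext_gradient_curve_measurable[OF zc]
  have c4: "continuous_on {a..b} (\<lambda>t. \<beta> t / (4 * t\<^sup>2))" and c2: "continuous_on {a..b} (\<lambda>t. \<beta> t / (2 * t))"
    using a_pos by (intro continuous_intros \<beta>_cont; auto)+
  have c1: "continuous_on {a..b} (\<lambda>t. \<beta> t * t\<^sup>2)" by (intro continuous_intros \<beta>_cont)
  have nn: "0 \<le> \<beta> t * t\<^sup>2" "0 \<le> \<beta> t / (4 * t\<^sup>2)" "0 \<le> \<beta> t / (2 * t)" if "t \<in> {a..b}" for t
    using \<beta>_pos[OF that] t_pos[OF that] by simp_all
  note [measurable] = borel_measurable_lebesgue_on_continuous[OF c4] borel_measurable_lebesgue_on_continuous[OF c2]
    borel_measurable_lebesgue_on_continuous[OF c1]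
  \<comment> \<open>The bound in terms of \<open>p\<close> blows up at the ends, where \<open>\<eta>\<close> vanishes; there the uniform bound on the gradient takes over.\<close>
  define N where "N \<epsilon> t = (\<beta> t / (4 * t\<^sup>2)) * min (radius\<^sup>2) ((norm (?p t))\<^sup>2 + sqrt \<epsilon> * (2 * entropy_bound / \<eta> t))" for \<epsilon> t
  have \<eta>m[measurable]: "\<eta> \<in> borel_measurable leb" unfolding \<eta>_def[abs_def]
    by (intro borel_measurable_lebesgue_on_continuous continuous_intros)
  have Nm[measurable]: "N \<epsilon> \<in> borel_measurable leb" for \<epsilon> unfolding N_def[abs_def] by measurable
  obtain C4 where C4: "C4 \<ge> 0" "\<And>t. t \<in> {a..b} \<Longrightarrow> norm (\<beta> t / (4 * t\<^sup>2)) \<le> C4" using continuous_on_Icc_bounded[OF c4] by auto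
  have Nbd: "\<bar>N \<epsilon> t\<bar> \<le> C4 * radius\<^sup>2" if "\<epsilon> > 0" "t \<in> {a..b}" for \<epsilon> t
  proof -
    have "0 \<le> sqrt \<epsilon> * (2 * entropy_bound / \<eta> t)" using that \<eta>0[of t] entropy_bound_nonneg by simp
    hence "\<bar>min (radius\<^sup>2) ((norm (?p t))\<^sup>2 + sqrt \<epsilon> * (2 * entropy_bound / \<eta> t))\<bar> \<le> radius\<^sup>2"
      by (simp add: min_def)
    thus ?thesis unfolding N_def abs_mult using C4 that by (intro mult_mono) auto
  qed
  have Ni: "integrable leb (N \<epsilon>)" if "\<epsilon> > 0" for \<epsilon>
    by (rule integrable_bounded_on[OF Nm Nbd[OF that]])
  define T where "T = (\<integral>t. (\<beta> t * t\<^sup>2) * (norm (v t))\<^sup>2 \<partial>leb)"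
  define T1 where "T1 = (\<integral>t. (\<beta> t * t\<^sup>2) * norm (v t) \<partial>leb)"
  define T2 where "T2 = (\<integral>t. \<beta> t * t\<^sup>2 \<partial>leb)"
  define B2 where "B2 = (\<integral>t. \<beta> t / (2 * t) \<partial>leb)"
  have Ti: "integrable leb (\<lambda>t. (\<beta> t * t\<^sup>2) * (norm (v t))\<^sup>2)" by (rule integrable_weighted_sq[OF vs c1])
  have T2i: "integrable leb (\<lambda>t. \<beta> t * t\<^sup>2)" by (rule continuous_imp_integrable_real[OF c1])
  have T1i: "integrable leb (\<lambda>t. (\<beta> t * t\<^sup>2) * norm (v t))"
  proof -
    have "square_integrable_on a b (\<lambda>t. (\<beta> t * t\<^sup>2) *\<^sub>R v t)" by (rule square_integrable_on_scaleR[OF vs c1])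
    hence i: "integrable leb (\<lambda>t. norm ((\<beta> t * t\<^sup>2) *\<^sub>R v t))" by (intro integrable_norm square_integrable_onD(3))
    show ?thesis by (rule Bochner_Integration.integrable_bound[OF i]) (auto simp: abs_mult)
  qed
  have B2i: "integrable leb (\<lambda>t. \<beta> t / (2 * t))" by (rule continuous_imp_integrable_real[OF c2])
  define U where "U \<epsilon> = (T + 2 * k \<epsilon> * T1 + (k \<epsilon>)\<^sup>2 * T2) + (\<integral>t. N \<epsilon> t \<partial>leb)
    + ((\<integral>t. (\<beta> t / (2 * t)) * hard_max (z\<epsilon> \<epsilon> t) \<partial>leb) + (\<epsilon> * entropy_bound) * B2) + potential (soft_max \<epsilon>) (z\<epsilon> \<epsilon>)" for \<epsilon>
  have upper: "energy (v\<epsilon> \<epsilon>) (z\<epsilon> \<epsilon>) (\<lambda>t. soft_grad \<epsilon> (z\<epsilon> \<epsilon> t)) \<le> U \<epsilon>" if \<epsilon>: "\<epsilon> > 0" for \<epsilon>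
  proof -
    let ?q = "\<lambda>t. soft_grad \<epsilon> (z\<epsilon> \<epsilon> t)"
    have qm: "?q \<in> borel_measurable leb"
      by (rule borel_measurable_lebesgue_on_continuous, rule continuous_on_compose2[OF soft_grad_continuous[of UNIV] z\<epsilon>c[OF \<epsilon>]]) simp
    note E = energy_expand[OF w\<epsilon>[OF \<epsilon>] z\<epsilon>c[OF \<epsilon>] qm norm_soft_grad_le soft_max_continuous[OF \<epsilon>] AE_I2[OF soft_grad_subgradient[OF \<epsilon>]]]
    have "(\<integral>t. (\<beta> t * t\<^sup>2) * (norm (v\<epsilon> \<epsilon> t))\<^sup>2 \<partial>leb)
      \<le> (\<integral>t. (\<beta> t * t\<^sup>2) * (norm (v t))\<^sup>2 + 2 * k \<epsilon> * ((\<beta> t * t\<^sup>2) * norm (v t)) + (k \<epsilon>)\<^sup>2 * (\<beta> t * t\<^sup>2) \<partial>leb)"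
    proof (rule integral_mono_AE[OF E(1)])
      show "AE t in leb. (\<beta> t * t\<^sup>2) * (norm (v\<epsilon> \<epsilon> t))\<^sup>2
         \<le> (\<beta> t * t\<^sup>2) * (norm (v t))\<^sup>2 + 2 * k \<epsilon> * ((\<beta> t * t\<^sup>2) * norm (v t)) + (k \<epsilon>)\<^sup>2 * (\<beta> t * t\<^sup>2)"
        using v\<epsilon>[OF \<epsilon>] AE_space[of leb]
      proof eventually_elim
        case (elim t)
        have "(norm (v\<epsilon> \<epsilon> t))\<^sup>2 \<le> (norm (v t) + k \<epsilon>)\<^sup>2" using elim by (intro power_mono) auto
        hence "(\<beta> t * t\<^sup>2) * (norm (v\<epsilon> \<epsilon> t))\<^sup>2 \<le> (\<beta> t * t\<^sup>2) * (norm (v t) + k \<epsilon>)\<^sup>2"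
          using nn(1)[of t] elim by (intro mult_left_mono) auto
        also have "\<dots> = (\<beta> t * t\<^sup>2) * (norm (v t))\<^sup>2 + 2 * k \<epsilon> * ((\<beta> t * t\<^sup>2) * norm (v t)) + (k \<epsilon>)\<^sup>2 * (\<beta> t * t\<^sup>2)"
          unfolding power2_sum by (simp add: algebra_simps)
        finally show ?case .
      qed
    qed (intro Bochner_Integration.integrable_add integrable_mult_right Ti T1i T2i)
    also have "\<dots> = T + 2 * k \<epsilon> * T1 + (k \<epsilon>)\<^sup>2 * T2"
      unfolding T_def T1_def T2_def
      by (simp only: Bochner_Integration.integral_add Bochner_Integration.integrable_add integrable_mult_right integral_mult_right_zero Ti T1i T2i)
    finally have 1: "(\<integral>t. (\<beta> t * t\<^sup>2) * (norm (v\<epsilon> \<epsilon> t))\<^sup>2 \<partial>leb) \<le> T + 2 * k \<epsilon> * T1 + (k \<epsilon>)\<^sup>2 * T2" .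
    have 2: "(\<integral>t. (\<beta> t / (4 * t\<^sup>2)) * (norm (?q t))\<^sup>2 \<partial>leb) \<le> (\<integral>t. N \<epsilon> t \<partial>leb)"
    proof (rule integral_mono_AE[OF E(2) Ni[OF \<epsilon>]])
      have "{a, b} \<in> null_sets lebesgue" by simp
      hence "AE t in lebesgue. t \<notin> {a, b}" by (rule AE_not_in)
      hence "AE t in leb. t \<notin> {a, b}" by (subst AE_restrict_space_iff) auto
      thus "AE t in leb. (\<beta> t / (4 * t\<^sup>2)) * (norm (?q t))\<^sup>2 \<le> N \<epsilon> t" using AE_space[of leb]
      proof eventually_elim
        case (elim t)
        hence t: "t \<in> {a..b}" "0 < \<eta> t" using \<eta>_pos[of t] by auto
        have "(norm (?q t))\<^sup>2 \<le> (norm (?p t))\<^sup>2 + 2 * \<epsilon> * entropy_bound / (sqrt \<epsilon> * \<eta> t)"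
          unfolding z\<epsilon>_def
          by (rule soft_grad_resolvent_le[OF \<epsilon> _ ext_gradient_hard_max(1)]) (use \<epsilon> t in simp)
        also have "2 * \<epsilon> * entropy_bound / (sqrt \<epsilon> * \<eta> t) = (\<epsilon> / sqrt \<epsilon>) * (2 * entropy_bound / \<eta> t)" by simp
        also have "\<epsilon> / sqrt \<epsilon> = sqrt \<epsilon>" using \<epsilon> by (simp add: real_div_sqrt)
        finally have "(norm (?q t))\<^sup>2 \<le> (norm (?p t))\<^sup>2 + sqrt \<epsilon> * (2 * entropy_bound / \<eta> t)" .
        moreover have "(norm (?q t))\<^sup>2 \<le> radius\<^sup>2" using norm_soft_grad_le by (intro power_mono) auto
        ultimately show ?case unfolding N_def using nn(2)[OF t(1)] by (intro mult_left_mono) auto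
      qed
    qed
    have h2: "integrable leb (\<lambda>t. (\<beta> t / (2 * t)) * hard_max (z\<epsilon> \<epsilon> t))"
      by (rule continuous_imp_integrable_real, intro continuous_intros c2)
         (rule continuous_on_compose2[OF hard_max_continuous[of UNIV] z\<epsilon>c[OF \<epsilon>]], simp)
    have "(\<integral>t. (\<beta> t / (2 * t)) * (z\<epsilon> \<epsilon> t \<bullet> ?q t) \<partial>leb)
      \<le> (\<integral>t. (\<beta> t / (2 * t)) * hard_max (z\<epsilon> \<epsilon> t) + (\<epsilon> * entropy_bound) * (\<beta> t / (2 * t)) \<partial>leb)"
    proof (rule integral_mono[OF E(3)])
      fix t assume "t \<in> space leb"
      hence t: "t \<in> {a..b}" by simp
      have "z\<epsilon> \<epsilon> t \<bullet> ?q t \<le> hard_max (z\<epsilon> \<epsilon> t) + \<epsilon> * entropy_bound"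
        using soft_grad_inner_self[OF \<epsilon>, of "z\<epsilon> \<epsilon> t"] by linarith
      from mult_left_mono[OF this nn(3)[OF t]]
      show "(\<beta> t / (2 * t)) * (z\<epsilon> \<epsilon> t \<bullet> ?q t) \<le> (\<beta> t / (2 * t)) * hard_max (z\<epsilon> \<epsilon> t) + (\<epsilon> * entropy_bound) * (\<beta> t / (2 * t))"
        by (simp only: distrib_left mult.commute)
    qed (intro Bochner_Integration.integrable_add integrable_mult_right h2 B2i)
    also have "\<dots> = (\<integral>t. (\<beta> t / (2 * t)) * hard_max (z\<epsilon> \<epsilon> t) \<partial>leb) + (\<epsilon> * entropy_bound) * B2"
      unfolding B2_def
      by (simp only: Bochner_Integration.integral_add integrable_mult_right integral_mult_right_zero h2 B2i)
    finally have 3: "(\<integral>t. (\<beta> t / (2 * t)) * (z\<epsilon> \<epsilon> t \<bullet> ?q t) \<partial>leb) \<le> \<dots>" .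
    show ?thesis unfolding E(4) U_def using 1 2 3 by linarith
  qed
  have limit: "(U \<longlongrightarrow> energy v z ?p) (at_right 0)"
    unfolding tendsto_at_iff_sequentially
  proof (intro allI impI)
    fix e :: "nat \<Rightarrow> real" assume e: "\<forall>i. e i \<in> {0<..} - {0}" and e0: "e \<longlonglongrightarrow> 0"
    have ep: "e n > 0" for n using e by auto
    have s0: "(\<lambda>n. sqrt (e n)) \<longlonglongrightarrow> 0" using tendsto_real_sqrt[OF e0] by simp
    obtain E where E: "\<And>n. e n \<le> E" "\<And>n. sqrt (e n) \<le> E"
    proof -
      from convergent_imp_Bseq[OF convergentI[OF e0]] obtain E1 where "\<And>n. norm (e n) \<le> E1" unfolding Bseq_def by blast
      moreover from convergent_imp_Bseq[OF convergentI[OF s0]] obtain E2 where "\<And>n. norm (sqrt (e n)) \<le> E2" unfolding Bseq_def by blast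
      ultimately have "e n \<le> max E1 E2" "sqrt (e n) \<le> max E1 E2" for n
        by (auto simp: le_max_iff_disj intro: order_trans[OF abs_ge_self])
      thus ?thesis by (rule that)
    qed
    obtain Z where Z: "Z \<ge> 0" "\<And>t. t \<in> {a..b} \<Longrightarrow> norm (z t) \<le> Z" using continuous_on_Icc_bounded[OF zc] by auto
    define Zb where "Zb = Z + E * \<kappa>"
    have \<kappa>0: "0 \<le> \<kappa>" using ab radius_nonneg by (simp add: \<kappa>_def)
    have zb: "norm (z\<epsilon> (e n) t) \<le> Zb" if t: "t \<in> {a..b}" for n t
      using close[OF ep t, of n] Z(2)[OF t] norm_triangle_sub[of "z\<epsilon> (e n) t" "z t"] mult_right_mono[OF E(2) \<kappa>0, of n]
      unfolding Zb_def by linarith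
    have zl: "(\<lambda>n. z\<epsilon> (e n) t) \<longlonglongrightarrow> z t" if t: "t \<in> {a..b}" for t
    proof -
      have "(\<lambda>n. sqrt (e n) * \<kappa>) \<longlonglongrightarrow> 0" using tendsto_mult[OF s0 tendsto_const[of \<kappa>]] by simp
      hence "(\<lambda>n. z\<epsilon> (e n) t - z t) \<longlonglongrightarrow> 0"
        by (rule Lim_null_comparison[rotated]) (use close[OF ep t] in auto)
      thus ?thesis by (simp add: LIM_zero_iff)
    qed
    have hl: "(\<lambda>n. hard_max (z\<epsilon> (e n) t)) \<longlonglongrightarrow> hard_max (z t)" if t: "t \<in> {a..b}" for t
      using continuous_on_tendsto_compose[OF hard_max_continuous[of UNIV] zl[OF t]] by simp
    have sl: "(\<lambda>n. soft_max (e n) (z\<epsilon> (e n) t)) \<longlonglongrightarrow> hard_max (z t)" if t: "t \<in> {a..b}" for t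
    proof -
      have "(\<lambda>n. e n * entropy_bound) \<longlonglongrightarrow> 0" using tendsto_mult[OF e0 tendsto_const[of entropy_bound]] by simp
      hence "(\<lambda>n. soft_max (e n) (z\<epsilon> (e n) t) - hard_max (z\<epsilon> (e n) t)) \<longlonglongrightarrow> 0"
        by (rule Lim_null_comparison[rotated]) (use soft_max_dist[OF ep] in auto)
      from tendsto_add[OF this hl[OF t]] show ?thesis by simp
    qed
    have hb: "\<bar>hard_max (z\<epsilon> (e n) t)\<bar> \<le> radius * Zb" if t: "t \<in> {a..b}" for n t
      using hard_max_abs_le[of "z\<epsilon> (e n) t"] mult_left_mono[OF zb[OF t] radius_nonneg, of n] by linarith
    have sb: "\<bar>soft_max (e n) (z\<epsilon> (e n) t)\<bar> \<le> radius * Zb + E * entropy_bound" if t: "t \<in> {a..b}" for n t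
      using hb[OF t, of n] soft_max_dist[OF ep, of n "z\<epsilon> (e n) t"] mult_right_mono[OF E(1) entropy_bound_nonneg, of n] by linarith
    have nb: "\<bar>(norm (z\<epsilon> (e n) t))\<^sup>2\<bar> \<le> Zb\<^sup>2" if t: "t \<in> {a..b}" for n t
      using power_mono[OF zb[OF t] norm_ge_zero, of n 2] by simp
    have nb2: "\<bar>(norm (z\<epsilon> (e n) t))\<^sup>2 / 2\<bar> \<le> Zb\<^sup>2" if t: "t \<in> {a..b}" for n t
      using nb[OF t, of n] zero_le_power2[of Zb] unfolding abs_divide by linarith
    have nc: "continuous_on {a..b} (\<lambda>t. (norm (y t))\<^sup>2)" if "continuous_on {a..b} y" for y :: "real \<Rightarrow> 'e"
      using that by (intro continuous_intros)
    have nc2: "continuous_on {a..b} (\<lambda>t. (norm (y t))\<^sup>2 / 2)" if "continuous_on {a..b} y" for y :: "real \<Rightarrow> 'e"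
      using that by (intro continuous_intros) auto
    have nl: "(\<lambda>n. (norm (z\<epsilon> (e n) t))\<^sup>2) \<longlonglongrightarrow> (norm (z t))\<^sup>2" if "t \<in> {a..b}" for t
      by (intro tendsto_power tendsto_norm zl that)
    have nl2: "(\<lambda>n. (norm (z\<epsilon> (e n) t))\<^sup>2 / 2) \<longlonglongrightarrow> (norm (z t))\<^sup>2 / 2" if "t \<in> {a..b}" for t
      using tendsto_mult[OF tendsto_const[of "1/2"] nl[OF that]] by simp
    have hc: "continuous_on {a..b} (\<lambda>t. hard_max (y t))" if "continuous_on {a..b} y" for y
      using continuous_on_compose2[OF hard_max_continuous[of UNIV] that] by simp
    have sc: "continuous_on {a..b} (\<lambda>t. soft_max (e n) (y t))" if "continuous_on {a..b} y" for y n
      using continuous_on_compose2[OF soft_max_continuous[OF ep, of UNIV] that] by simp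
    have L2: "(\<lambda>n. \<integral>t. (\<beta> t / (2 * t)) * hard_max (z\<epsilon> (e n) t) \<partial>leb) \<longlonglongrightarrow> (\<integral>t. (\<beta> t / (2 * t)) * hard_max (z t) \<partial>leb)"
      by (rule weighted_limit[OF c2 hc[OF z\<epsilon>c[OF ep]] hb hl hc[OF zc]])
    have \<beta>4: "continuous_on {a..b} (\<lambda>t. \<beta> t / 4)" by (intro continuous_intros \<beta>_cont) auto
    have Q1: "(\<lambda>n. \<integral>t. (\<beta> t / 4) * (norm (z\<epsilon> (e n) t))\<^sup>2 \<partial>leb) \<longlonglongrightarrow> (\<integral>t. (\<beta> t / 4) * (norm (z t))\<^sup>2 \<partial>leb)"
      by (rule weighted_limit[OF \<beta>4 nc[OF z\<epsilon>c[OF ep]] nb nl nc[OF zc]])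
    have \<beta>t: "continuous_on {a..b} (\<lambda>t. \<beta>' t * t + \<beta> t)" by (intro continuous_intros \<beta>_cont \<beta>'_cont)
    have Q2: "(\<lambda>n. \<integral>t. (\<beta>' t * t + \<beta> t) * ((norm (z\<epsilon> (e n) t))\<^sup>2 / 2) \<partial>leb) \<longlonglongrightarrow> (\<integral>t. (\<beta>' t * t + \<beta> t) * ((norm (z t))\<^sup>2 / 2) \<partial>leb)"
      by (rule weighted_limit[OF \<beta>t nc2[OF z\<epsilon>c[OF ep]] nb2 nl2 nc2[OF zc]])
    have Q3: "(\<lambda>n. \<integral>t. \<beta>' t * soft_max (e n) (z\<epsilon> (e n) t) \<partial>leb) \<longlonglongrightarrow> (\<integral>t. \<beta>' t * hard_max (z t) \<partial>leb)"
      by (rule weighted_limit[OF \<beta>'_cont sc[OF z\<epsilon>c[OF ep]] sb sl hc[OF zc]])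
    have Pl: "(\<lambda>n. potential (soft_max (e n)) (z\<epsilon> (e n))) \<longlonglongrightarrow> potential hard_max z"
    proof -
      have q: "(\<lambda>n. \<integral>t. \<beta> t * (norm (z\<epsilon> (e n) t))\<^sup>2 / 4 \<partial>leb) \<longlonglongrightarrow> (\<integral>t. \<beta> t * (norm (z t))\<^sup>2 / 4 \<partial>leb)" using Q1 by simp
      have "a \<in> {a..b}" "b \<in> {a..b}" using ab by auto
      note s = sl[OF this(1)] sl[OF this(2)]
      show ?thesis unfolding potential_def
        by (intro tendsto_add[OF q] tendsto_add tendsto_diff Q2 Q3 tendsto_mult tendsto_const s[unfolded ends] s)
           (simp_all add: ends)
    qed
    have Nl: "(\<lambda>n. \<integral>t. N (e n) t \<partial>leb) \<longlonglongrightarrow> (\<integral>t. (\<beta> t / (4 * t\<^sup>2)) * (norm (?p t))\<^sup>2 \<partial>leb)"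
    proof (rule bounded_convergence[OF Nm Nbd[OF ep]])
      show "(\<lambda>t. (\<beta> t / (4 * t\<^sup>2)) * (norm (?p t))\<^sup>2) \<in> borel_measurable leb" by measurable
      show "AE t in leb. (\<lambda>n. N (e n) t) \<longlonglongrightarrow> (\<beta> t / (4 * t\<^sup>2)) * (norm (?p t))\<^sup>2"
      proof (rule AE_I2)
        fix t
        have "(\<lambda>n. N (e n) t) \<longlonglongrightarrow> (\<beta> t / (4 * t\<^sup>2)) * min (radius\<^sup>2) ((norm (?p t))\<^sup>2 + 0 * (2 * entropy_bound / \<eta> t))"
          unfolding N_def by (intro tendsto_mult tendsto_const tendsto_min tendsto_add s0)
        moreover have "(norm (?p t))\<^sup>2 \<le> radius\<^sup>2" using ext_gradient_hard_max(3) by (intro power_mono) auto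
        then have "min (radius\<^sup>2) ((norm (?p t))\<^sup>2 + 0 * (2 * entropy_bound / \<eta> t)) = (norm (?p t))\<^sup>2" by (simp add: min_absorb2)
        ultimately show "(\<lambda>n. N (e n) t) \<longlonglongrightarrow> (\<beta> t / (4 * t\<^sup>2)) * (norm (?p t))\<^sup>2" by (simp only:)
      qed
    qed
    have kl: "(\<lambda>n. k (e n)) \<longlonglongrightarrow> 0"
      unfolding k_def using tendsto_mult[OF s0 tendsto_const[of "(b - a) * radius"]] by simp
    have "(\<lambda>n. U (e n)) \<longlonglongrightarrow> (T + 2 * 0 * T1 + 0\<^sup>2 * T2) + (\<integral>t. (\<beta> t / (4 * t\<^sup>2)) * (norm (?p t))\<^sup>2 \<partial>leb)
      + ((\<integral>t. (\<beta> t / (2 * t)) * hard_max (z t) \<partial>leb) + (0 * entropy_bound) * B2) + potential hard_max z"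
      unfolding U_def by (intro tendsto_add tendsto_mult tendsto_power tendsto_const kl Nl L2 Pl e0)
    also have "(T + 2 * 0 * T1 + 0\<^sup>2 * T2) + (\<integral>t. (\<beta> t / (4 * t\<^sup>2)) * (norm (?p t))\<^sup>2 \<partial>leb)
      + ((\<integral>t. (\<beta> t / (2 * t)) * hard_max (z t) \<partial>leb) + (0 * entropy_bound) * B2) + potential hard_max z = energy v z ?p"
    proof -
      have "z t \<bullet> ?p t = hard_max (z t)" for t
        using subgradient_inner_self[OF ext_gradient_hard_max(1)] by (simp add: inner_commute)
      thus ?thesis
        using energy_expand(4)[OF w zc pm ext_gradient_hard_max(3) hard_max_continuous AE_I2[OF ext_gradient_hard_max(1)]]
        unfolding T_def by simp
    qed
    finally show "(U \<circ> e) \<longlonglongrightarrow> energy v z ?p" by (simp add: o_def)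
  qed
  show ?thesis
    by (rule that[of z\<epsilon> v\<epsilon> \<kappa> U]) (fact w\<epsilon> z\<epsilon>c ends close upper limit)+
qed

end

section \<open>Gamma-convergence of the actions\<close>

lemma is_weak_derivative_cong:
  assumes "\<And>t. t \<in> {a..b} \<Longrightarrow> X t = Y t"
  shows "is_weak_derivative a b X V \<longleftrightarrow> is_weak_derivative a b Y V"
proof -
  have "(\<integral>t. deriv \<phi> t *\<^sub>R X t \<partial>lebesgue_on {a..b}) = (\<integral>t. deriv \<phi> t *\<^sub>R Y t \<partial>lebesgue_on {a..b})" for \<phi>
    by (rule Bochner_Integration.integral_cong) (use assms in auto)
  thus ?thesis by (simp add: is_weak_derivative_def)
qed

lemma weak_derivative_selected: "is_weak_derivative a b X V \<Longrightarrow> is_weak_derivative a b X (weak_derivative a b X)"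
  unfolding weak_derivative_def by (rule someI[of "is_weak_derivative a b X"])

lemma weak_derivative_rescaled:
  fixes X :: "real \<Rightarrow> 'e::euclidean_space"
  assumes "0 < a" "is_weak_derivative a b X V" "continuous_on {a..b} X"
  shows "is_weak_derivative a b (\<lambda>t. (1 / t) *\<^sub>R X t) (\<lambda>t. (- 1 / t\<^sup>2) *\<^sub>R X t + (1 / t) *\<^sub>R V t)"
proof (rule weak_derivative_scaleR[OF assms(2,3)])
  fix t assume "t \<in> {a..b}"
  hence "t \<noteq> 0" using assms(1) by auto
  thus "((\<lambda>t. 1 / t) has_real_derivative - 1 / t\<^sup>2) (at t)"
    by (auto intro!: derivative_eq_intros simp: power2_eq_square)
next
  show "continuous_on {a..b} (\<lambda>t. - 1 / t\<^sup>2)" using assms(1) by (intro continuous_intros) auto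
qed

context weighted_interval begin

text \<open>The weak derivative chosen in the action may be replaced by \<open>z + t v\<close>, from which it differs only on
  a null set.\<close>

lemma action_eq_energy:
  fixes P Q :: "(real ^ 'd::finite) ^ 'n::finite"
  assumes zc: "continuous_on {a..b} z" and w: "is_weak_derivative a b z v"
    and X: "\<And>t. t \<in> {a..b} \<Longrightarrow> X t = t *\<^sub>R z t"
    and G: "\<And>t. t \<in> {a..b} \<Longrightarrow> G t (X t) = g t" and g: "square_integrable_on a b g"
    and ends: "X a \<in> orbit_conf P" "X b \<in> orbit_conf Q"
  shows "action \<beta> a b P Q G X = ennreal (energy v z g)"
proof -
  define V where "V t = 1 *\<^sub>R z t + t *\<^sub>R v t" for t
  have "is_weak_derivative a b (\<lambda>t. t *\<^sub>R z t) V" unfolding V_def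
    by (rule weak_derivative_scaleR[OF w zc]) (auto intro!: derivative_eq_intros continuous_intros)
  hence V: "is_weak_derivative a b X V" using is_weak_derivative_cong[of a b X] X by simp
  have Xc: "continuous_on {a..b} X"
    by (rule continuous_on_eq[of _ "\<lambda>t. t *\<^sub>R z t"]) (use X zc in \<open>auto intro!: continuous_intros\<close>)
  have H1: "H1_on a b X" unfolding H1_on_def using square_integrable_on_continuous[OF Xc] V by blast
  have AE: "AE t in leb. weak_derivative a b X t = V t"
    by (rule weak_derivative_unique[OF ab weak_derivative_selected[OF V] V Xc])
  have "action \<beta> a b P Q G X = (\<integral>\<^sup>+ t. ennreal ((norm (weak_derivative a b X t - (1 / (2 * t)) *\<^sub>R (X t - G t (X t))))\<^sup>2 * \<beta> t) \<partial>leb)"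
    unfolding action_def using H1 ends by simp
  also have "\<dots> = (\<integral>\<^sup>+ t. ennreal ((norm (drift_defect t (v t) (z t) (g t)))\<^sup>2 * \<beta> t) \<partial>leb)"
  proof (rule nn_integral_cong_AE, use AE AE_space[of leb] in eventually_elim)
    case (elim t)
    hence t: "t \<in> {a..b}" "t \<noteq> 0" using t_pos[of t] by auto
    have XG: "X t - G t (X t) = t *\<^sub>R z t - g t" by (subst G[OF t(1)], subst X[OF t(1)], rule refl)
    have half: "(1 / (2 * t)) *\<^sub>R t *\<^sub>R z t = (1/2) *\<^sub>R z t" using t by simp
    have "(1/2) *\<^sub>R z t + (1/2) *\<^sub>R z t = z t" using scaleR_half_double[of "z t"] by (simp only: scaleR_add_right)
    hence "z t - (1/2) *\<^sub>R z t = (1/2) *\<^sub>R z t" by (simp add: diff_eq_eq)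
    hence "weak_derivative a b X t - (1 / (2 * t)) *\<^sub>R (X t - G t (X t)) = drift_defect t (v t) (z t) (g t)"
      unfolding elim(1) XG V_def drift_defect_def scaleR_diff_right half by (simp add: algebra_simps)
    thus ?case by simp
  qed
  also have "\<dots> = ennreal (energy v z g)"
    by (rule nn_integral_eq_energy[OF weak_derivativeD(1)[OF w] zc g])
  finally show ?thesis .
qed

end

lemma finite_perms: "finite (perms :: ('n::finite \<Rightarrow> 'n) set)"
  by (rule finite_permutations) simp

lemma card_perms: "card (perms :: ('n::finite \<Rightarrow> 'n) set) = fact CARD('n)"
  by (rule card_permutations) auto

lemma finite_orbit_conf: "finite (orbit_conf P)"
  unfolding orbit_conf_def using finite_perms by simp

lemma action_finiteD:
  assumes "action \<beta> a b P Q G X < \<infinity>"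
  shows "H1_on a b X" "X a \<in> orbit_conf P" "X b \<in> orbit_conf Q"
  using assms unfolding action_def by (auto split: if_splits)

theorem theorem5:
  fixes A P Q :: "(real ^ 'd::finite) ^ 'n::finite"
    and t\<^sub>0 t\<^sub>1 :: real
    and \<beta> :: "real \<Rightarrow> real"
  assumes "0 < t\<^sub>0" and "t\<^sub>0 < t\<^sub>1"
    and "\<And>t. t > 0 \<Longrightarrow> \<beta> t > 0"
    and "smooth_on_pos \<beta>"
  shows "Gamma_converges_uniformly t\<^sub>0 t\<^sub>1 (L_eps A \<beta> t\<^sub>0 t\<^sub>1 P Q) (L_lim A \<beta> t\<^sub>0 t\<^sub>1 P Q)"
proof -
  let ?L = "L_eps A \<beta> t\<^sub>0 t\<^sub>1 P Q" and ?Lim = "L_lim A \<beta> t\<^sub>0 t\<^sub>1 P Q"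
  let ?I = "perms :: ('n \<Rightarrow> 'n) set" and ?c = "permute_conf A"
  have sm: "(deriv ^^ k) \<beta> field_differentiable at t" if "t > 0" for k t
    using assms(4) that by (simp add: smooth_on_pos_def)
  interpret soft_max_action ?I ?c t\<^sub>0 t\<^sub>1 \<beta> "deriv \<beta>"
  proof
    show "finite ?I" by (rule finite_perms)
    show "?I \<noteq> {}" using permutes_id by blast
    show "0 < t\<^sub>0" "t\<^sub>0 < t\<^sub>1" by fact+
    fix t assume t: "t \<in> {t\<^sub>0..t\<^sub>1}"
    hence t0: "t > 0" using assms(1) by simp
    show "0 < \<beta> t" using assms(3) t0 by blast
    show "(\<beta> has_real_derivative deriv \<beta> t) (at t within {t\<^sub>0..t\<^sub>1})"
      using sm[OF t0, of 0] by (simp add: field_differentiable_derivI has_field_derivative_at_within)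
  next
    show "continuous_on {t\<^sub>0..t\<^sub>1} (deriv \<beta>)"
    proof (intro continuous_at_imp_continuous_on ballI)
      fix t assume "t \<in> {t\<^sub>0..t\<^sub>1}"
      hence "t > 0" using assms(1) by simp
      from sm[OF this, of 1] show "isCont (deriv \<beta>) t" by (simp add: field_differentiable_imp_continuous_at)
    qed
  qed
  have f_max: "f_max A = hard_max" by (intro ext) (simp add: f_max_def hard_max_def)
  have f_eps: "f_eps A \<epsilon> t = soft_max (\<epsilon> * t)" for \<epsilon> t
    by (intro ext) (simp add: f_eps_def soft_max_def card_perms)
  have grad: "gradient (f_eps A \<epsilon> t) (t *\<^sub>R y) = soft_grad \<epsilon> y" if "\<epsilon> > 0" "t > 0" for \<epsilon> t y
    unfolding f_eps using gradient_eqI[OF soft_max_gderiv[of "\<epsilon> * t" "t *\<^sub>R y"]] soft_grad_rescale[of \<epsilon> t "t *\<^sub>R y"] that by simp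
  have ext: "ext_gradient (f_max A) (t *\<^sub>R y) = ext_gradient hard_max y" if "t > 0" for t y
    unfolding f_max ext_gradient_def subdifferential_hard_max_rescale[OF that] ..
  have soft_grad_sq: "square_integrable_on t\<^sub>0 t\<^sub>1 (\<lambda>t. soft_grad \<epsilon> (z t))" if "continuous_on {t\<^sub>0..t\<^sub>1} z" for \<epsilon> z
    by (rule square_integrable_on_continuous) (rule continuous_on_compose2[OF soft_grad_continuous[of UNIV] that], simp)
  have ext_sq: "square_integrable_on t\<^sub>0 t\<^sub>1 (\<lambda>t. ext_gradient hard_max (z t))" if "continuous_on {t\<^sub>0..t\<^sub>1} z" for z
    by (rule square_integrable_on_bounded[OF ext_gradient_curve_measurable[OF that] ext_gradient_hard_max(3)])
  have L_lim_eq: "?Lim X = ennreal (energy v z (\<lambda>t. ext_gradient hard_max (z t)))"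
    if "continuous_on {t\<^sub>0..t\<^sub>1} z" "is_weak_derivative t\<^sub>0 t\<^sub>1 z v" "\<And>t. t \<in> {t\<^sub>0..t\<^sub>1} \<Longrightarrow> X t = t *\<^sub>R z t"
      "X t\<^sub>0 \<in> orbit_conf P" "X t\<^sub>1 \<in> orbit_conf Q" for X z v
    unfolding L_lim_def
    by (rule action_eq_energy[OF that(1,2,3) _ ext_sq[OF that(1)] that(4,5)]) (use that(3) ext t_pos in auto)
  have L_eps_eq: "?L \<epsilon> X = ennreal (energy v z (\<lambda>t. soft_grad \<epsilon> (z t)))"
    if "\<epsilon> > 0" "continuous_on {t\<^sub>0..t\<^sub>1} z" "is_weak_derivative t\<^sub>0 t\<^sub>1 z v" "\<And>t. t \<in> {t\<^sub>0..t\<^sub>1} \<Longrightarrow> X t = t *\<^sub>R z t"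
      "X t\<^sub>0 \<in> orbit_conf P" "X t\<^sub>1 \<in> orbit_conf Q" for \<epsilon> X z v
    unfolding L_eps_def
    by (rule action_eq_energy[OF that(2,3,4) _ soft_grad_sq[OF that(2)] that(5,6)]) (use that(4) grad[OF that(1)] t_pos in auto)
  have rescaled: "continuous_on {t\<^sub>0..t\<^sub>1} (\<lambda>t. (1 / t) *\<^sub>R X t)" "\<And>t. t \<in> {t\<^sub>0..t\<^sub>1} \<Longrightarrow> X t = t *\<^sub>R ((1 / t) *\<^sub>R X t)"
    if "continuous_on {t\<^sub>0..t\<^sub>1} X" for X :: "real \<Rightarrow> (real ^ 'd) ^ 'n"
    using that assms(1) by (auto intro!: continuous_intros)
  have rescaled_wd: "\<exists>v. is_weak_derivative t\<^sub>0 t\<^sub>1 (\<lambda>t. (1 / t) *\<^sub>R X t) v"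
    if Xc: "continuous_on {t\<^sub>0..t\<^sub>1} X" and H1: "H1_on t\<^sub>0 t\<^sub>1 X" for X :: "real \<Rightarrow> (real ^ 'd) ^ 'n"
  proof -
    obtain V where "is_weak_derivative t\<^sub>0 t\<^sub>1 X V" using H1 unfolding H1_on_def by blast
    from weak_derivative_rescaled[OF assms(1) this Xc] show ?thesis by blast
  qed
  have liminf: "?Lim X \<le> Liminf (at_right 0) (\<lambda>\<epsilon>. ?L \<epsilon> (\<X> \<epsilon>))"
    if \<X>c: "\<And>\<epsilon>. \<epsilon> > 0 \<Longrightarrow> continuous_on {t\<^sub>0..t\<^sub>1} (\<X> \<epsilon>)" and Xc: "continuous_on {t\<^sub>0..t\<^sub>1} X"
      and u: "uniform_limit {t\<^sub>0..t\<^sub>1} \<X> X (at_right 0)" for \<X> X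
  proof (rule ccontr)
    assume "\<not> ?thesis"
    hence "Liminf (at_right 0) (\<lambda>\<epsilon>. ?L \<epsilon> (\<X> \<epsilon>)) < ?Lim X" by simp
    then obtain M where M: "Liminf (at_right 0) (\<lambda>\<epsilon>. ?L \<epsilon> (\<X> \<epsilon>)) < M" "M < ?Lim X"
      using dense by blast
    have Mfin: "M < \<infinity>" using less_le_trans[OF M(2) top_greatest] by simp
    then obtain m where m: "M = ennreal m" "m \<ge> 0" by (cases M) auto
    have freq: "\<exists>\<^sub>F \<epsilon> in at_right 0. ?L \<epsilon> (\<X> \<epsilon>) < M"
    proof (rule ccontr)
      assume "\<not> ?thesis"
      hence "\<forall>\<^sub>F \<epsilon> in at_right 0. M \<le> ?L \<epsilon> (\<X> \<epsilon>)" by (simp add: not_frequently not_less)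
      hence "M \<le> Liminf (at_right 0) (\<lambda>\<epsilon>. ?L \<epsilon> (\<X> \<epsilon>))" by (rule Liminf_bounded)
      thus False using M(1) by simp
    qed
    \<comment> \<open>A member of the family that is close to \<open>X\<close>, has small parameter, and has action below \<open>M\<close>.\<close>
    have pick: "\<exists>\<epsilon>. 0 < \<epsilon> \<and> \<epsilon> \<le> e \<and> (\<forall>t\<in>{t\<^sub>0..t\<^sub>1}. norm (\<X> \<epsilon> t - X t) \<le> e) \<and> ?L \<epsilon> (\<X> \<epsilon>) < M"
      if e: "e > 0" for e
    proof -
      have "\<forall>\<^sub>F \<epsilon> in at_right 0. \<forall>t\<in>{t\<^sub>0..t\<^sub>1}. dist (\<X> \<epsilon> t) (X t) < e" by (rule uniform_limitD[OF u e])
      moreover have "\<forall>\<^sub>F \<epsilon> in at_right (0::real). 0 < \<epsilon> \<and> \<epsilon> < e"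
        using eventually_at_right_less eventually_at_right_real[OF e] by eventually_elim auto
      ultimately have "\<forall>\<^sub>F \<epsilon> in at_right 0. 0 < \<epsilon> \<and> \<epsilon> \<le> e \<and> (\<forall>t\<in>{t\<^sub>0..t\<^sub>1}. norm (\<X> \<epsilon> t - X t) \<le> e)"
        by eventually_elim (auto simp: dist_norm less_imp_le)
      from frequently_ex[OF frequently_eventually_frequently[OF freq this]] show ?thesis by blast
    qed
    have fin: "?L \<epsilon> (\<X> \<epsilon>) < \<infinity>" if "?L \<epsilon> (\<X> \<epsilon>) < M" for \<epsilon>
      using that Mfin by (rule less_trans)
    \<comment> \<open>The orbits are finite, hence closed, so that the endpoint conditions pass to the limit.\<close>
    have endpoint: "X s \<in> S"
      if s: "s \<in> {t\<^sub>0..t\<^sub>1}" and S: "finite S"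
        and mem: "\<And>\<epsilon>. action \<beta> t\<^sub>0 t\<^sub>1 P Q (\<lambda>t. gradient (f_eps A \<epsilon> t)) (\<X> \<epsilon>) < \<infinity> \<Longrightarrow> \<X> \<epsilon> s \<in> S" for s S
    proof -
      have "\<exists>y\<in>S. dist y (X s) < e" if e: "e > 0" for e
      proof -
        from pick[of "e/2"] e obtain \<epsilon> where
          \<epsilon>: "\<forall>t\<in>{t\<^sub>0..t\<^sub>1}. norm (\<X> \<epsilon> t - X t) \<le> e/2" "?L \<epsilon> (\<X> \<epsilon>) < M" by auto
        have "\<X> \<epsilon> s \<in> S" by (rule mem[OF fin[OF \<epsilon>(2), unfolded L_eps_def]])
        moreover have "dist (\<X> \<epsilon> s) (X s) \<le> e / 2" using bspec[OF \<epsilon>(1) s] by (simp add: dist_norm)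
        hence "dist (\<X> \<epsilon> s) (X s) < e" using e by linarith
        ultimately show ?thesis by blast
      qed
      thus ?thesis using closed_approachable[OF finite_imp_closed[OF S]] by blast
    qed
    have end0: "X t\<^sub>0 \<in> orbit_conf P"
      by (rule endpoint[of t\<^sub>0 "orbit_conf P", OF _ finite_orbit_conf]) (use assms(2) in simp, erule action_finiteD(2))
    have end1: "X t\<^sub>1 \<in> orbit_conf Q"
      by (rule endpoint[of t\<^sub>1 "orbit_conf Q", OF _ finite_orbit_conf]) (use assms(2) in simp, erule action_finiteD(3))
    let ?z = "\<lambda>t. (1 / t) *\<^sub>R X t"
    have "\<exists>v. is_weak_derivative t\<^sub>0 t\<^sub>1 ?z v \<and> energy v ?z (\<lambda>t. ext_gradient hard_max (?z t)) \<le> m"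
    proof (rule energy_liminf[OF rescaled(1)[OF Xc]])
      show "0 \<le> 1 / t\<^sub>0" using assms(1) by simp
      fix n
      obtain \<epsilon> where \<epsilon>: "0 < \<epsilon>" "\<epsilon> \<le> 1 / real (Suc n)" "\<And>t. t \<in> {t\<^sub>0..t\<^sub>1} \<Longrightarrow> norm (\<X> \<epsilon> t - X t) \<le> 1 / real (Suc n)"
        and lt: "?L \<epsilon> (\<X> \<epsilon>) < M" using pick[of "1 / real (Suc n)"] by auto
      note D = action_finiteD[OF fin[OF lt, unfolded L_eps_def]]
      let ?z' = "\<lambda>t. (1 / t) *\<^sub>R \<X> \<epsilon> t"
      obtain v' where v': "is_weak_derivative t\<^sub>0 t\<^sub>1 ?z' v'" using rescaled_wd[OF \<X>c[OF \<epsilon>(1)] D(1)] by blast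
      note R = rescaled[OF \<X>c[OF \<epsilon>(1)]]
      have "ennreal (energy v' ?z' (\<lambda>t. soft_grad \<epsilon> (?z' t))) < ennreal m"
        using lt L_eps_eq[OF \<epsilon>(1) R(1) v' R(2) D(2,3)] m(1) by simp
      hence le: "energy v' ?z' (\<lambda>t. soft_grad \<epsilon> (?z' t)) \<le> m" using m(2) by (simp add: ennreal_less_iff energy_nonneg)
      have near: "norm (?z' t - ?z t) \<le> (1 / t\<^sub>0) / real (Suc n)" if t: "t \<in> {t\<^sub>0..t\<^sub>1}" for t
      proof -
        have tp: "0 < t" "t\<^sub>0 \<le> t" using t assms(1) by auto
        have "norm (?z' t - ?z t) = (1 / t) * norm (\<X> \<epsilon> t - X t)"
          using tp by (simp only: scaleR_diff_right[symmetric] norm_scaleR) simp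
        also have "\<dots> \<le> (1 / t\<^sub>0) * (1 / real (Suc n))"
          using tp assms(1) \<epsilon>(3)[OF t] by (intro mult_mono frac_le) auto
        finally show ?thesis by simp
      qed
      show "\<exists>\<epsilon> z' v'. 0 < \<epsilon> \<and> \<epsilon> \<le> 1 / real (Suc n) \<and> is_weak_derivative t\<^sub>0 t\<^sub>1 z' v' \<and> continuous_on {t\<^sub>0..t\<^sub>1} z' \<and>
         (\<forall>t\<in>{t\<^sub>0..t\<^sub>1}. norm (z' t - ?z t) \<le> (1 / t\<^sub>0) / real (Suc n)) \<and> energy v' z' (\<lambda>t. soft_grad \<epsilon> (z' t)) \<le> m"
        by (rule exI[of _ \<epsilon>], rule exI[of _ ?z'], rule exI[of _ v'], intro conjI ballI \<epsilon>(1,2) v' R(1) near le)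
    qed
    then obtain v where v: "is_weak_derivative t\<^sub>0 t\<^sub>1 ?z v" "energy v ?z (\<lambda>t. ext_gradient hard_max (?z t)) \<le> m" by blast
    have "?Lim X = ennreal (energy v ?z (\<lambda>t. ext_gradient hard_max (?z t)))"
      by (rule L_lim_eq[OF rescaled(1)[OF Xc] v(1) rescaled(2)[OF Xc] end0 end1])
    also have "\<dots> \<le> M" unfolding m(1) by (rule ennreal_leI[OF v(2)])
    finally have "?Lim X \<le> M" .
    thus False using M(2) by simp
  qed
  have limsup: "\<exists>\<X>. (\<forall>\<epsilon>>0. continuous_on {t\<^sub>0..t\<^sub>1} (\<X> \<epsilon>)) \<and> uniform_limit {t\<^sub>0..t\<^sub>1} \<X> X (at_right 0) \<and>
      Limsup (at_right 0) (\<lambda>\<epsilon>. ?L \<epsilon> (\<X> \<epsilon>)) \<le> ?Lim X"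
    if Xc: "continuous_on {t\<^sub>0..t\<^sub>1} X" for X
  proof (cases "H1_on t\<^sub>0 t\<^sub>1 X \<and> X t\<^sub>0 \<in> orbit_conf P \<and> X t\<^sub>1 \<in> orbit_conf Q")
    case False
    hence "?Lim X = \<infinity>" unfolding L_lim_def action_def by (simp only: if_False)
    thus ?thesis using Xc by (intro exI[of _ "\<lambda>\<epsilon>. X"]) (auto intro: uniform_limit_const)
  next
    case True
    let ?z = "\<lambda>t. (1 / t) *\<^sub>R X t"
    note R = rescaled[OF Xc]
    obtain v where v: "is_weak_derivative t\<^sub>0 t\<^sub>1 ?z v" using rescaled_wd[OF Xc] True by blast
    have Lim: "?Lim X = ennreal (energy v ?z (\<lambda>t. ext_gradient hard_max (?z t)))"
      by (rule L_lim_eq[OF R(1) v R(2)]) (use True in auto)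
    obtain z\<epsilon> v\<epsilon> \<kappa> U where z\<epsilon>: "\<And>\<epsilon>. \<epsilon> > 0 \<Longrightarrow> is_weak_derivative t\<^sub>0 t\<^sub>1 (z\<epsilon> \<epsilon>) (v\<epsilon> \<epsilon>)" "\<And>\<epsilon>. \<epsilon> > 0 \<Longrightarrow> continuous_on {t\<^sub>0..t\<^sub>1} (z\<epsilon> \<epsilon>)"
        "\<And>\<epsilon>. z\<epsilon> \<epsilon> t\<^sub>0 = ?z t\<^sub>0" "\<And>\<epsilon>. z\<epsilon> \<epsilon> t\<^sub>1 = ?z t\<^sub>1"
        "\<And>\<epsilon> t. \<epsilon> > 0 \<Longrightarrow> t \<in> {t\<^sub>0..t\<^sub>1} \<Longrightarrow> norm (z\<epsilon> \<epsilon> t - ?z t) \<le> sqrt \<epsilon> * \<kappa>"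
      and U: "\<And>\<epsilon>. \<epsilon> > 0 \<Longrightarrow> energy (v\<epsilon> \<epsilon>) (z\<epsilon> \<epsilon>) (\<lambda>t. soft_grad \<epsilon> (z\<epsilon> \<epsilon> t)) \<le> U \<epsilon>"
        "(U \<longlongrightarrow> energy v ?z (\<lambda>t. ext_gradient hard_max (?z t))) (at_right (0::real))"
      by (rule energy_limsup[OF v R(1)]) (rule that; assumption)
    define \<X> where "\<X> \<epsilon> t = t *\<^sub>R z\<epsilon> \<epsilon> t" for \<epsilon> t
    have ends: "\<X> \<epsilon> t\<^sub>0 = X t\<^sub>0" "\<X> \<epsilon> t\<^sub>1 = X t\<^sub>1" for \<epsilon>
      unfolding \<X>_def z\<epsilon>(3,4) using assms(1,2) by simp_all
    have L: "?L \<epsilon> (\<X> \<epsilon>) \<le> ennreal (U \<epsilon>)" if "\<epsilon> > 0" for \<epsilon>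
    proof -
      have "?L \<epsilon> (\<X> \<epsilon>) = ennreal (energy (v\<epsilon> \<epsilon>) (z\<epsilon> \<epsilon>) (\<lambda>t. soft_grad \<epsilon> (z\<epsilon> \<epsilon> t)))"
        by (rule L_eps_eq[OF that z\<epsilon>(2,1)[OF that]]) (use ends True in \<open>auto simp: \<X>_def\<close>)
      thus ?thesis using U(1)[OF that] by (simp add: ennreal_leI)
    qed
    have pos: "\<forall>\<^sub>F \<epsilon> in at_right (0::real). \<epsilon> > 0" by (rule eventually_at_right_less)
    show ?thesis
    proof (intro exI[of _ \<X>] conjI allI impI)
      show "continuous_on {t\<^sub>0..t\<^sub>1} (\<X> \<epsilon>)" if "\<epsilon> > 0" for \<epsilon>
        unfolding \<X>_def using z\<epsilon>(2)[OF that] by (intro continuous_intros)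
      show "uniform_limit {t\<^sub>0..t\<^sub>1} \<X> X (at_right 0)"
      proof (rule uniform_limitI)
        fix e :: real assume e: "e > 0"
        have "((\<lambda>\<epsilon>. t\<^sub>1 * (sqrt \<epsilon> * \<kappa>)) \<longlongrightarrow> t\<^sub>1 * (sqrt 0 * \<kappa>)) (at_right 0)" by (intro tendsto_intros)
        hence "\<forall>\<^sub>F \<epsilon> in at_right 0. t\<^sub>1 * (sqrt \<epsilon> * \<kappa>) < e" using e by (intro order_tendstoD(2)) auto
        with pos show "\<forall>\<^sub>F \<epsilon> in at_right 0. \<forall>t\<in>{t\<^sub>0..t\<^sub>1}. dist (\<X> \<epsilon> t) (X t) < e"
        proof eventually_elim
          case (elim \<epsilon>)
          show ?case
          proof
            fix t assume t: "t \<in> {t\<^sub>0..t\<^sub>1}"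
            have "dist (\<X> \<epsilon> t) (X t) = norm (t *\<^sub>R (z\<epsilon> \<epsilon> t - ?z t))"
              using t_pos[OF t] by (simp add: dist_norm \<X>_def scaleR_diff_right)
            also have "\<dots> = t * norm (z\<epsilon> \<epsilon> t - ?z t)" using t_pos[OF t] by simp
            also have "\<dots> \<le> t\<^sub>1 * (sqrt \<epsilon> * \<kappa>)"
              using t t_pos[OF t] z\<epsilon>(5)[OF elim(1) t] by (intro mult_mono) auto
            finally show "dist (\<X> \<epsilon> t) (X t) < e" using elim(2) by linarith
          qed
        qed
      qed
      have "Limsup (at_right 0) (\<lambda>\<epsilon>. ?L \<epsilon> (\<X> \<epsilon>)) \<le> Limsup (at_right 0) (\<lambda>\<epsilon>. ennreal (U \<epsilon>))"
        by (rule Limsup_mono) (use pos L in \<open>auto elim: eventually_mono\<close>)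
      also have "\<dots> = ?Lim X"
        unfolding Lim by (rule lim_imp_Limsup[OF _ tendsto_ennrealI[OF U(2)]]) simp
      finally show "Limsup (at_right 0) (\<lambda>\<epsilon>. ?L \<epsilon> (\<X> \<epsilon>)) \<le> ?Lim X" .
    qed
  qed
  show ?thesis unfolding Gamma_converges_uniformly_def using liminf limsup by blast
qed

end
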